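(* For each integer $k>1$ and each real number $b\in(0,1)$ there exists a real number $a>0$ such that $$G(z)=\frac{z^{k+1}(z^k-a^k)}{a^kz^k-1},\qquad dh=\frac{b^{2k}z^{k-1}(z^k-a^k)(a^kz^k-1)}{a^k(z^k-b^k)^2(b^kz^k-1)^2}\,dz$$ is the Weierstrass data for a minimal surface on $\Sigma=\overline{\mathbb{C}}\setminus\left(\{0,\infty\}\cup\{z\in\mathbb{C}: z^k=b^k\}\cup\{z\in\mathbb{C}: z^k=1/b^k\}\right)$ which has horizontal planar ends at $z=0$ and $z=\infty$, an upward pointing non-vertical catenoid end at each solution of $z^k=b^k$, and a downward pointing non-vertical catenoid end at each solution of $z^k=1/b^k$.
   Context: Let $\overline{\mathbb{C}}$ be the Riemann sphere and $\Sigma=\overline{\mathbb{C}}\setminus\{p_1,\dots,p_n\}$ a punctured sphere. Let $G$ be a meromorphic function and $dh$ a meromorphic one-form (the height differential) on $\overline{\mathbb{C}}$. The pair $(G,dh)$ is the Weierstrass data for a minimal surface on $\Sigma$ if the following two conditions hold. (i) (Period problem) The map $X:\Sigma\to\mathbb{R}^3$, $$X(z)=\operatorname{Re}\int_{z_0}^z\left(\frac12\left(\frac1G-G\right)dh,\ \frac i2\left(\frac1G+G\right)dh,\ dh\right),\qquad z_0\in\Sigma,$$ is well defined, i.e. the real part of the integral of this triple over every closed curve in $\Sigma$ is $(0,0,0)$. Equivalently, at every puncture $p_j$ the residues of $\left(\frac1G-G\right)dh$, $i\left(\frac1G+G\right)dh$ and $dh$ are real. (ii) (Regularity) $dh$ is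 holomorphic on $\Sigma$, and $G$ has a zero or pole at $p\in\Sigma$ if and only if $dh$ has a zero at $p$ of the same multiplicity, so that $X$ is a conformal minimal immersion. $G$ is the composition of stereographic projection with the Gauss map of $X$. $G=0$ corresponds to the downward vertical normal and $G=\infty$ to the upward vertical normal. The punctures $p_j$ are the ends of the surface. Types of ends. Let $N$ be the limiting unit normal of $X$ at an end $p_j$ (determined by $G(p_j)$). The end is a planar end (respectively a catenoid end) if $X$ restricted to a small punctured neighbourhood of $p_j$ is an embedding whose image, outside a compact set, is a graph over the exterior of a bounded domain in the plane orthogonal to $N$, with height function in the direction $N$ of the form $c\log r+d+O(1/r)$, where $r$ is the distance to the origin in that plane, and where $c=0$ for a planar end (respectively $c\neq0$ for a catenoid end). A planar end is horizontal if $N$ is vertical, i.e. $N=(0,0,\pm1)$. A catenoid end is vertical if $N=(0,0,\pm1)$ (i.e. $G(p_j)\in\{0,\infty\}$) and non-vertical otherwise. A catenoid end points in the direction $\nu\in\{N,-N\}$ for which the height in the direction $\nu$ tends to $+\infty$ at the end. It is upward pointing if the third coordinate of $\nu$ is positive and downward pointing if the third coordinate of $\nu$ is negative. *)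

theory Defs
  imports "HOL-Complex_Analysis.Complex_Analysis" "HOL-Library.Landau_Symbols"
begin

section \<open>The Riemann sphere\<close>

datatype rsphere = Fin complex | Infty

text \<open>A local parameter at each point, sending \<open>0\<close> to that point. At \<open>Infty\<close> only its values for
  \<open>w \<noteq> 0\<close> are meaningful.\<close>

fun chart :: "rsphere \<Rightarrow> complex \<Rightarrow> complex" where
  "chart (Fin p) w = p + w"
| "chart Infty w = inverse w"

text \<open>A meromorphic function on the sphere is represented by its restriction to the plane, and a
  meromorphic one-form \<open>h(z) dz\<close> by its coefficient \<open>h\<close>. The values of these at their poles are
  irrelevant.\<close>

definition meromorphic_fun_on_sphere :: "(complex \<Rightarrow> complex) \<Rightarrow> bool" where
  "meromorphic_fun_on_sphere f \<longleftrightarrow> (\<forall>p. (\<lambda>w. f (chart p w)) meromorphic_on {0})"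

definition meromorphic_form_on_sphere :: "(complex \<Rightarrow> complex) \<Rightarrow> bool" where
  "meromorphic_form_on_sphere h \<longleftrightarrow>
     (\<forall>p. (\<lambda>w. h (chart p w) * deriv (chart p) w) meromorphic_on {0})"

text \<open>\<open>zorder\<close> is unspecified for functions vanishing identically near the point, hence the first
  conjunct.\<close>

definition has_order_at :: "(complex \<Rightarrow> complex) \<Rightarrow> complex \<Rightarrow> int \<Rightarrow> bool" where
  "has_order_at f p n \<longleftrightarrow> (\<exists>\<^sub>F z in at p. f z \<noteq> 0) \<and> zorder f p = n"


section \<open>Weierstrass data\<close>

text \<open>The point at infinity is always taken to be one of the punctures, so that the punctured sphere
  is a subset of the plane.\<close>

definition punctured_sphere :: "rsphere set \<Rightarrow> complex set" where
  "punctured_sphere P = {z. Fin z \<notin> P}"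

text \<open>The real part of the integral of the Weierstrass triple along \<open>\<gamma>\<close>. At a zero or pole of \<open>G\<close> in
  the surface the first two forms are holomorphic, but the pointwise expression \<open>1 / G z\<close> or \<open>G z\<close>
  is meaningless there; \<open>remove_sings\<close> supplies the correct value.\<close>

definition weierstrass_integral ::
  "(complex \<Rightarrow> complex) \<Rightarrow> (complex \<Rightarrow> complex) \<Rightarrow> (real \<Rightarrow> complex) \<Rightarrow> real^3" where
  "weierstrass_integral G h \<gamma> = vector
     [Re (contour_integral \<gamma> (remove_sings (\<lambda>z. 1 / 2 * (1 / G z - G z) * h z))),
      Re (contour_integral \<gamma> (remove_sings (\<lambda>z. \<i> / 2 * (1 / G z + G z) * h z))),
      Re (contour_integral \<gamma> h)]"

definition weierstrass_data ::
  "rsphere set \<Rightarrow> (complex \<Rightarrow> complex) \<Rightarrow> (complex \<Rightarrow> complex) \<Rightarrow> bool" where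
  "weierstrass_data P G h \<longleftrightarrow>
     finite P \<and> Infty \<in> P \<and>
     meromorphic_fun_on_sphere G \<and> meromorphic_form_on_sphere h \<and>
     (\<forall>\<gamma>. valid_path \<gamma> \<and> path_image \<gamma> \<subseteq> punctured_sphere P \<and> pathfinish \<gamma> = pathstart \<gamma> \<longrightarrow>
        weierstrass_integral G h \<gamma> = 0) \<and>
     h holomorphic_on punctured_sphere P \<and>
     (\<forall>p\<in>punctured_sphere P. \<forall>n>0.
        (has_order_at G p n \<or> has_order_at G p (- n)) \<longleftrightarrow> has_order_at h p n)"

text \<open>The choice of path is immaterial for Weierstrass data, by the period condition.\<close>

definition weierstrass_map ::
  "rsphere set \<Rightarrow> (complex \<Rightarrow> complex) \<Rightarrow> (complex \<Rightarrow> complex) \<Rightarrow> complex \<Rightarrow> complex \<Rightarrow> real^3" where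
  "weierstrass_map P G h z0 z = weierstrass_integral G h
     (SOME \<gamma>. valid_path \<gamma> \<and> path_image \<gamma> \<subseteq> punctured_sphere P \<and>
        pathstart \<gamma> = z0 \<and> pathfinish \<gamma> = z)"


section \<open>Ends\<close>

text \<open>Inverse stereographic projection, with \<open>0\<close> corresponding to the downward normal.\<close>

definition inv_stereographic :: "complex \<Rightarrow> real^3" where
  "inv_stereographic g =
     (1 / ((cmod g)\<^sup>2 + 1)) *\<^sub>R vector [2 * Re g, 2 * Im g, (cmod g)\<^sup>2 - 1]"

definition limit_normal :: "(complex \<Rightarrow> complex) \<Rightarrow> rsphere \<Rightarrow> real^3 \<Rightarrow> bool" where
  "limit_normal G p N \<longleftrightarrow> ((\<lambda>w. inv_stereographic (G (chart p w))) \<longlongrightarrow> N) (at 0)"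

definition vertical :: "real^3 \<Rightarrow> bool" where
  "vertical N \<longleftrightarrow> N = vector [0, 0, 1] \<or> N = vector [0, 0, - 1]"

definition embedding_on :: "complex set \<Rightarrow> (complex \<Rightarrow> real^3) \<Rightarrow> bool" where
  "embedding_on U Y \<longleftrightarrow>
     (\<forall>w\<in>U. \<exists>D. (Y has_derivative D) (at w) \<and> inj D) \<and>
     (\<exists>g. homeomorphism U (Y ` U) Y g)"

definition normal_plane :: "real^3 \<Rightarrow> (real^3) set" where
  "normal_plane N = {q. q \<bullet> N = 0}"

text \<open>\<open>S\<close> is, outside a compact set, a graph over the exterior of a bounded domain of the plane
  orthogonal to the unit vector \<open>N\<close>, with height \<open>c log r + d + O(1/r)\<close>. The exterior of a domain
  is the complement of its closure.\<close>

definition log_graph :: "(real^3) set \<Rightarrow> real^3 \<Rightarrow> real \<Rightarrow> bool" where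
  "log_graph S N c \<longleftrightarrow>
     (\<exists>K \<Omega> u d. compact K \<and>
        openin (top_of_set (normal_plane N)) \<Omega> \<and> connected \<Omega> \<and> \<Omega> \<noteq> {} \<and> bounded \<Omega> \<and>
        S - K = (\<lambda>q. q + u q *\<^sub>R N) ` (normal_plane N - closure \<Omega>) \<and>
        (\<lambda>q. u q - (c * ln (norm q) + d))
          \<in> O[inf at_infinity (principal (normal_plane N))](\<lambda>q. 1 / norm q))"

definition log_end ::
  "rsphere set \<Rightarrow> (complex \<Rightarrow> complex) \<Rightarrow> (complex \<Rightarrow> real^3) \<Rightarrow> rsphere \<Rightarrow> real^3 \<Rightarrow> real \<Rightarrow> bool" where
  "log_end P G X p N c \<longleftrightarrow> p \<in> P \<and> limit_normal G p N \<and>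
     (\<exists>\<epsilon>>0. chart p ` (ball 0 \<epsilon> - {0}) \<subseteq> punctured_sphere P \<and>
        embedding_on (ball 0 \<epsilon> - {0}) (\<lambda>w. X (chart p w)) \<and>
        log_graph ((\<lambda>w. X (chart p w)) ` (ball 0 \<epsilon> - {0})) N c)"

definition planar_end ::
  "rsphere set \<Rightarrow> (complex \<Rightarrow> complex) \<Rightarrow> (complex \<Rightarrow> real^3) \<Rightarrow> rsphere \<Rightarrow> real^3 \<Rightarrow> bool" where
  "planar_end P G X p N \<longleftrightarrow> log_end P G X p N 0"

definition catenoid_end ::
  "rsphere set \<Rightarrow> (complex \<Rightarrow> complex) \<Rightarrow> (complex \<Rightarrow> real^3) \<Rightarrow> rsphere \<Rightarrow> real^3 \<Rightarrow> bool" where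
  "catenoid_end P G X p N \<longleftrightarrow> (\<exists>c. c \<noteq> 0 \<and> log_end P G X p N c)"

definition points_in_direction ::
  "(complex \<Rightarrow> real^3) \<Rightarrow> rsphere \<Rightarrow> real^3 \<Rightarrow> real^3 \<Rightarrow> bool" where
  "points_in_direction X p N \<nu> \<longleftrightarrow>
     \<nu> \<in> {N, - N} \<and> filterlim (\<lambda>w. X (chart p w) \<bullet> \<nu>) at_top (at 0)"

definition horizontal_planar_end ::
  "rsphere set \<Rightarrow> (complex \<Rightarrow> complex) \<Rightarrow> (complex \<Rightarrow> real^3) \<Rightarrow> rsphere \<Rightarrow> bool" where
  "horizontal_planar_end P G X p \<longleftrightarrow> (\<exists>N. planar_end P G X p N \<and> vertical N)"

definition upward_nonvertical_catenoid_end ::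
  "rsphere set \<Rightarrow> (complex \<Rightarrow> complex) \<Rightarrow> (complex \<Rightarrow> real^3) \<Rightarrow> rsphere \<Rightarrow> bool" where
  "upward_nonvertical_catenoid_end P G X p \<longleftrightarrow>
     (\<exists>N \<nu>. catenoid_end P G X p N \<and> \<not> vertical N \<and> points_in_direction X p N \<nu> \<and> \<nu> $ 3 > 0)"

definition downward_nonvertical_catenoid_end ::
  "rsphere set \<Rightarrow> (complex \<Rightarrow> complex) \<Rightarrow> (complex \<Rightarrow> real^3) \<Rightarrow> rsphere \<Rightarrow> bool" where
  "downward_nonvertical_catenoid_end P G X p \<longleftrightarrow>
     (\<exists>N \<nu>. catenoid_end P G X p N \<and> \<not> vertical N \<and> points_in_direction X p N \<nu> \<and> \<nu> $ 3 < 0)"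

end

theory Submission
  imports Defs
begin

text \<open>Write \<open>\<alpha> = a ^ k\<close> and \<open>\<beta> = b ^ k\<close>. The triple of Weierstrass forms is isotropic, that is, the sum of the
squares of its components is zero, and at each puncture it has a double pole, say
\<open>(v / w\<^sup>2 + r / w + \<dots>) dw\<close>. Suppose that the residue vector \<open>r\<close> is real. Then
\<open>X = Re (- v / w) + r ln \<bar>w\<bar> + smooth\<close>. By isotropy \<open>v\<close> spans, through its real and imaginary parts,
the plane orthogonal to the limit normal \<open>N\<close>, and \<open>r\<close> is a multiple of \<open>N\<close>. The projection of \<open>X\<close> to
this plane is an inversion with a Lipschitz perturbation; it expands distances near the puncture,
hence is injective, and by Brouwer's theorem it covers a neighbourhood of infinity. So the end is an
embedded graph, and its logarithmic growth is \<open>- r \<bullet> N\<close> (lemmas \<open>log_graph_of_perturbed_inversion\<close> and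
\<open>isotropic_double_pole_end\<close>). Real residues also solve the period problem, by the residue theorem
(\<open>period_phi\<close>). It remains to compute residues.

At \<open>0\<close> and infinity the residues vanish, since \<open>h / G\<close>, \<open>G * h\<close> and \<open>h\<close> are \<open>z powi (- 2)\<close>, \<open>1\<close> and
\<open>z ^ (k - 1)\<close> times functions of \<open>z ^ k\<close> and \<open>k > 1\<close>; these ends are planar. At a root \<open>\<zeta>\<close> of
\<open>\<zeta> ^ k = \<tau>\<close>, where \<open>\<tau>\<close> is \<open>\<beta>\<close> or \<open>1 / \<beta>\<close>, the residue of \<open>h\<close> is real and those of \<open>h / G\<close> and \<open>G * h\<close> are
\<open>c1 / \<zeta>\<close> and \<open>c2 * \<zeta>\<close> with real \<open>c1\<close> and \<open>c2\<close> that are the same for all \<open>k\<close> roots. The first two residues of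
the triple are real if and only if \<open>c1 + \<bar>\<zeta>\<bar>\<^sup>2 * c2 = 0\<close>. The forms are invariant under
\<open>\<beta> \<mapsto> 1 / \<beta>\<close>, and the equations for the two values of \<open>\<tau>\<close> are equivalent (\<open>balance_inverse\<close>), so one
real equation for \<open>\<alpha>\<close> is left; it has a solution with \<open>1 < \<alpha> < 1 / \<beta>\<close> by the intermediate value theorem
(\<open>exists_balanced_parameter\<close>). Finally, the residue of \<open>h\<close> is a positive multiple of
\<open>((\<alpha> * \<tau> - 1)\<^sup>2 + (\<tau> - \<alpha>)\<^sup>2) / (\<tau>\<^sup>2 - 1) ^ 3\<close>. It is negative for \<open>\<tau> = \<beta>\<close> and positive for
\<open>\<tau> = 1 / \<beta>\<close>, which makes the ends upward and downward pointing, respectively.\<close>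

section \<open>Inversion with a Lipschitz perturbation\<close>

text \<open>On a disc of radius \<open>\<epsilon>\<close> the map \<open>\<mu> / w\<close> stretches distances by at least \<open>\<bar>\<mu>\<bar> / \<epsilon>\<^sup>2\<close>, which beats any
Lipschitz constant once \<open>\<epsilon>\<close> is small. This one estimate gives injectivity, continuity of the inverse
and injectivity of the derivative of an end.\<close>

lemma inversion_plus_lipschitz_expands:
  fixes e :: "complex \<Rightarrow> complex"
  assumes e: "L-lipschitz_on (cball 0 \<epsilon>) e" and \<epsilon>: "\<epsilon> > 0"
    and x: "x \<in> cball 0 \<epsilon> - {0}" and y: "y \<in> cball 0 \<epsilon> - {0}"
  shows "(cmod \<mu> / \<epsilon>\<^sup>2 - L) * dist x y \<le> dist (\<mu> / x + e x) (\<mu> / y + e y)"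
proof -
  have xy: "0 < cmod x" "cmod x \<le> \<epsilon>" "0 < cmod y" "cmod y \<le> \<epsilon>" "x \<noteq> 0" "y \<noteq> 0"
    using x y by auto
  have "\<mu> / x - \<mu> / y = \<mu> * (y - x) / (x * y)"
    using xy by (simp add: field_simps)
  then have "dist (\<mu> / x) (\<mu> / y) = cmod \<mu> * dist x y / (cmod x * cmod y)"
    by (simp add: dist_norm norm_mult norm_divide norm_minus_commute)
  also have "\<dots> \<ge> cmod \<mu> * dist x y / \<epsilon>\<^sup>2"
    unfolding power2_eq_square using xy \<epsilon> by (intro divide_left_mono mult_mono) auto
  finally have 1: "cmod \<mu> / \<epsilon>\<^sup>2 * dist x y \<le> dist (\<mu> / x) (\<mu> / y)" by simp
  have 2: "dist (e x) (e y) \<le> L * dist x y"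
    using lipschitz_onD[OF e] x y by auto
  have "dist (\<mu> / x) (\<mu> / y) \<le> dist (\<mu> / x + e x) (\<mu> / y + e y) + dist (e x) (e y)"
    unfolding dist_norm
    by (metis (no_types, lifting) add_diff_add add_diff_cancel_right' norm_triangle_ineq4 diff_diff_eq2 add.commute)
  then show ?thesis using 1 2 by (simp add: algebra_simps)
qed

text \<open>A bounded perturbation cannot keep the inversion from covering a neighbourhood of infinity: a
preimage of \<open>q\<close> is a fixed point of \<open>w \<mapsto> \<mu> / (q - e w)\<close>, which maps the disc into itself when \<open>q\<close> is
large, so Brouwer's theorem applies.\<close>

lemma inversion_plus_bounded_onto:
  fixes e :: "complex \<Rightarrow> complex"
  assumes e: "continuous_on (cball 0 \<epsilon>) e" and M: "\<And>w. w \<in> cball 0 \<epsilon> \<Longrightarrow> cmod (e w) \<le> M"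
    and \<mu>: "\<mu> \<noteq> 0" and \<epsilon>: "\<epsilon> > 0" and q: "cmod q > M + cmod \<mu> / \<epsilon>"
  obtains w where "w \<noteq> 0" "cmod w < \<epsilon>" "cmod w \<le> cmod \<mu> / (cmod q - M)" "\<mu> / w + e w = q"
proof -
  define f where "f = (\<lambda>w. \<mu> / (q - e w))"
  have pos: "cmod \<mu> / \<epsilon> > 0" using \<mu> \<epsilon> by simp
  have low: "cmod (q - e w) \<ge> cmod q - M" if "w \<in> cball 0 \<epsilon>" for w
    using M[OF that] norm_triangle_ineq2[of q "e w"] by linarith
  have nz: "q - e w \<noteq> 0" if "w \<in> cball 0 \<epsilon>" for w
    using low[OF that] pos q by auto
  have fb: "cmod (f w) \<le> cmod \<mu> / (cmod q - M)" if "w \<in> cball 0 \<epsilon>" for w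
    unfolding f_def norm_divide using low[OF that] pos q by (intro divide_left_mono mult_pos_pos) auto
  have less: "cmod \<mu> / (cmod q - M) < \<epsilon>"
  proof -
    have X: "cmod \<mu> / \<epsilon> < cmod q - M" using q by linarith
    then have "cmod \<mu> < (cmod q - M) * \<epsilon>" using \<epsilon> by (simp only: pos_divide_less_eq)
    moreover have "cmod q - M > 0" using X pos by linarith
    ultimately show ?thesis by (simp add: pos_divide_less_eq mult.commute)
  qed
  have cont: "continuous_on (cball 0 \<epsilon>) f"
    unfolding f_def using nz by (intro continuous_intros e) auto
  obtain w where w: "w \<in> cball 0 \<epsilon>" "f w = w"
  proof (rule brouwer[OF compact_cball convex_cball _ cont])
    show "cball 0 \<epsilon> \<noteq> ({} :: complex set)" using \<epsilon> by auto
    show "f \<in> cball 0 \<epsilon> \<rightarrow> cball 0 \<epsilon>" using fb less by fastforce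
  qed
  show thesis
  proof (rule that[of w])
    show "w \<noteq> 0" using w \<mu> nz[OF w(1)] unfolding f_def by auto
    show "cmod w < \<epsilon>" "cmod w \<le> cmod \<mu> / (cmod q - M)" using fb[OF w(1)] less w by auto
    show "\<mu> / w + e w = q"
      using w(2) nz[OF w(1)] \<open>w \<noteq> 0\<close> unfolding f_def by (simp add: field_simps)
  qed
qed

lemma expanding_imp_inj_derivative:
  fixes Y :: "'a::real_normed_vector \<Rightarrow> 'b::real_normed_vector"
  assumes D: "(Y has_derivative D) (at w)" and U: "open U" "w \<in> U" and c: "c > 0"
    and ex: "\<And>x. x \<in> U \<Longrightarrow> c * dist x w \<le> dist (Y x) (Y w)"
  shows "inj D"
proof -
  have lin: "linear D" using D has_derivative_linear by blast
  have "v = 0" if v: "D v = 0" for v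
  proof (rule ccontr)
    assume "v \<noteq> 0"
    obtain r where r: "r > 0" "ball w r \<subseteq> U" using U open_contains_ball by blast
    obtain d where d: "d > 0" "\<And>y. norm (y - w) < d \<Longrightarrow> norm (Y y - Y w - D (y - w)) \<le> c / 2 * norm (y - w)"
      using D c unfolding has_derivative_at_alt by (meson half_gt_zero)
    define t where "t = min d r / (2 * norm v)"
    have t: "t > 0" "t * norm v < d" "t * norm v < r"
      using \<open>v \<noteq> 0\<close> d(1) r(1) by (auto simp: t_def)
    let ?y = "w + t *\<^sub>R v"
    have "?y \<in> U" using r(2) t by (auto simp: dist_norm subset_iff)
    then have "c * (t * norm v) \<le> norm (Y ?y - Y w)"
      using ex[of ?y] t by (simp add: dist_norm)
    moreover have "norm (Y ?y - Y w) \<le> c / 2 * (t * norm v)"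
      using d(2)[of ?y] t v linear_cmul[OF lin, of t v] by simp
    moreover have "c * (t * norm v) > 0" using c t \<open>v \<noteq> 0\<close> by simp
    ultimately show False by linarith
  qed
  then show ?thesis using lin by (simp add: linear_injective_0)
qed

lemma expanding_imp_embedding_on:
  assumes U: "open U" and c: "c > 0"
    and diff: "\<And>w. w \<in> U \<Longrightarrow> \<exists>D. (Y has_derivative D) (at w)"
    and ex: "\<And>x y. x \<in> U \<Longrightarrow> y \<in> U \<Longrightarrow> c * dist x y \<le> dist (Y x) (Y y)"
  shows "embedding_on U Y"
proof -
  have inj: "inj_on Y U"
    using ex c by (intro inj_onI) (metis dist_eq_0_iff dist_self less_le_not_le mult_pos_pos zero_less_dist_iff)
  let ?g = "inv_into U Y"
  have "continuous_on (Y ` U) ?g"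
  proof (rule lipschitz_on_continuous_on)
    show "(1/c)-lipschitz_on (Y ` U) ?g"
    proof (rule lipschitz_onI)
      fix a b assume "a \<in> Y ` U" "b \<in> Y ` U"
      then have "c * dist (?g a) (?g b) \<le> dist a b"
        using ex[of "?g a" "?g b"] by (simp add: inv_into_into f_inv_into_f)
      then show "dist (?g a) (?g b) \<le> 1 / c * dist a b" using c by (simp add: field_simps)
    qed (use c in auto)
  qed
  moreover have "continuous_on U Y"
    using diff by (meson continuous_at_imp_continuous_on has_derivative_continuous)
  ultimately have "homeomorphism U (Y ` U) Y ?g"
    unfolding homeomorphism_def using inj by (auto simp: f_inv_into_f inv_into_f_f image_iff)
  moreover have "\<exists>D. (Y has_derivative D) (at w) \<and> inj D" if "w \<in> U" for w
    using diff[OF that] expanding_imp_inj_derivative[OF _ U that c] ex that by blast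
  ultimately show ?thesis unfolding embedding_on_def by blast
qed

text \<open>Replaces \<open>ln \<bar>w\<bar>\<close> by \<open>- ln r\<close> in the height of an end: \<open>\<mu> / w\<close> differs from the position \<open>q\<close> in the plane
by the bounded vector \<open>e\<close>, and this changes the logarithm by \<open>O(1 / r)\<close> only.\<close>

lemma ln_cmod_diff_bound:
  assumes "cmod e \<le> M" "2 * M \<le> cmod q" "q \<noteq> 0"
  shows "\<bar>ln (cmod (q - e)) - ln (cmod q)\<bar> \<le> 2 * M / cmod q"
proof -
  have q: "cmod q > 0" using assms by simp
  have M: "M \<ge> 0" using assms(1) norm_ge_zero order_trans by blast
  have a: "cmod (q - e) \<ge> cmod q / 2" using assms norm_triangle_ineq2[of q e] by linarith
  then have a0: "cmod (q - e) > 0" using q by linarith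
  have "ln (cmod (q - e)) - ln (cmod q) \<le> (cmod (q - e) - cmod q) / cmod q"
    by (rule ln_diff_le[OF a0 q])
  also have "\<dots> \<le> M / cmod q"
    using norm_triangle_ineq4[of q e] assms q by (intro divide_right_mono) auto
  also have "\<dots> \<le> 2 * M / cmod q" using M q by (intro divide_right_mono) auto
  finally have 1: "ln (cmod (q - e)) - ln (cmod q) \<le> 2 * M / cmod q" .
  have "ln (cmod q) - ln (cmod (q - e)) \<le> (cmod q - cmod (q - e)) / cmod (q - e)"
    by (rule ln_diff_le[OF q a0])
  also have "\<dots> \<le> M / cmod (q - e)"
    using norm_triangle_ineq2[of q e] assms a0 by (intro divide_right_mono) auto
  also have "\<dots> \<le> M / (cmod q / 2)" using M a q a0 by (intro divide_left_mono) auto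
  finally have 2: "ln (cmod q) - ln (cmod (q - e)) \<le> 2 * M / cmod q" by (simp add: mult.commute)
  from 1 2 show ?thesis by linarith
qed

section \<open>Logarithmic ends as graphs\<close>

locale orthonormal_frame =
  fixes e1 e2 N :: "real^3"
  assumes unit: "norm e1 = 1" "norm e2 = 1" "norm N = 1"
    and orth: "e1 \<bullet> e2 = 0" "e1 \<bullet> N = 0" "e2 \<bullet> N = 0"
begin

lemma frame_unit [simp]: "e1 \<bullet> e1 = 1" "e2 \<bullet> e2 = 1" "N \<bullet> N = 1"
  using unit by (simp_all add: norm_eq_1)

lemma frame_orthogonal [simp]: "e1 \<bullet> e2 = 0" "e1 \<bullet> N = 0" "e2 \<bullet> N = 0" "e2 \<bullet> e1 = 0" "N \<bullet> e1 = 0" "N \<bullet> e2 = 0"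
  using orth by (simp_all add: inner_commute)

lemma frame_expansion: "x = (x \<bullet> e1) *\<^sub>R e1 + (x \<bullet> e2) *\<^sub>R e2 + (x \<bullet> N) *\<^sub>R N"
proof -
  let ?B = "{e1, e2, N}"
  have ne: "e1 \<noteq> e2" "e1 \<noteq> N" "e2 \<noteq> N" using frame_unit frame_orthogonal by (metis zero_neq_one)+
  have "pairwise orthogonal ?B" by (auto simp: pairwise_def orthogonal_def)
  moreover have "0 \<notin> ?B" using frame_unit by (metis inner_zero_left insert_iff empty_iff zero_neq_one)
  ultimately have ind: "independent ?B" by (rule pairwise_orthogonal_independent)
  have "card ?B = 3" using ne by simp
  then have sp: "UNIV \<subseteq> span ?B"
    using ind by (intro card_ge_dim_independent) (auto simp: dim_UNIV)
  let ?y = "x - ((x \<bullet> e1) *\<^sub>R e1 + (x \<bullet> e2) *\<^sub>R e2 + (x \<bullet> N) *\<^sub>R N)"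
  have "orthogonal ?y b" if "b \<in> ?B" for b
    using that by (auto simp: orthogonal_def inner_diff_left inner_add_left)
  then have "orthogonal ?y ?y" using sp orthogonal_to_span by blast
  then have "?y = 0" by (simp only: orthogonal_self)
  then show ?thesis by (simp only: right_minus_eq)
qed

definition \<iota> :: "complex \<Rightarrow> real^3" where "\<iota> \<zeta> = Re \<zeta> *\<^sub>R e1 + Im \<zeta> *\<^sub>R e2"

lemma iota_inner [simp]: "\<iota> \<zeta> \<bullet> e1 = Re \<zeta>" "\<iota> \<zeta> \<bullet> e2 = Im \<zeta>" "\<iota> \<zeta> \<bullet> N = 0"
  by (simp_all add: \<iota>_def inner_add_left)

lemma linear_iota: "linear \<iota>"
  by (rule linearI) (simp_all add: \<iota>_def algebra_simps)

lemma norm_iota_plus: "(norm (\<iota> \<zeta> + t *\<^sub>R N))\<^sup>2 = (cmod \<zeta>)\<^sup>2 + t\<^sup>2"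
  unfolding cmod_power2 unfolding power2_norm_eq_inner \<iota>_def
  by (simp add: inner_add_left inner_add_right power2_eq_square)

lemma norm_iota [simp]: "norm (\<iota> \<zeta>) = cmod \<zeta>"
  using norm_iota_plus[of \<zeta> 0] by simp

lemma norm_iota_le: "cmod \<zeta> \<le> norm (\<iota> \<zeta> + t *\<^sub>R N)"
  using norm_iota_plus[of \<zeta> t] by (metis abs_le_square_iff abs_norm_cancel le_add_same_cancel1 zero_le_power2)

lemma inj_iota: "inj \<iota>"
  using linear_iota by (subst linear_injective_0) (auto, metis norm_iota norm_zero norm_eq_zero)

lemma normal_plane_iota: "normal_plane N = range \<iota>"
proof -
  have "q = \<iota> (Complex (q \<bullet> e1) (q \<bullet> e2))" if "q \<bullet> N = 0" for q
    using frame_expansion[of q] that by (simp add: \<iota>_def)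
  then show ?thesis unfolding normal_plane_def by auto
qed

lemma closure_iota_ball: "R > 0 \<Longrightarrow> closure (\<iota> ` ball 0 R) = \<iota> ` cball 0 R"
  using closure_injective_linear_image[OF linear_iota inj_iota, of "ball 0 R"] by simp

lemma iota_ball: "\<iota> ` ball 0 R = ball 0 R \<inter> normal_plane N"
  unfolding normal_plane_iota by auto

text \<open>The geometric core. The projection of \<open>Y\<close> to the plane spanned by \<open>e1\<close> and \<open>e2\<close> is an inversion with
Lipschitz perturbation, hence a bijection from a punctured disc onto a set containing the exterior
of a disc of some radius \<open>R\<close>; therefore \<open>Y\<close> is an embedding and its image is a graph there. The
height is \<open>\<rho> ln \<bar>w\<bar>\<close> up to a Lipschitz term, and \<open>\<bar>w\<bar>\<close> is comparable to \<open>1 / r\<close>, which turns \<open>\<rho>\<close> into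
the logarithmic growth \<open>- \<rho>\<close>.\<close>

lemma log_graph_of_perturbed_inversion:
  fixes \<mu> :: complex and Y E :: "complex \<Rightarrow> real^3" and \<rho> :: real
  assumes \<mu>: "\<mu> \<noteq> 0" and \<delta>: "\<delta> > 0" and E: "L-lipschitz_on (ball 0 \<delta>) E"
    and Y: "\<And>w. w \<in> ball 0 \<delta> - {0} \<Longrightarrow> Y w = \<iota> (\<mu> / w) + (\<rho> * ln (cmod w)) *\<^sub>R N + E w"
    and diff: "\<And>w. w \<in> ball 0 \<delta> - {0} \<Longrightarrow> \<exists>D. (Y has_derivative D) (at w)"
  obtains \<epsilon> where "0 < \<epsilon>" "\<epsilon> \<le> \<delta>" "embedding_on (ball 0 \<epsilon> - {0}) Y"
    "log_graph (Y ` (ball 0 \<epsilon> - {0})) N (- \<rho>)"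
proof -
  have L: "L \<ge> 0" using E lipschitz_on_nonneg by blast
  define e where "e w = Complex (E w \<bullet> e1) (E w \<bullet> e2)" for w
  define T where "T w = \<mu> / w + e w" for w
  define H where "H w = \<rho> * ln (cmod w) + E w \<bullet> N" for w
  have E_split: "E w = \<iota> (e w) + (E w \<bullet> N) *\<^sub>R N" for w
    using frame_expansion[of "E w"] by (simp add: \<iota>_def e_def)
  have YT: "Y w = \<iota> (T w) + H w *\<^sub>R N" if "w \<in> ball 0 \<delta> - {0}" for w
    using Y[OF that] E_split[of w] linear_add[OF linear_iota, of "\<mu> / w" "e w"]
    by (simp add: T_def H_def scaleR_add_left)
  have e_lip: "L-lipschitz_on (ball 0 \<delta>) e"
  proof (rule lipschitz_onI[OF _ L])
    fix x y :: complex assume xy: "x \<in> ball 0 \<delta>" "y \<in> ball 0 \<delta>"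
    have "E x - E y = \<iota> (e x - e y) + ((E x - E y) \<bullet> N) *\<^sub>R N"
    proof -
      have "E x - E y = (\<iota> (e x) + (E x \<bullet> N) *\<^sub>R N) - (\<iota> (e y) + (E y \<bullet> N) *\<^sub>R N)"
        using E_split[of x] E_split[of y] by argo
      also have "\<dots> = \<iota> (e x - e y) + ((E x - E y) \<bullet> N) *\<^sub>R N"
        by (simp add: inner_diff_left scaleR_diff_left linear_diff[OF linear_iota])
      finally show ?thesis .
    qed
    then have "cmod (e x - e y) \<le> norm (E x - E y)" by (metis norm_iota_le)
    then show "dist (e x) (e y) \<le> L * dist x y"
      using lipschitz_onD[OF E xy] by (simp add: dist_norm)
  qed
  \<comment> \<open>The last bound makes \<open>L \<epsilon>\<^sup>2\<close> smaller than \<open>\<bar>\<mu>\<bar>\<close>, the first keeps the closed disc inside the domain.\<close>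
  define \<epsilon> where "\<epsilon> = min (\<delta> / 2) (min 1 (cmod \<mu> / (2 * (L + 1))))"
  have \<epsilon>: "\<epsilon> > 0" "\<epsilon> < \<delta>" "\<epsilon> \<le> 1" using \<delta> \<mu> L by (auto simp: \<epsilon>_def)
  have "L * \<epsilon>\<^sup>2 < cmod \<mu>"
  proof -
    have "L * \<epsilon>\<^sup>2 \<le> (L + 1) * \<epsilon>"
      using L \<epsilon> by (intro mult_mono) (auto simp: power2_eq_square mult_left_le)
    also have "\<dots> \<le> (L + 1) * (cmod \<mu> / (2 * (L + 1)))"
      using L by (intro mult_left_mono) (auto simp: \<epsilon>_def)
    also have "\<dots> = cmod \<mu> / 2" using L by (simp add: field_simps)
    also have "\<dots> < cmod \<mu>" using \<mu> by simp
    finally show ?thesis .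
  qed
  then have cpos: "cmod \<mu> / \<epsilon>\<^sup>2 - L > 0" using \<epsilon>(1) by (simp add: field_simps)
  have sub: "cball 0 \<epsilon> \<subseteq> ball 0 \<delta>" using \<epsilon> by auto
  let ?U = "ball 0 \<epsilon> - {0 :: complex}"
  have Usub: "w \<in> ball 0 \<delta> - {0}" if "w \<in> ?U" for w using that \<epsilon> by auto
  have e_lip': "L-lipschitz_on (cball 0 \<epsilon>) e" using e_lip sub lipschitz_on_subset by blast
  have Texp: "(cmod \<mu> / \<epsilon>\<^sup>2 - L) * dist x y \<le> dist (T x) (T y)" if "x \<in> ?U" "y \<in> ?U" for x y
    unfolding T_def using that by (intro inversion_plus_lipschitz_expands[OF e_lip' \<epsilon>(1)]) auto
  have Tinj: "x = y" if "x \<in> ?U" "y \<in> ?U" "T x = T y" for x y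
    using Texp[OF that(1,2)] that(3) cpos
    by (metis dist_self dist_pos_lt less_le_not_le mult_pos_pos)
  have emb: "embedding_on ?U Y"
  proof (rule expanding_imp_embedding_on[OF _ cpos])
    show "open ?U" by auto
    show "\<exists>D. (Y has_derivative D) (at w)" if "w \<in> ?U" for w using diff Usub[OF that] by blast
    fix x y assume xy: "x \<in> ?U" "y \<in> ?U"
    have "Y x - Y y = \<iota> (T x - T y) + (H x - H y) *\<^sub>R N"
      using YT[OF Usub[OF xy(1)]] YT[OF Usub[OF xy(2)]] linear_diff[OF linear_iota, of "T x" "T y"]
      by (simp add: scaleR_diff_left)
    then have "dist (T x) (T y) \<le> dist (Y x) (Y y)"
      unfolding dist_norm by (metis norm_iota_le)
    then show "(cmod \<mu> / \<epsilon>\<^sup>2 - L) * dist x y \<le> dist (Y x) (Y y)" using Texp[OF xy] by linarith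
  qed
  define M where "M = norm (E 0) + L * \<epsilon>"
  have EM: "norm (E w) \<le> M" if "w \<in> cball 0 \<epsilon>" for w
  proof -
    have "norm (E w - E 0) \<le> L * norm w"
      using lipschitz_onD[OF E, of w 0] that \<epsilon>(2) \<delta> by (auto simp: dist_norm)
    also have "\<dots> \<le> L * \<epsilon>" using that L by (intro mult_left_mono) auto
    finally show ?thesis unfolding M_def using norm_triangle_sub[of "E w" "E 0"] by linarith
  qed
  have eM: "cmod (e w) \<le> M" if "w \<in> cball 0 \<epsilon>" for w
    using EM[OF that] E_split[of w] norm_iota_le[of "e w" "E w \<bullet> N"] by simp
  have M0: "M \<ge> 0" unfolding M_def using L \<epsilon>(1) by simp
  \<comment> \<open>The summand \<open>\<bar>\<mu>\<bar> / \<epsilon>\<close> is what surjectivity needs, and \<open>2 * M\<close> gives \<open>\<bar>q - e\<bar> \<ge> \<bar>q\<bar> / 2\<close> beyond \<open>R\<close>.\<close>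
  define R where "R = 2 * M + cmod \<mu> / \<epsilon>"
  have R0: "R > 0" using M0 \<mu> \<epsilon>(1) by (simp add: R_def add_nonneg_pos)
  have onto: "\<exists>w\<in>?U. T w = \<zeta> \<and> cmod w \<le> cmod \<mu> / (cmod \<zeta> - M)" if "cmod \<zeta> > R" for \<zeta>
  proof -
    have q: "cmod \<zeta> > M + cmod \<mu> / \<epsilon>" using that M0 unfolding R_def by linarith
    obtain w where "w \<noteq> 0" "cmod w < \<epsilon>" "cmod w \<le> cmod \<mu> / (cmod \<zeta> - M)" "\<mu> / w + e w = \<zeta>"
      using inversion_plus_bounded_onto[OF lipschitz_on_continuous_on[OF e_lip'] eM \<mu> \<epsilon>(1) q] by metis
    then show ?thesis unfolding T_def by (intro bexI[of _ w]) auto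
  qed
  define W where "W \<zeta> = (SOME w. w \<in> ?U \<and> T w = \<zeta>)" for \<zeta>
  have W: "W \<zeta> \<in> ?U" "T (W \<zeta>) = \<zeta>" if "cmod \<zeta> > R" for \<zeta>
    using someI_ex[of "\<lambda>w. w \<in> ?U \<and> T w = \<zeta>"] onto[OF that] unfolding W_def by blast+
  have WT: "W (T w) = w" if "w \<in> ?U" "cmod (T w) > R" for w
    using W[OF that(2)] Tinj that(1) by blast
  have W_small: "cmod (W \<zeta>) \<le> cmod \<mu> / (cmod \<zeta> - M)" if "cmod \<zeta> > R" for \<zeta>
    using onto[OF that] W[OF that] Tinj by metis
  define coord where "coord q = Complex (q \<bullet> e1) (q \<bullet> e2)" for q
  have coord_iota [simp]: "coord (\<iota> \<zeta>) = \<zeta>" for \<zeta> by (simp add: coord_def)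
  define u where "u q = H (W (coord q))" for q
  \<comment> \<open>Over the disc of radius \<open>R\<close> the parameter \<open>w\<close> stays away from the puncture, so the height is bounded and this part of the end can be removed by a compact cylinder.\<close>
  define \<delta>\<^sub>0 where "\<delta>\<^sub>0 = cmod \<mu> / (R + M)"
  define B where "B = \<bar>\<rho>\<bar> * (\<bar>ln \<delta>\<^sub>0\<bar> + \<bar>ln \<epsilon>\<bar>) + M"
  have d0: "\<delta>\<^sub>0 > 0" using \<mu> R0 M0 by (simp add: \<delta>\<^sub>0_def add_pos_nonneg)
  have HB: "\<bar>H w\<bar> \<le> B" if w: "w \<in> ?U" "cmod (T w) \<le> R" for w
  proof -
    have w': "cmod w > 0" "cmod w < \<epsilon>" "w \<in> cball 0 \<epsilon>" using w by auto
    have "cmod (\<mu> / w) \<le> R + M"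
      using w(2) eM[OF w'(3)] norm_triangle_ineq4[of "T w" "e w"] unfolding T_def by simp
    then have "cmod \<mu> \<le> (R + M) * cmod w" using w' by (simp add: norm_divide pos_divide_le_eq)
    then have "\<delta>\<^sub>0 \<le> cmod w" unfolding \<delta>\<^sub>0_def using R0 M0 by (simp add: pos_divide_le_eq mult.commute)
    then have "ln \<delta>\<^sub>0 \<le> ln (cmod w)" "ln (cmod w) \<le> ln \<epsilon>" using d0 w' by auto
    then have "\<bar>ln (cmod w)\<bar> \<le> \<bar>ln \<delta>\<^sub>0\<bar> + \<bar>ln \<epsilon>\<bar>" by linarith
    then have "\<bar>\<rho> * ln (cmod w)\<bar> \<le> \<bar>\<rho>\<bar> * (\<bar>ln \<delta>\<^sub>0\<bar> + \<bar>ln \<epsilon>\<bar>)"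
      unfolding abs_mult by (intro mult_left_mono) auto
    moreover have "\<bar>E w \<bullet> N\<bar> \<le> M"
      using Cauchy_Schwarz_ineq2[of "E w" N] EM[OF w'(3)] unit by simp
    ultimately show ?thesis unfolding H_def B_def by linarith
  qed
  define K where "K = {x :: real^3. norm (x - (x \<bullet> N) *\<^sub>R N) \<le> R \<and> \<bar>x \<bullet> N\<bar> \<le> B}"
  have "compact K"
  proof -
    have "closed K" unfolding K_def
      by (intro closed_Collect_conj closed_Collect_le continuous_intros)
    moreover have "norm x \<le> R + B" if "x \<in> K" for x
    proof -
      have "norm x \<le> norm (x - (x \<bullet> N) *\<^sub>R N) + norm ((x \<bullet> N) *\<^sub>R N)" 
        using norm_triangle_ineq[of "x - (x \<bullet> N) *\<^sub>R N" "(x \<bullet> N) *\<^sub>R N"] by simp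
      then show ?thesis using that unit by (simp add: K_def)
    qed
    ultimately show ?thesis unfolding compact_eq_bounded_closed bounded_iff by blast
  qed
  have YN: "Y w \<bullet> N = H w" "Y w - (Y w \<bullet> N) *\<^sub>R N = \<iota> (T w)" if "w \<in> ?U" for w
    using YT[OF Usub[OF that]] by (auto simp: inner_add_left)
  have notK: "Y w \<notin> K \<longleftrightarrow> cmod (T w) > R" if "w \<in> ?U" for w
  proof -
    have "norm (Y w - (Y w \<bullet> N) *\<^sub>R N) = cmod (T w)" by (simp only: YN(2)[OF that] norm_iota)
    then show ?thesis using HB[OF that] YN(1)[OF that]
      by (cases "cmod (T w) \<le> R") (auto simp: K_def not_le)
  qed
  have plane: "normal_plane N - closure (\<iota> ` ball 0 R) = \<iota> ` {\<zeta>. cmod \<zeta> > R}"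
  proof -
    have "{\<zeta> :: complex. cmod \<zeta> > R} = UNIV - cball 0 R" by auto
    then show ?thesis
      unfolding closure_iota_ball[OF R0] normal_plane_iota by (simp only: image_set_diff[OF inj_iota])
  qed
  have graph: "Y ` ?U - K = (\<lambda>q. q + u q *\<^sub>R N) ` (normal_plane N - closure (\<iota> ` ball 0 R))"
  proof -
    have "Y w = \<iota> (T w) + u (\<iota> (T w)) *\<^sub>R N" if "w \<in> ?U" "cmod (T w) > R" for w
      unfolding u_def coord_iota WT[OF that] using YT[OF Usub[OF that(1)]] .
    moreover have "\<iota> \<zeta> + u (\<iota> \<zeta>) *\<^sub>R N = Y (W \<zeta>)" if "cmod \<zeta> > R" for \<zeta>
      unfolding u_def coord_iota using YT[OF Usub[OF W(1)[OF that]]] W(2)[OF that] by simp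
    moreover have "Y ` ?U - K = Y ` {w \<in> ?U. cmod (T w) > R}" using notK by blast
    moreover have "Y ` {w \<in> ?U. cmod (T w) > R} \<subseteq> (\<lambda>\<zeta>. \<iota> \<zeta> + u (\<iota> \<zeta>) *\<^sub>R N) ` {\<zeta>. cmod \<zeta> > R}"
      using calculation(1) by (intro image_subsetI) (simp add: image_iff, metis)
    moreover have "(\<lambda>\<zeta>. \<iota> \<zeta> + u (\<iota> \<zeta>) *\<^sub>R N) ` {\<zeta>. cmod \<zeta> > R} \<subseteq> Y ` {w \<in> ?U. cmod (T w) > R}"
      using calculation(2) W by (intro image_subsetI) (auto intro!: imageI)
    ultimately show ?thesis unfolding plane image_image by (intro equalityI) simp_all
  qed
  have asym: "(\<lambda>q. u q - (- \<rho> * ln (norm q) + (\<rho> * ln (cmod \<mu>) + E 0 \<bullet> N)))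
          \<in> O[inf at_infinity (principal (normal_plane N))](\<lambda>q. 1 / norm q)"
  proof (rule landau_o.bigI)
    let ?C = "\<bar>\<rho>\<bar> * (2 * M) + L * (2 * cmod \<mu>)"
    show "?C + 1 > 0" using M0 L by (simp add: add_nonneg_pos)
    have "norm (u q - (- \<rho> * ln (norm q) + (\<rho> * ln (cmod \<mu>) + E 0 \<bullet> N))) \<le> (?C + 1) * norm (1 / norm q)"
      if q: "norm q \<ge> R + 1" "q \<in> normal_plane N" for q
    proof -
      obtain \<zeta> where \<zeta>: "q = \<iota> \<zeta>" using q(2) unfolding normal_plane_iota by blast
      have n: "norm q = cmod \<zeta>" "cmod \<zeta> > R" using q \<zeta> by auto
      have z2: "2 * M \<le> cmod \<zeta>" 
      proof -
        have "cmod \<mu> / \<epsilon> \<ge> 0" using \<epsilon>(1) by simp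
        then show ?thesis using n(2) unfolding R_def by linarith
      qed
      have z0: "cmod \<zeta> > 0" using n R0 by linarith
      let ?w = "W \<zeta>"
      have w: "?w \<in> ?U" "?w \<in> cball 0 \<epsilon>" "?w \<noteq> 0" using W(1)[OF n(2)] by auto
      have "cmod ?w \<le> cmod \<mu> / (cmod \<zeta> - M)" by (rule W_small[OF n(2)])
      also have "\<dots> \<le> cmod \<mu> / (cmod \<zeta> / 2)" 
      proof -
        have "cmod \<zeta> - M \<ge> cmod \<zeta> / 2" "cmod \<zeta> - M > 0" using z2 z0 M0 by linarith+
        then show ?thesis using z0 by (intro divide_left_mono mult_pos_pos) (linarith | simp)+
      qed
      finally have ws: "cmod ?w \<le> 2 * cmod \<mu> / cmod \<zeta>" by (simp add: mult.commute)
      have "\<mu> / ?w = \<zeta> - e ?w" using W(2)[OF n(2)] unfolding T_def by (simp add: algebra_simps)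
      then have "cmod \<mu> / cmod ?w = cmod (\<zeta> - e ?w)" by (metis norm_divide)
      moreover have "ln (cmod \<mu> / cmod ?w) = ln (cmod \<mu>) - ln (cmod ?w)"
        using \<mu> w(3) by (simp add: ln_div)
      ultimately have lnw: "ln (cmod ?w) = ln (cmod \<mu>) - ln (cmod (\<zeta> - e ?w))" by simp
      have "\<bar>ln (cmod (\<zeta> - e ?w)) - ln (cmod \<zeta>)\<bar> \<le> 2 * M / cmod \<zeta>"
        using ln_cmod_diff_bound[OF eM[OF w(2)] z2] z0 by auto
      then have 1: "\<bar>\<rho> * (ln (cmod (\<zeta> - e ?w)) - ln (cmod \<zeta>))\<bar> \<le> \<bar>\<rho>\<bar> * (2 * M / cmod \<zeta>)"
        unfolding abs_mult by (intro mult_left_mono) auto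
      have "norm (E ?w - E 0) \<le> L * cmod ?w"
        using lipschitz_onD[OF E, of ?w 0] w \<epsilon>(2) \<delta> by (auto simp: dist_norm)
      also have "\<dots> \<le> L * (2 * cmod \<mu> / cmod \<zeta>)" using ws L by (intro mult_left_mono)
      finally have 2: "\<bar>(E ?w - E 0) \<bullet> N\<bar> \<le> L * (2 * cmod \<mu> / cmod \<zeta>)"
        using Cauchy_Schwarz_ineq2[of "E ?w - E 0" N] unit by simp
      have "u q - (- \<rho> * ln (norm q) + (\<rho> * ln (cmod \<mu>) + E 0 \<bullet> N))
         = - (\<rho> * (ln (cmod (\<zeta> - e ?w)) - ln (cmod \<zeta>))) + (E ?w - E 0) \<bullet> N"
        unfolding u_def H_def \<zeta> coord_iota norm_iota lnw by (simp add: algebra_simps inner_diff_left)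
      then have "\<bar>u q - (- \<rho> * ln (norm q) + (\<rho> * ln (cmod \<mu>) + E 0 \<bullet> N))\<bar>
         \<le> \<bar>\<rho>\<bar> * (2 * M / cmod \<zeta>) + L * (2 * cmod \<mu> / cmod \<zeta>)" using 1 2 by linarith
      also have "\<dots> = ?C * (1 / cmod \<zeta>)" by (simp add: add_divide_distrib ring_distribs)
      also have "\<dots> \<le> (?C + 1) * (1 / cmod \<zeta>)" using z0 by (intro mult_right_mono) auto
      finally show ?thesis using n z0 by simp
    qed
    then show "\<forall>\<^sub>F q in inf at_infinity (principal (normal_plane N)).
        norm (u q - (- \<rho> * ln (norm q) + (\<rho> * ln (cmod \<mu>) + E 0 \<bullet> N))) \<le> (?C + 1) * norm (1 / norm q)"
      unfolding eventually_inf_principal eventually_at_infinity by blast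
  qed
  have "log_graph (Y ` ?U) N (- \<rho>)"
    unfolding log_graph_def
  proof (intro exI conjI)
    show "compact K" by fact
    show "openin (top_of_set (normal_plane N)) (\<iota> ` ball 0 R)"
      unfolding iota_ball by (simp add: openin_open_Int Int_commute)
    show "connected (\<iota> ` ball 0 R)"
      by (rule connected_linear_image[OF linear_iota convex_connected[OF convex_ball]])
    show "\<iota> ` ball 0 R \<noteq> {}" using R0 by simp
    show "bounded (\<iota> ` ball 0 R)" unfolding iota_ball by (simp add: bounded_Int)
    show "Y ` ?U - K = (\<lambda>q. q + u q *\<^sub>R N) ` (normal_plane N - closure (\<iota> ` ball 0 R))" by (rule graph)
  qed (rule asym)
  with emb \<epsilon> show thesis by (intro that[of \<epsilon>]) auto
qed

end

section \<open>Isotropic forms with a double pole\<close>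

lemma has_derivative_ln_cmod:
  fixes w :: complex
  assumes "w \<noteq> 0"
  shows "((\<lambda>w. ln (cmod w)) has_derivative (\<lambda>t. Re (t / w))) (at w)"
proof -
  have "((\<lambda>w. ln (cmod w)) has_derivative (\<lambda>t. (w \<bullet> t / cmod w) * inverse (cmod w))) (at w)"
    using assms
    by (auto intro!: derivative_eq_intros has_derivative_norm simp: fun_eq_iff sgn_div_norm inner_commute)
       (simp_all add: divide_simps)
  moreover have "(w \<bullet> t / cmod w) * inverse (cmod w) = Re (t / w)" for t
  proof -
    have "cmod w * cmod w = Im w * Im w + Re w * Re w"
      using cmod_power2[of w] by (simp add: power2_eq_square)
    then show ?thesis
      using assms by (simp add: Re_divide inner_complex_def cmod_power2[symmetric] power2_eq_square field_simps)
  qed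
  ultimately show ?thesis by simp
qed

lemma has_derivative_Re_holomorphic:
  "(f has_field_derivative f') (at z) \<Longrightarrow> ((\<lambda>z. Re (f z)) has_derivative (\<lambda>t. Re (f' * t))) (at z)"
  unfolding has_field_derivative_def by (rule bounded_linear.has_derivative[OF bounded_linear_Re])

text \<open>Integration of the Laurent expansion \<open>\<phi> 0 / w\<^sup>2 + \<phi>' 0 / w + \<dots>\<close>. The residue \<open>\<phi>' 0\<close> being real makes
\<open>Re (\<phi>' 0 * log w)\<close> single-valued. No path appears: both sides have the same derivative on the
connected punctured disc.\<close>

lemma double_pole_primitive:
  fixes y :: "complex \<Rightarrow> real"
  assumes \<delta>: "\<delta> > 0" and \<phi>: "\<phi> holomorphic_on ball 0 \<delta>" and r: "Im (deriv \<phi> 0) = 0"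
    and y: "\<And>w. w \<in> ball 0 \<delta> - {0} \<Longrightarrow> (y has_derivative (\<lambda>t. Re (\<phi> w / w\<^sup>2 * t))) (at w)"
  obtains H where "H holomorphic_on ball 0 \<delta>"
    "\<And>w. w \<in> ball 0 \<delta> - {0} \<Longrightarrow> y w = Re (- \<phi> 0 / w) + Re (deriv \<phi> 0) * ln (cmod w) + Re (H w)"
proof -
  define g1 where "g1 = (\<lambda>w. if w = 0 then deriv \<phi> 0 else (\<phi> w - \<phi> 0) / (w - 0))"
  define g2 where "g2 = (\<lambda>w. if w = 0 then deriv g1 0 else (g1 w - g1 0) / (w - 0))"
  have g1: "g1 holomorphic_on ball 0 \<delta>"
    unfolding g1_def by (rule pole_lemma[OF \<phi>]) (use \<delta> in auto)
  have g2: "g2 holomorphic_on ball 0 \<delta>"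
    unfolding g2_def by (rule pole_lemma[OF g1]) (use \<delta> in auto)
  have expand: "\<phi> w / w\<^sup>2 = \<phi> 0 / w\<^sup>2 + deriv \<phi> 0 / w + g2 w" if "w \<noteq> 0" for w
    using that by (simp add: g1_def g2_def field_simps power2_eq_square)
  obtain H0 where H0: "\<And>w. w \<in> ball 0 \<delta> \<Longrightarrow> (H0 has_field_derivative g2 w) (at w)"
    using holomorphic_convex_primitive'[OF convex_ball open_ball g2] by (metis at_within_open open_ball)
  define d where "d = deriv \<phi> 0"
  have d: "d = complex_of_real (Re d)" using r by (simp add: d_def complex_eq_iff)
  define D where "D w = y w - (Re (- \<phi> 0 / w) + Re d * ln (cmod w) + Re (H0 w))" for w
  have D: "(D has_derivative (\<lambda>t. 0)) (at w)" if w: "w \<in> ball 0 \<delta> - {0}" for w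
  proof -
    have w0: "w \<noteq> 0" "w \<in> ball 0 \<delta>" using w by auto
    have p: "((\<lambda>w. - \<phi> 0 / w) has_field_derivative \<phi> 0 / w\<^sup>2) (at w)"
      using w0 by (auto intro!: derivative_eq_intros simp: power2_eq_square)
    have "(D has_derivative (\<lambda>t. Re (\<phi> w / w\<^sup>2 * t)
        - (Re (\<phi> 0 / w\<^sup>2 * t) + Re d * Re (t / w) + Re (g2 w * t)))) (at w)"
      unfolding D_def
      by (intro has_derivative_diff has_derivative_add has_derivative_mult_right y[OF w]
          has_derivative_Re_holomorphic[OF p] has_derivative_ln_cmod[OF w0(1)]
          has_derivative_Re_holomorphic[OF H0[OF w0(2)]])
    moreover have "Re (\<phi> w / w\<^sup>2 * t)
        - (Re (\<phi> 0 / w\<^sup>2 * t) + Re d * Re (t / w) + Re (g2 w * t)) = 0" for t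
    proof -
      have "d / w * t = of_real (Re d) * (t / w)" by (subst d) simp
      then have "Re (d / w * t) = Re (of_real (Re d) * (t / w))" by (rule arg_cong)
      then have "Re d * Re (t / w) = Re (d / w * t)"
        by (simp only: times_complex.sel Re_complex_of_real Im_complex_of_real mult_zero_left diff_zero)
      then show ?thesis unfolding expand[OF w0(1)] d_def[symmetric] by (simp add: distrib_right)
    qed
    ultimately show ?thesis by simp
  qed
  have "\<delta> / 2 \<in> ball 0 \<delta> - {0 :: complex}" using \<delta> by simp
  then have "D w = D (\<delta> / 2)" if "w \<in> ball 0 \<delta> - {0}" for w
    using D that
    by (intro has_derivative_zero_unique_connected[of "ball 0 \<delta> - {0}"])
       (auto intro!: connected_open_delete_finite)
  then have "y w = Re (- \<phi> 0 / w) + Re d * ln (cmod w) + Re (H0 w + D (\<delta> / 2))"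
    if "w \<in> ball 0 \<delta> - {0}" for w
    using that[THEN \<open>\<And>w. w \<in> ball 0 \<delta> - {0} \<Longrightarrow> D w = D (\<delta> / 2)\<close>] by (simp add: D_def)
  moreover have "H0 holomorphic_on ball 0 \<delta>" using H0 by (metis holomorphic_on_open open_ball)
  then have "(\<lambda>w. H0 w + D (\<delta> / 2)) holomorphic_on ball 0 \<delta>" by (intro holomorphic_intros)
  ultimately show thesis using that unfolding d_def by blast
qed

lemma holomorphic_imp_lipschitz_half_ball:
  assumes \<delta>: "\<delta> > 0" and H: "H holomorphic_on ball 0 \<delta>"
  obtains L where "L-lipschitz_on (ball 0 (\<delta> / 2)) H"
proof -
  have sub: "cball 0 (\<delta> / 2) \<subseteq> ball 0 \<delta>" using \<delta> by auto
  have "continuous_on (cball 0 (\<delta> / 2)) (deriv H)"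
    using holomorphic_deriv[OF H] sub by (meson continuous_on_subset holomorphic_on_imp_continuous_on open_ball)
  then have "bounded (deriv H ` cball 0 (\<delta> / 2))"
    by (intro compact_imp_bounded compact_continuous_image) auto
  then obtain B where B: "\<And>w. w \<in> cball 0 (\<delta> / 2) \<Longrightarrow> cmod (deriv H w) \<le> B"
    unfolding bounded_iff by blast
  have "B \<ge> 0" using B[of 0] \<delta> by (auto intro: order_trans[OF norm_ge_zero])
  have "B-lipschitz_on (ball 0 (\<delta> / 2)) H"
  proof (rule lipschitz_onI)
    fix x y :: complex assume xy: "x \<in> ball 0 (\<delta> / 2)" "y \<in> ball 0 (\<delta> / 2)"
    have "cmod (H x - H y) \<le> B * cmod (x - y)"
    proof (rule field_differentiable_bound[of "ball 0 (\<delta> / 2)" H "deriv H"])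
      show "(H has_field_derivative deriv H z) (at z within ball 0 (\<delta> / 2))" if "z \<in> ball 0 (\<delta> / 2)" for z
        using that holomorphic_derivI[OF H open_ball] \<delta> by (auto intro!: has_field_derivative_at_within)
    qed (use xy B in auto)
    then show "dist (H x) (H y) \<le> B * dist x y" by (simp add: dist_norm)
  qed fact
  then show thesis by (rule that)
qed

text \<open>Let \<open>v\<close> be the leading coefficient of the forms \<open>\<Phi> j w / w\<^sup>2\<close> and \<open>r\<close> the vector of residues. Comparing
coefficients in \<open>\<Sum> (\<Phi> j)\<^sup>2 = 0\<close> gives \<open>v \<bullet> v = 0\<close> and \<open>v \<bullet> r = 0\<close> for the bilinear product. The first
says that \<open>Re v\<close> and \<open>Im v\<close> are orthogonal of equal length, so that \<open>Re (- v / w)\<close> is an inversion into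
the plane orthogonal to \<open>N\<close>; the second says that the real vector \<open>r\<close> is orthogonal to that plane, so
that the logarithm contributes only to the height.\<close>

lemma isotropic_double_pole_end:
  fixes \<Phi> :: "3 \<Rightarrow> complex \<Rightarrow> complex" and Y :: "complex \<Rightarrow> real^3" and N :: "real^3"
  assumes \<delta>: "\<delta> > 0" and hol: "\<And>j. \<Phi> j holomorphic_on ball 0 \<delta>"
    and iso: "\<And>w. w \<in> ball 0 \<delta> - {0} \<Longrightarrow> (\<Sum>j\<in>UNIV. (\<Phi> j w)\<^sup>2) = 0"
    and nz: "\<exists>j. \<Phi> j 0 \<noteq> 0" and real: "\<And>j. Im (deriv (\<Phi> j) 0) = 0"
    and N: "norm N = 1" and perp: "(\<Sum>j\<in>UNIV. of_real (N $ j) * \<Phi> j 0) = 0"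
    and Y: "\<And>j w. w \<in> ball 0 \<delta> - {0} \<Longrightarrow>
      ((\<lambda>w. Y w $ j) has_derivative (\<lambda>t. Re (\<Phi> j w / w\<^sup>2 * t))) (at w)"
  defines "r \<equiv> \<chi> j. Re (deriv (\<Phi> j) 0)"
  shows "r = (r \<bullet> N) *\<^sub>R N" 
    and "\<exists>\<epsilon>>0. \<epsilon> \<le> \<delta> \<and> embedding_on (ball 0 \<epsilon> - {0}) Y \<and> log_graph (Y ` (ball 0 \<epsilon> - {0})) N (- (r \<bullet> N))"
    and "r \<bullet> N \<noteq> 0 \<Longrightarrow> filterlim (\<lambda>w. Y w \<bullet> (- sgn (r \<bullet> N) *\<^sub>R N)) at_top (at 0)"
proof -
  define U :: "real^3" where "U = (\<chi> j. Re (\<Phi> j 0))"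
  define V :: "real^3" where "V = (\<chi> j. Im (\<Phi> j 0))"
  define S where "S w = (\<Sum>j\<in>UNIV. (\<Phi> j w)\<^sup>2)" for w
  have der: "(\<Phi> j has_field_derivative deriv (\<Phi> j) 0) (at 0)" for j
    using hol \<delta> by (intro holomorphic_derivI[of _ "ball 0 \<delta>"]) auto
  have dS: "(S has_field_derivative (\<Sum>j\<in>UNIV. 2 * \<Phi> j 0 * deriv (\<Phi> j) 0)) (at 0)"
    unfolding S_def by (auto intro!: derivative_eq_intros der sum.cong)
  have ev: "\<forall>\<^sub>F w in at 0. S w = 0"
    unfolding eventually_at using iso \<delta> by (intro exI[of _ \<delta>]) (auto simp: S_def)
  have "(S \<longlongrightarrow> S 0) (at 0)" using DERIV_isCont[OF dS] by (simp add: isCont_def)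
  moreover have "(S \<longlongrightarrow> 0) (at 0)" using tendsto_eventually[OF ev] .
  ultimately have S0: "S 0 = 0" by (rule tendsto_unique[OF trivial_limit_at])
  have "\<forall>\<^sub>F w in nhds 0. S w = 0"
    using ev S0 by (simp add: eventually_nhds_conv_at)
  then have "(S has_field_derivative 0) (at 0)"
    by (subst DERIV_cong_ev[OF refl _ refl, of _ "\<lambda>_. 0"]) auto
  then have dS0: "(\<Sum>j\<in>UNIV. 2 * \<Phi> j 0 * deriv (\<Phi> j) 0) = 0" using DERIV_unique dS by blast
  have d: "deriv (\<Phi> j) 0 = of_real (r $ j)" for j using real by (simp add: r_def complex_eq_iff)
  have UV: "U \<bullet> U = V \<bullet> V" "U \<bullet> V = 0"
  proof -
    have "Re (S 0) = U \<bullet> U - V \<bullet> V"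
      by (simp add: S_def U_def V_def inner_vec_def power2_eq_square sum_subtractf)
    then show "U \<bullet> U = V \<bullet> V" using S0 by simp
    have "Im (S 0) = 2 * (U \<bullet> V)"
      by (simp add: S_def U_def V_def inner_vec_def power2_eq_square sum_distrib_left mult.commute flip: sum.distrib)
    then show "U \<bullet> V = 0" using S0 by simp
  qed
  have Ur: "U \<bullet> r = 0" "V \<bullet> r = 0"
  proof -
    have "0 = Re (\<Sum>j\<in>UNIV. 2 * \<Phi> j 0 * deriv (\<Phi> j) 0)" unfolding dS0 by simp
    also have "\<dots> = 2 * (U \<bullet> r)" by (simp add: d U_def inner_vec_def sum_distrib_left mult.assoc)
    finally show "U \<bullet> r = 0" by simp
    have "0 = Im (\<Sum>j\<in>UNIV. 2 * \<Phi> j 0 * deriv (\<Phi> j) 0)" unfolding dS0 by simp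
    also have "\<dots> = 2 * (V \<bullet> r)" by (simp add: d V_def inner_vec_def sum_distrib_left mult.assoc)
    finally show "V \<bullet> r = 0" by simp
  qed
  have UN: "U \<bullet> N = 0" "V \<bullet> N = 0"
  proof -
    have "0 = Re (\<Sum>j\<in>UNIV. of_real (N $ j) * \<Phi> j 0)" unfolding perp by simp
    also have "\<dots> = U \<bullet> N" by (simp add: U_def inner_vec_def mult.commute)
    finally show "U \<bullet> N = 0" by simp
    have "0 = Im (\<Sum>j\<in>UNIV. of_real (N $ j) * \<Phi> j 0)" unfolding perp by simp
    also have "\<dots> = V \<bullet> N" by (simp add: V_def inner_vec_def mult.commute)
    finally show "V \<bullet> N = 0" by simp
  qed
  define s where "s = norm U"
  have sV: "norm V = s" using UV(1) by (simp add: s_def norm_eq_sqrt_inner)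
  have s: "s > 0"
  proof -
    have "\<not> (U = 0 \<and> V = 0)" using nz by (auto simp: U_def V_def vec_eq_iff complex_eq_iff)
    then show ?thesis using sV by (metis norm_eq_zero s_def zero_less_norm_iff)
  qed
  \<comment> \<open>The sign in \<open>e2\<close> turns \<open>Re (- v / w)\<close> into \<open>\<iota> (- s / w)\<close>, an inversion without conjugation.\<close>
  define e1 where "e1 = (1 / s) *\<^sub>R U"
  define e2 where "e2 = (- 1 / s) *\<^sub>R V"
  interpret F: orthonormal_frame e1 e2 N
    by unfold_locales (use s sV N UV UN in \<open>auto simp: e1_def e2_def s_def\<close>)
  show r_N: "r = (r \<bullet> N) *\<^sub>R N"
  proof -
    have "r \<bullet> e1 = 0" "r \<bullet> e2 = 0" using Ur by (simp_all add: e1_def e2_def inner_commute)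
    then show ?thesis using F.frame_expansion[of r] by simp
  qed
  define \<rho> where "\<rho> = r \<bullet> N"
  have "\<exists>H. H holomorphic_on ball 0 \<delta> \<and> (\<forall>w\<in>ball 0 \<delta> - {0}.
      Y w $ j = Re (- \<Phi> j 0 / w) + r $ j * ln (cmod w) + Re (H w))" for j
  proof -
    obtain H where "H holomorphic_on ball 0 \<delta>"
      "\<And>w. w \<in> ball 0 \<delta> - {0} \<Longrightarrow> Y w $ j = Re (- \<Phi> j 0 / w) + Re (deriv (\<Phi> j) 0) * ln (cmod w) + Re (H w)"
      using double_pole_primitive[OF \<delta> hol[of j] real[of j] Y[of _ j]] by blast
    then show ?thesis by (intro exI[of _ H]) (simp add: r_def)
  qed
  then obtain H where H: "\<And>j. H j holomorphic_on ball 0 \<delta>"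
    "\<And>j w. w \<in> ball 0 \<delta> - {0} \<Longrightarrow> Y w $ j = Re (- \<Phi> j 0 / w) + r $ j * ln (cmod w) + Re (H j w)"
    by metis
  have "\<exists>L. L-lipschitz_on (ball 0 (\<delta> / 2)) (H j)" for j
    using holomorphic_imp_lipschitz_half_ball[OF \<delta> H(1)] by blast
  then obtain Lj where Lj: "\<And>j. (Lj j)-lipschitz_on (ball 0 (\<delta> / 2)) (H j)" by metis
  define E :: "complex \<Rightarrow> real^3" where "E w = (\<chi> j. Re (H j w))" for w
  define L where "L = (\<Sum>j\<in>UNIV. Lj j)"
  have E: "L-lipschitz_on (ball 0 (\<delta> / 2)) E"
  proof (rule lipschitz_onI)
    show "L \<ge> 0" unfolding L_def using Lj lipschitz_on_nonneg by (intro sum_nonneg) blast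
    fix x y :: complex assume xy: "x \<in> ball 0 (\<delta> / 2)" "y \<in> ball 0 (\<delta> / 2)"
    have "norm (E x - E y) \<le> (\<Sum>j\<in>UNIV. \<bar>(E x - E y) $ j\<bar>)" by (rule norm_le_l1_cart)
    also have "\<dots> \<le> (\<Sum>j\<in>UNIV. Lj j * dist x y)"
    proof (rule sum_mono)
      fix j
      have "\<bar>(E x - E y) $ j\<bar> = \<bar>Re (H j x - H j y)\<bar>" by (simp add: E_def)
      also have "\<dots> \<le> dist (H j x) (H j y)" unfolding dist_norm by (rule abs_Re_le_cmod)
      also have "\<dots> \<le> Lj j * dist x y" by (rule lipschitz_onD[OF Lj xy])
      finally show "\<bar>(E x - E y) $ j\<bar> \<le> Lj j * dist x y" .
    qed
    finally show "dist (E x) (E y) \<le> L * dist x y" by (simp add: dist_norm L_def sum_distrib_right)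
  qed
  have Yeq: "Y w = F.\<iota> (of_real (- s) / w) + (\<rho> * ln (cmod w)) *\<^sub>R N + E w"
    if w: "w \<in> ball 0 (\<delta> / 2) - {0}" for w
  proof -
    have io: "F.\<iota> (of_real (- s) / w) = - Re (1 / w) *\<^sub>R U + Im (1 / w) *\<^sub>R V"
      unfolding F.\<iota>_def using s by (simp add: e1_def e2_def Re_divide Im_divide)
    have "(\<rho> * ln (cmod w)) *\<^sub>R N = ln (cmod w) *\<^sub>R r" by (subst r_N) (simp add: \<rho>_def)
    moreover have "Y w = - Re (1 / w) *\<^sub>R U + Im (1 / w) *\<^sub>R V + ln (cmod w) *\<^sub>R r + E w"
    proof (rule iffD2[OF vec_eq_iff], rule allI)
      fix j
      have "Re (- \<Phi> j 0 / w) = - Re (1 / w) * U $ j + Im (1 / w) * V $ j"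
        using Re_divide[of "- \<Phi> j 0" w] by (simp add: U_def V_def Re_divide Im_divide diff_divide_distrib add_divide_distrib mult.commute)
      then show "Y w $ j = (- Re (1 / w) *\<^sub>R U + Im (1 / w) *\<^sub>R V + ln (cmod w) *\<^sub>R r + E w) $ j"
        using H(2)[of w j] w \<delta> by (simp add: E_def mult.commute)
    qed
    ultimately show ?thesis unfolding io by simp
  qed
  have diff: "\<exists>D. (Y has_derivative D) (at w)" if "w \<in> ball 0 (\<delta> / 2) - {0}" for w
  proof -
    have "w \<in> ball 0 \<delta> - {0}" using that \<delta> by auto
    note 1 = Y[OF this]
    have "(Y has_derivative (\<lambda>t. \<chi> j. Re (\<Phi> j w / w\<^sup>2 * t))) (at w)"
      unfolding has_derivative_componentwise_within[of Y]
      using 1 by (auto simp: Basis_vec_def inner_axis)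
    then show ?thesis by blast
  qed
  obtain \<epsilon> where "0 < \<epsilon>" "\<epsilon> \<le> \<delta> / 2" "embedding_on (ball 0 \<epsilon> - {0}) Y"
    "log_graph (Y ` (ball 0 \<epsilon> - {0})) N (- \<rho>)"
    using F.log_graph_of_perturbed_inversion[OF _ _ E Yeq diff] s \<delta>
    by (metis divide_pos_pos neg_equal_0_iff_equal of_real_eq_0_iff order_less_irrefl zero_less_numeral)
  then show "\<exists>\<epsilon>>0. \<epsilon> \<le> \<delta> \<and> embedding_on (ball 0 \<epsilon> - {0}) Y \<and> log_graph (Y ` (ball 0 \<epsilon> - {0})) N (- (r \<bullet> N))"
    using \<delta> unfolding \<rho>_def by (intro exI[of _ \<epsilon>]) auto
  assume "r \<bullet> N \<noteq> 0"
  then have \<rho>0: "\<bar>\<rho>\<bar> > 0" by (simp add: \<rho>_def)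
  \<comment> \<open>The height equals \<open>\<rho> * ln \<bar>w\<bar>\<close> up to a bounded term and \<open>ln \<bar>w\<bar>\<close> tends to minus infinity.\<close>
  define M where "M = norm (E 0) + L * \<delta>"
  have L0: "L \<ge> 0" using E lipschitz_on_nonneg by blast
  have lower: "- \<bar>\<rho>\<bar> * ln (cmod w) - M \<le> Y w \<bullet> (- sgn \<rho> *\<^sub>R N)" if w: "w \<in> ball 0 (\<delta> / 2) - {0}" for w
  proof -
    have "norm (E w - E 0) \<le> L * cmod w"
      using lipschitz_onD[OF E, of w 0] w \<delta> by (auto simp: dist_norm)
    also have "\<dots> \<le> L * \<delta>" using w L0 \<delta> by (intro mult_left_mono) auto
    finally have "norm (E w) \<le> M" unfolding M_def using norm_triangle_sub[of "E w" "E 0"] by linarith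
    then have "\<bar>E w \<bullet> N\<bar> \<le> M" using Cauchy_Schwarz_ineq2[of "E w" N] N by simp
    moreover have "Y w \<bullet> (- sgn \<rho> *\<^sub>R N) = - sgn \<rho> * (\<rho> * ln (cmod w)) - sgn \<rho> * (E w \<bullet> N)"
      unfolding Yeq[OF w] by (simp add: inner_add_left algebra_simps)
    moreover have "- sgn \<rho> * (\<rho> * ln (cmod w)) = - \<bar>\<rho>\<bar> * ln (cmod w)"
      by (simp add: sgn_real_def)
    moreover have "\<bar>sgn \<rho> * (E w \<bullet> N)\<bar> \<le> \<bar>E w \<bullet> N\<bar>"
      by (simp add: abs_mult sgn_real_def)
    ultimately show ?thesis by linarith
  qed
  have "filterlim (\<lambda>w::complex. - \<bar>\<rho>\<bar> * ln (cmod w) - M) at_top (at 0)"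
  proof -
    have c: "filterlim cmod (at_right 0) (at 0)"
      unfolding filterlim_at by (auto intro!: tendsto_eq_intros simp: eventually_at_filter)
    have "filterlim (\<lambda>x. - \<bar>\<rho>\<bar> * ln x - M) at_top (at_right 0)" using \<rho>0 by real_asymp
    then show ?thesis using filterlim_compose[OF _ c] by blast
  qed
  moreover have "\<forall>\<^sub>F w in at 0. - \<bar>\<rho>\<bar> * ln (cmod w) - M \<le> Y w \<bullet> (- sgn \<rho> *\<^sub>R N)"
    unfolding eventually_at using lower \<delta> by (intro exI[of _ "\<delta> / 2"]) auto
  ultimately show "filterlim (\<lambda>w. Y w \<bullet> (- sgn (r \<bullet> N) *\<^sub>R N)) at_top (at 0)"
    unfolding \<rho>_def[symmetric] by (rule filterlim_at_top_mono)
qed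

section \<open>The immersion defined by Weierstrass data\<close>

text \<open>However the paths were chosen, the vanishing of the real periods lets \<open>\<gamma> y\<close> be compared with \<open>\<gamma> z\<close>
followed by the segment from \<open>z\<close> to \<open>y\<close>, on which the integral is the increment of a local primitive.\<close>

lemma path_integral_has_derivative:
  assumes S: "open S" and f: "f holomorphic_on S" and z: "z \<in> S"
    and path: "\<And>y. y \<in> S \<Longrightarrow> valid_path (\<gamma> y) \<and> path_image (\<gamma> y) \<subseteq> S \<and> pathstart (\<gamma> y) = z0 \<and> pathfinish (\<gamma> y) = y"
    and period: "\<And>\<gamma>. valid_path \<gamma> \<Longrightarrow> path_image \<gamma> \<subseteq> S \<Longrightarrow> pathfinish \<gamma> = pathstart \<gamma> \<Longrightarrow> Re (contour_integral \<gamma> f) = 0"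
  shows "((\<lambda>y. Re (contour_integral (\<gamma> y) f)) has_derivative (\<lambda>t. Re (f z * t))) (at z)"
proof -
  obtain e where e: "e > 0" "ball z e \<subseteq> S" using S z open_contains_ball by blast
  have hb: "f holomorphic_on ball z e" using f e(2) holomorphic_on_subset by blast
  obtain F where F: "\<And>x. x \<in> ball z e \<Longrightarrow> (F has_field_derivative f x) (at x within ball z e)"
    using holomorphic_convex_primitive'[OF convex_ball open_ball hb] by blast
  have int: "f contour_integrable_on \<gamma>" if "valid_path \<gamma>" "path_image \<gamma> \<subseteq> S" for \<gamma>
    using contour_integrable_holomorphic_simple[OF f S that] .
  have loc: "Re (contour_integral (\<gamma> z) f) + (Re (F y) - Re (F z)) = Re (contour_integral (\<gamma> y) f)"
    if y: "y \<in> ball z e" for y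
  proof -
    have yS: "y \<in> S" using y e by blast
    note py = path[OF yS] and pz = path[OF z]
    have seg: "closed_segment z y \<subseteq> ball z e" using y e(1) by (intro closed_segment_subset) auto
    have lin: "contour_integral (linepath z y) f = F y - F z"
    proof (rule contour_integral_unique)
      show "(f has_contour_integral F y - F z) (linepath z y)"
        using contour_integral_primitive[of "ball z e" F f "linepath z y"] F seg by simp
    qed
    have iz: "f contour_integrable_on (\<gamma> z)" "f contour_integrable_on (linepath z y)" "f contour_integrable_on (\<gamma> y)"
      using int pz py seg e by (auto simp: subset_iff)
    let ?c = "\<gamma> z +++ linepath z y +++ reversepath (\<gamma> y)"
    have "Re (contour_integral ?c f) = 0"
      using pz py seg e(2) by (intro period) (auto simp: path_image_join valid_path_join)
    moreover have "contour_integral ?c f = contour_integral (\<gamma> z) f + (contour_integral (linepath z y) f - contour_integral (\<gamma> y) f)"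
      using pz py iz by (simp add: contour_integral_join valid_path_join contour_integrable_joinI contour_integrable_reversepath contour_integral_reversepath)
    ultimately show ?thesis unfolding lin by simp
  qed
  have "(F has_field_derivative f z) (at z)"
    using F[of z] e(1) by (simp add: at_within_open[OF _ open_ball])
  then have "((\<lambda>y. Re (F y)) has_derivative (\<lambda>t. Re (f z * t))) (at z)"
    by (rule has_derivative_Re_holomorphic)
  then have "((\<lambda>y. Re (contour_integral (\<gamma> z) f) + (Re (F y) - Re (F z))) has_derivative (\<lambda>t. Re (f z * t))) (at z)"
    using has_derivative_add[OF has_derivative_const has_derivative_diff[OF _ has_derivative_const]] by fastforce
  then show ?thesis
    by (rule has_derivative_transform_within_open[OF _ open_ball]) (use loc e in auto)
qed

lemma inv_stereographic_nth:
  "inv_stereographic g $ 1 = 2 * Re g / ((cmod g)\<^sup>2 + 1)"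
  "inv_stereographic g $ 2 = 2 * Im g / ((cmod g)\<^sup>2 + 1)"
  "inv_stereographic g $ 3 = ((cmod g)\<^sup>2 - 1) / ((cmod g)\<^sup>2 + 1)"
  by (simp_all add: inv_stereographic_def)

lemma norm_inv_stereographic [simp]: "norm (inv_stereographic g) = 1"
proof -
  have "(norm (inv_stereographic g))\<^sup>2
      = (inv_stereographic g $ 1)\<^sup>2 + (inv_stereographic g $ 2)\<^sup>2 + (inv_stereographic g $ 3)\<^sup>2"
    unfolding power2_norm_eq_inner inner_vec_def sum_3 by (simp add: power2_eq_square)
  also have "\<dots> = (4 * ((Re g)\<^sup>2 + (Im g)\<^sup>2) + ((cmod g)\<^sup>2 - 1)\<^sup>2) / ((cmod g)\<^sup>2 + 1)\<^sup>2"
    by (simp add: inv_stereographic_nth power_divide power_mult_distrib add_divide_distrib)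
  also have "\<dots> = ((cmod g)\<^sup>2 + 1)\<^sup>2 / ((cmod g)\<^sup>2 + 1)\<^sup>2"
    unfolding cmod_power2[symmetric] by (simp add: power2_eq_square algebra_simps)
  also have "\<dots> = 1" by (simp add: add_nonneg_eq_0_iff)
  finally show ?thesis by (simp add: power2_eq_1_iff) (metis norm_ge_zero not_one_le_zero neg_0_le_iff_le le_minus_one_simps(3))
qed

text \<open>Everything is expressed through \<open>q1 = \<eta> / g\<close>, \<open>q2 = g * \<eta>\<close> and \<open>\<eta>\<close>, which stay meaningful where \<open>g\<close> has a
zero or a pole.\<close>

definition weierstrass_triple :: "complex \<Rightarrow> complex \<Rightarrow> complex \<Rightarrow> complex^3" where
  "weierstrass_triple q1 q2 \<eta> = vector [1 / 2 * (q1 - q2), \<i> / 2 * (q1 + q2), \<eta>]"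

lemma weierstrass_triple_nth [simp]:
  "weierstrass_triple q1 q2 \<eta> $ 1 = 1 / 2 * (q1 - q2)"
  "weierstrass_triple q1 q2 \<eta> $ 2 = \<i> / 2 * (q1 + q2)"
  "weierstrass_triple q1 q2 \<eta> $ 3 = \<eta>"
  by (simp_all add: weierstrass_triple_def)

lemma weierstrass_triple_isotropic:
  assumes "q1 * q2 = \<eta>\<^sup>2"
  shows "(\<Sum>j\<in>UNIV. (weierstrass_triple q1 q2 \<eta> $ j)\<^sup>2) = 0"
  using assms by (simp add: sum_3 power2_eq_square field_simps)

text \<open>The Gauss map is normal to the immersion. Taken to the limit at a puncture, this shows that the
limit normal is orthogonal to the leading coefficient of the forms.\<close>

lemma weierstrass_triple_perp_normal:
  assumes "g \<noteq> 0"
  shows "(\<Sum>j\<in>UNIV. of_real (inv_stereographic g $ j) * weierstrass_triple (\<eta> / g) (g * \<eta>) \<eta> $ j) = 0"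
proof -
  have re: "complex_of_real (2 * Re g) = g + cnj g" and im: "complex_of_real (2 * Im g) = - \<i> * (g - cnj g)"
    and n: "complex_of_real ((cmod g)\<^sup>2) = g * cnj g"
    by (simp_all add: complex_eq_iff complex_norm_square[symmetric])
  have "(g + cnj g) * (1 / 2 * (\<eta> / g - g * \<eta>)) + (- \<i> * (g - cnj g)) * (\<i> / 2 * (\<eta> / g + g * \<eta>))
      + (g * cnj g - 1) * \<eta> = 0"
    using assms by (simp add: field_simps)
  then have "complex_of_real (2 * Re g) * (1 / 2 * (\<eta> / g - g * \<eta>)) + complex_of_real (2 * Im g) * (\<i> / 2 * (\<eta> / g + g * \<eta>))
      + complex_of_real ((cmod g)\<^sup>2 - 1) * \<eta> = 0" unfolding re im of_real_diff n by simp
  moreover have "inv_stereographic g $ 1 = 1 / ((cmod g)\<^sup>2 + 1) * (2 * Re g)"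
    "inv_stereographic g $ 2 = 1 / ((cmod g)\<^sup>2 + 1) * (2 * Im g)"
    "inv_stereographic g $ 3 = 1 / ((cmod g)\<^sup>2 + 1) * ((cmod g)\<^sup>2 - 1)"
    by (simp_all add: inv_stereographic_nth)
  ultimately show ?thesis
    unfolding sum_3 weierstrass_triple_nth
    by (simp only: of_real_mult mult.assoc flip: distrib_left) simp
qed

text \<open>\<open>Q1\<close> and \<open>Q2\<close> are the holomorphic extensions of \<open>h / G\<close> and \<open>G * h\<close> over the finite set \<open>Z\<close>, which
contains the zeros and poles of \<open>G\<close> in the surface.\<close>

locale weierstrass_forms =
  fixes P :: "rsphere set" and G h Q1 Q2 :: "complex \<Rightarrow> complex" and Z :: "complex set"
  assumes finP: "finite P" and InftyP: "Infty \<in> P" and finZ: "finite Z"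
    and Q1: "Q1 holomorphic_on punctured_sphere P" and Q2: "Q2 holomorphic_on punctured_sphere P"
    and h: "h holomorphic_on punctured_sphere P"
    and forms: "\<And>z. z \<in> punctured_sphere P \<Longrightarrow> z \<notin> Z \<Longrightarrow> G z \<noteq> 0 \<and> Q1 z = h z / G z \<and> Q2 z = G z * h z"
begin

abbreviation \<Sigma> :: "complex set" where "\<Sigma> \<equiv> punctured_sphere P"

definition pts :: "complex set" where "pts = {z. Fin z \<in> P}"

lemma finite_pts: "finite pts"
proof -
  have "pts = Fin -` P" by (auto simp: pts_def)
  then show ?thesis using finP by (simp add: finite_vimageI inj_def)
qed

lemma Sigma_eq: "\<Sigma> = UNIV - pts"
  by (auto simp: punctured_sphere_def pts_def)

lemma open_Sigma: "open \<Sigma>"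
  unfolding Sigma_eq by (intro open_Diff finite_imp_closed finite_pts) auto

lemma connected_Sigma: "connected \<Sigma>"
  unfolding Sigma_eq using finite_pts by (intro connected_open_delete_finite) auto

definition \<phi> :: "3 \<Rightarrow> complex \<Rightarrow> complex" where "\<phi> j z = weierstrass_triple (Q1 z) (Q2 z) (h z) $ j"

lemma holomorphic_phi: "\<phi> j holomorphic_on \<Sigma>"
proof -
  have "(\<lambda>z. \<phi> j z) holomorphic_on \<Sigma>"
    using exhaust_3[of j] by (auto simp: \<phi>_def intro!: holomorphic_intros Q1 Q2 h)
  then show ?thesis .
qed

lemma remove_sings_phi:
  assumes "\<And>z. z \<in> \<Sigma> \<Longrightarrow> z \<notin> Z \<Longrightarrow> f z = \<phi> j z" and z: "z \<in> \<Sigma>"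
  shows "remove_sings f z = \<phi> j z"
proof (rule remove_sings_eqI)
  have "open (\<Sigma> - (Z - {z}))" using open_Sigma finZ by (intro open_Diff finite_imp_closed) auto
  then have "\<forall>\<^sub>F y in at z. y \<in> \<Sigma> - Z"
    unfolding eventually_at_topological using z by (intro exI[of _ "\<Sigma> - (Z - {z})"]) auto
  then have ev: "\<forall>\<^sub>F y in at z. f y = \<phi> j y" by eventually_elim (use assms in auto)
  have "continuous_on \<Sigma> (\<phi> j)" by (rule holomorphic_on_imp_continuous_on[OF holomorphic_phi])
  then have "\<phi> j \<midarrow>z\<rightarrow> \<phi> j z"
    using continuous_on_eq_continuous_at[OF open_Sigma] z by (auto simp: isCont_def)
  then show "f \<midarrow>z\<rightarrow> \<phi> j z" by (subst tendsto_cong[OF ev])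
qed

lemma weierstrass_integral_nth:
  assumes "path_image \<gamma> \<subseteq> \<Sigma>"
  shows "weierstrass_integral G h \<gamma> $ j = Re (contour_integral \<gamma> (\<phi> j))"
proof -
  have eq: "contour_integral \<gamma> f = contour_integral \<gamma> g" if "\<And>z. z \<in> \<Sigma> \<Longrightarrow> f z = g z" for f g
    using assms that by (intro contour_integral_eq) auto
  have 1: "contour_integral \<gamma> (remove_sings (\<lambda>z. 1 / 2 * (1 / G z - G z) * h z)) = contour_integral \<gamma> (\<phi> 1)"
    by (rule eq, rule remove_sings_phi) (auto simp: \<phi>_def forms field_simps)
  have 2: "contour_integral \<gamma> (remove_sings (\<lambda>z. \<i> / 2 * (1 / G z + G z) * h z)) = contour_integral \<gamma> (\<phi> 2)"
    by (rule eq, rule remove_sings_phi) (auto simp: \<phi>_def forms field_simps)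
  have 3: "contour_integral \<gamma> h = contour_integral \<gamma> (\<phi> 3)"
    by (rule eq) (auto simp: \<phi>_def)
  show ?thesis
    unfolding weierstrass_integral_def 1 2 3 using exhaust_3[of j] by auto
qed

text \<open>The forms in the local parameter at \<open>p\<close> have at most double poles, \<open>q1\<close>, \<open>q2\<close>, \<open>\<eta>\<close> being \<open>w\<^sup>2\<close> times their
coefficients, so that the residues are the derivatives at \<open>0\<close>. The triple has a genuine double pole
unless \<open>q1\<close> and \<open>q2\<close> both vanish at \<open>0\<close>. For the residues \<open>x\<close>, \<open>y\<close> of \<open>h / G\<close> and \<open>G * h\<close>, the numbers
\<open>x - y\<close> and \<open>\<i> * (x + y)\<close> are both real exactly when \<open>cnj x = - y\<close>.\<close>

definition end_expansion :: "rsphere \<Rightarrow> real \<Rightarrow> (complex \<Rightarrow> complex) \<Rightarrow> (complex \<Rightarrow> complex) \<Rightarrow> (complex \<Rightarrow> complex) \<Rightarrow> bool" where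
  "end_expansion p \<delta> q1 q2 \<eta> \<longleftrightarrow> \<delta> > 0 \<and>
     q1 holomorphic_on ball 0 \<delta> \<and> q2 holomorphic_on ball 0 \<delta> \<and> \<eta> holomorphic_on ball 0 \<delta> \<and>
     (\<forall>w\<in>ball 0 \<delta> - {0}. chart p w \<in> \<Sigma> - Z \<and>
        q1 w = w\<^sup>2 * (Q1 (chart p w) * deriv (chart p) w) \<and>
        q2 w = w\<^sup>2 * (Q2 (chart p w) * deriv (chart p) w) \<and>
        \<eta> w = w\<^sup>2 * (h (chart p w) * deriv (chart p) w)) \<and>
     (q1 0 \<noteq> 0 \<or> q2 0 \<noteq> 0) \<and>
     cnj (deriv q1 0) = - deriv q2 0 \<and> Im (deriv \<eta> 0) = 0"

context
  fixes p \<delta> q1 q2 \<eta>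
  assumes exp: "end_expansion p \<delta> q1 q2 \<eta>"
begin

definition \<Phi> :: "3 \<Rightarrow> complex \<Rightarrow> complex" where "\<Phi> j w = weierstrass_triple (q1 w) (q2 w) (\<eta> w) $ j"

lemma \<delta>: "\<delta> > 0" 
  and q1: "q1 holomorphic_on ball 0 \<delta>" and q2: "q2 holomorphic_on ball 0 \<delta>" and \<eta>: "\<eta> holomorphic_on ball 0 \<delta>"
  and chart_w: "\<And>w. w \<in> ball 0 \<delta> - {0} \<Longrightarrow> chart p w \<in> \<Sigma> \<and> chart p w \<notin> Z"
  and q1_eq: "\<And>w. w \<in> ball 0 \<delta> - {0} \<Longrightarrow> q1 w = w\<^sup>2 * (Q1 (chart p w) * deriv (chart p) w)"
  and q2_eq: "\<And>w. w \<in> ball 0 \<delta> - {0} \<Longrightarrow> q2 w = w\<^sup>2 * (Q2 (chart p w) * deriv (chart p) w)"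
  and \<eta>_eq: "\<And>w. w \<in> ball 0 \<delta> - {0} \<Longrightarrow> \<eta> w = w\<^sup>2 * (h (chart p w) * deriv (chart p) w)"
  using exp unfolding end_expansion_def by blast+

lemma holomorphic_Phi: "\<Phi> j holomorphic_on ball 0 \<delta>"
proof -
  have "(\<lambda>w. \<Phi> j w) holomorphic_on ball 0 \<delta>"
    using exhaust_3[of j] by (auto simp: \<Phi>_def intro!: holomorphic_intros q1 q2 \<eta>)
  then show ?thesis .
qed

lemma Phi_eq: "w \<in> ball 0 \<delta> - {0} \<Longrightarrow> \<Phi> j w = w\<^sup>2 * (\<phi> j (chart p w) * deriv (chart p) w)"
  using exhaust_3[of j] by (elim disjE) (simp_all add: \<Phi>_def \<phi>_def q1_eq q2_eq \<eta>_eq algebra_simps)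

lemma Phi_isotropic:
  assumes w: "w \<in> ball 0 \<delta> - {0}"
  shows "(\<Sum>j\<in>UNIV. (\<Phi> j w)\<^sup>2) = 0"
  unfolding \<Phi>_def
proof (rule weierstrass_triple_isotropic)
  show "q1 w * q2 w = (\<eta> w)\<^sup>2"
    unfolding q1_eq[OF w] q2_eq[OF w] \<eta>_eq[OF w]
    using forms chart_w[OF w] by (simp add: power2_eq_square)
qed

lemma deriv_Phi: "deriv (\<Phi> j) 0 = weierstrass_triple (deriv q1 0) (deriv q2 0) (deriv \<eta> 0) $ j"
proof -
  have d: "(q1 has_field_derivative deriv q1 0) (at 0)" "(q2 has_field_derivative deriv q2 0) (at 0)"
    "(\<eta> has_field_derivative deriv \<eta> 0) (at 0)"
    using q1 q2 \<eta> \<delta> by (auto intro!: holomorphic_derivI[of _ "ball 0 \<delta>"])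
  have "((\<lambda>w. \<Phi> j w) has_field_derivative weierstrass_triple (deriv q1 0) (deriv q2 0) (deriv \<eta> 0) $ j) (at 0)"
    using exhaust_3[of j] by (auto simp: \<Phi>_def intro!: derivative_eq_intros d)
  then show ?thesis by (simp add: DERIV_imp_deriv)
qed

lemma deriv_Phi_real: "Im (deriv (\<Phi> j) 0) = 0"
proof -
  have "deriv q2 0 = - cnj (deriv q1 0)" "Im (deriv \<eta> 0) = 0" using exp unfolding end_expansion_def by auto
  then show ?thesis using exhaust_3[of j] by (auto simp: deriv_Phi)
qed

lemma Phi_nonzero: "\<exists>j. \<Phi> j 0 \<noteq> 0"
proof (rule ccontr)
  assume "\<not> ?thesis"
  then have "\<Phi> 1 0 = 0" "\<Phi> 2 0 = 0" by auto
  then have "q1 0 - q2 0 = 0" "q1 0 + q2 0 = 0" by (auto simp: \<Phi>_def)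
  then have "q1 0 = 0" "q2 0 = 0" by (auto simp: algebra_simps)
  then show False using exp unfolding end_expansion_def by blast
qed

lemma Phi_perp_normal:
  assumes N: "limit_normal G p N"
  shows "norm N = 1" "(\<Sum>j\<in>UNIV. of_real (N $ j) * \<Phi> j 0) = 0"
proof -
  have lim: "((\<lambda>w. inv_stereographic (G (chart p w))) \<longlongrightarrow> N) (at 0)" using N unfolding limit_normal_def .
  show "norm N = 1" using tendsto_norm[OF lim] by (simp add: tendsto_const_iff)
  have "\<Phi> j \<midarrow>0\<rightarrow> \<Phi> j 0" for j
  proof -
    have "isCont (\<Phi> j) 0"
      using holomorphic_on_imp_continuous_on[OF holomorphic_Phi[of j]] \<delta> by (simp add: continuous_on_eq_continuous_at)
    then show ?thesis by (simp add: isCont_def)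
  qed
  then have A: "((\<lambda>w. \<Sum>j\<in>UNIV. of_real (inv_stereographic (G (chart p w)) $ j) * \<Phi> j w) \<longlongrightarrow>
      (\<Sum>j\<in>UNIV. of_real (N $ j) * \<Phi> j 0)) (at 0)"
    by (intro tendsto_intros lim)
  have B: "\<forall>\<^sub>F w in at 0. (\<Sum>j\<in>UNIV. of_real (inv_stereographic (G (chart p w)) $ j) * \<Phi> j w) = 0"
    unfolding eventually_at
  proof (intro exI[of _ \<delta>] conjI ballI impI \<delta>)
    fix w :: complex assume "w \<noteq> 0 \<and> dist w 0 < \<delta>"
    then have w: "w \<in> ball 0 \<delta> - {0}" by auto
    let ?z = "chart p w"
    let ?c = "w\<^sup>2 * (h ?z * deriv (chart p) w)"
    have g: "G ?z \<noteq> 0" "Q1 ?z = h ?z / G ?z" "Q2 ?z = G ?z * h ?z" using forms chart_w[OF w] by auto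
    have "q1 w = ?c / G ?z" "q2 w = G ?z * ?c" "\<eta> w = ?c"
      unfolding q1_eq[OF w] q2_eq[OF w] \<eta>_eq[OF w] g by simp_all
    then show "(\<Sum>j\<in>UNIV. of_real (inv_stereographic (G (chart p w)) $ j) * \<Phi> j w) = 0"
      unfolding \<Phi>_def by (simp only: weierstrass_triple_perp_normal[OF g(1)])
  qed
  show "(\<Sum>j\<in>UNIV. of_real (N $ j) * \<Phi> j 0) = 0"
    by (rule tendsto_unique[OF trivial_limit_at A tendsto_eventually[OF B]])
qed

end

lemma chart_eq: "chart (Fin a) = (\<lambda>w. a + w)" "chart Infty = inverse"
  by auto

lemma residue_phi_real:
  assumes exp: "end_expansion (Fin a) \<delta> q1 q2 \<eta>"
  shows "Im (residue (\<phi> j) a) = 0"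
proof -
  let ?F = "\<Phi> q1 q2 \<eta> j"
  have hol: "?F holomorphic_on ball 0 \<delta>" and \<delta>: "\<delta> > 0" by (rule holomorphic_Phi[OF exp], rule \<delta>[OF exp])
  have dF: "(?F has_field_derivative deriv ?F 0) (at 0)"
    using hol \<delta> by (auto intro!: holomorphic_derivI[of _ "ball 0 \<delta>"])
  have ev: "\<forall>\<^sub>F z in at a. \<phi> j z = ?F (z - a) / (z - a) ^ Suc 1"
    unfolding eventually_at
  proof (intro exI[of _ \<delta>] conjI ballI impI \<delta>)
    fix z assume "z \<noteq> a \<and> dist z a < \<delta>"
    then have w: "z - a \<in> ball 0 \<delta> - {0}" by (auto simp: dist_norm norm_minus_commute)
    have "deriv (chart (Fin a)) (z - a) = 1"
      unfolding chart_eq by (rule DERIV_imp_deriv) (auto intro!: derivative_eq_intros)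
    then show "\<phi> j z = ?F (z - a) / (z - a) ^ Suc 1"
      using Phi_eq[OF exp w, of j] w by (simp add: power2_eq_square)
  qed
  have h2: "(\<lambda>z. ?F (z - a)) holomorphic_on ball a \<delta>"
    by (rule holomorphic_on_compose_gen[OF _ hol, unfolded o_def]) (auto intro!: holomorphic_intros simp: dist_norm norm_minus_commute)
  have "residue (\<phi> j) a = residue (\<lambda>z. ?F (z - a) / (z - a) ^ Suc 1) a"
    by (rule residue_cong[OF ev]) simp
  also have "\<dots> = deriv (\<lambda>z. ?F (z - a)) a"
    by (subst residue_holomorphic_over_power[OF open_ball _ h2]) (use \<delta> in auto)
  also have "\<dots> = deriv ?F 0"
  proof (rule DERIV_imp_deriv)
    show "((\<lambda>z. ?F (z - a)) has_field_derivative deriv ?F 0) (at a)"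
      by (rule DERIV_chain2[of ?F _ "\<lambda>z. z - a" a 1, simplified]) (use dF in \<open>auto intro!: derivative_eq_intros\<close>)
  qed
  finally show ?thesis using deriv_Phi_real[OF exp, of j] by simp
qed

end

locale weierstrass_ends = weierstrass_forms +
  assumes ends: "\<And>p. p \<in> P \<Longrightarrow> \<exists>\<delta> q1 q2 \<eta>. end_expansion p \<delta> q1 q2 \<eta>"
begin

text \<open>Winding numbers of closed paths are integers, hence by the residue theorem the integral is \<open>2 pi \<i>\<close>
times a real number.\<close>

lemma period_phi:
  assumes \<gamma>: "valid_path \<gamma>" "path_image \<gamma> \<subseteq> \<Sigma>" "pathfinish \<gamma> = pathstart \<gamma>"
  shows "Re (contour_integral \<gamma> (\<phi> j)) = 0"
proof -
  have "contour_integral \<gamma> (\<phi> j) = complex_of_real (2 * pi) * \<i> * (\<Sum>p\<in>pts. winding_number \<gamma> p * residue (\<phi> j) p)"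
    by (rule Residue_theorem[OF open_UNIV connected_UNIV finite_pts])
       (use \<gamma> holomorphic_phi in \<open>auto simp: Sigma_eq[symmetric]\<close>)
  moreover have "Im (winding_number \<gamma> p * residue (\<phi> j) p) = 0" if p: "p \<in> pts" for p
  proof -
    have "Im (residue (\<phi> j) p) = 0" using ends[of "Fin p"] p residue_phi_real unfolding pts_def by blast
    moreover have "winding_number \<gamma> p \<in> \<int>"
      using \<gamma> p by (intro integer_winding_number) (auto simp: valid_path_imp_path Sigma_eq)
    ultimately show ?thesis by (auto elim!: Ints_cases)
  qed
  ultimately show ?thesis by simp
qed

lemma weierstrass_integral_closed:
  assumes "valid_path \<gamma>" "path_image \<gamma> \<subseteq> \<Sigma>" "pathfinish \<gamma> = pathstart \<gamma>"
  shows "weierstrass_integral G h \<gamma> = 0"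
  unfolding vec_eq_iff using weierstrass_integral_nth[OF assms(2)] period_phi[OF assms] by simp

lemma weierstrass_map_has_derivative:
  assumes z0: "z0 \<in> \<Sigma>" and z: "z \<in> \<Sigma>"
  shows "((\<lambda>z. weierstrass_map P G h z0 z $ j) has_derivative (\<lambda>t. Re (\<phi> j z * t))) (at z)"
proof -
  define \<gamma> where "\<gamma> z = (SOME \<gamma>. valid_path \<gamma> \<and> path_image \<gamma> \<subseteq> \<Sigma> \<and> pathstart \<gamma> = z0 \<and> pathfinish \<gamma> = z)" for z
  have \<gamma>: "valid_path (\<gamma> z) \<and> path_image (\<gamma> z) \<subseteq> \<Sigma> \<and> pathstart (\<gamma> z) = z0 \<and> pathfinish (\<gamma> z) = z" if "z \<in> \<Sigma>" for z
  proof -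
    have "\<exists>\<gamma>. valid_path \<gamma> \<and> path_image \<gamma> \<subseteq> \<Sigma> \<and> pathstart \<gamma> = z0 \<and> pathfinish \<gamma> = z"
      using connected_open_polynomial_connected[OF open_Sigma connected_Sigma z0 that]
      by (blast intro: valid_path_polynomial_function)
    then show ?thesis unfolding \<gamma>_def by (rule someI_ex)
  qed
  have "((\<lambda>y. Re (contour_integral (\<gamma> y) (\<phi> j))) has_derivative (\<lambda>t. Re (\<phi> j z * t))) (at z)"
    by (rule path_integral_has_derivative[OF open_Sigma holomorphic_phi z \<gamma> period_phi])
  then show ?thesis
    by (rule has_derivative_transform_within_open[OF _ open_Sigma z])
       (simp add: weierstrass_map_def \<gamma>_def[symmetric] weierstrass_integral_nth \<gamma>)
qed

lemma chart_has_field_derivative: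
  "w \<noteq> 0 \<Longrightarrow> (chart p has_field_derivative deriv (chart p) w) (at w)"
proof -
  assume w: "w \<noteq> 0"
  have "(\<lambda>w. chart p w) field_differentiable at w"
    using w by (cases p) (auto intro!: derivative_intros)
  then show ?thesis by (simp add: DERIV_deriv_iff_field_differentiable)
qed

context
  fixes p \<delta> q1 q2 \<eta> N z0
  assumes exp: "end_expansion p \<delta> q1 q2 \<eta>" and p: "p \<in> P" and N: "limit_normal G p N" and z0: "z0 \<in> \<Sigma>"
begin

abbreviation X :: "complex \<Rightarrow> real^3" where "X \<equiv> weierstrass_map P G h z0"

definition r :: "real^3" where "r = (\<chi> j. Re (deriv (\<Phi> q1 q2 \<eta> j) 0))"

lemma r_nth: "r $ j = Re (weierstrass_triple (deriv q1 0) (deriv q2 0) (deriv \<eta> 0) $ j)"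
  by (simp add: r_def deriv_Phi[OF exp])

lemma X_chart_has_derivative:
  assumes w: "w \<in> ball 0 \<delta> - {0}"
  shows "((\<lambda>w. X (chart p w) $ j) has_derivative (\<lambda>t. Re (\<Phi> q1 q2 \<eta> j w / w\<^sup>2 * t))) (at w)"
proof -
  have w0: "w \<noteq> 0" using w by auto
  have 1: "((\<lambda>z. X z $ j) has_derivative (\<lambda>t. Re (\<phi> j (chart p w) * t))) (at (chart p w))"
    using weierstrass_map_has_derivative[OF z0] chart_w[OF exp w] by blast
  have 2: "(chart p has_derivative (*) (deriv (chart p) w)) (at w)"
    using chart_has_field_derivative[OF w0] unfolding has_field_derivative_def .
  show ?thesis
    using has_derivative_compose[OF 2 1] w0 unfolding Phi_eq[OF exp w] by (simp add: mult.assoc)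
qed

lemma end_facts:
  shows "r = (r \<bullet> N) *\<^sub>R N"
    and "\<exists>\<epsilon>>0. \<epsilon> \<le> \<delta> \<and> embedding_on (ball 0 \<epsilon> - {0}) (\<lambda>w. X (chart p w)) \<and>
      log_graph ((\<lambda>w. X (chart p w)) ` (ball 0 \<epsilon> - {0})) N (- (r \<bullet> N))"
    and "r \<bullet> N \<noteq> 0 \<Longrightarrow> filterlim (\<lambda>w. X (chart p w) \<bullet> (- sgn (r \<bullet> N) *\<^sub>R N)) at_top (at 0)"
  unfolding r_def
  using isotropic_double_pole_end[of \<delta> "\<Phi> q1 q2 \<eta>" N "\<lambda>w. X (chart p w)", OF \<delta>[OF exp] holomorphic_Phi[OF exp]
    Phi_isotropic[OF exp] Phi_nonzero[OF exp] deriv_Phi_real[OF exp] Phi_perp_normal[OF exp N] X_chart_has_derivative]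
  by simp_all

lemma log_end_expansion: "log_end P G X p N (- (r \<bullet> N))"
proof -
  obtain \<epsilon> where \<epsilon>: "\<epsilon> > 0" "\<epsilon> \<le> \<delta>" "embedding_on (ball 0 \<epsilon> - {0}) (\<lambda>w. X (chart p w))"
    "log_graph ((\<lambda>w. X (chart p w)) ` (ball 0 \<epsilon> - {0})) N (- (r \<bullet> N))"
    using end_facts(2) by blast
  moreover have "chart p ` (ball 0 \<epsilon> - {0}) \<subseteq> \<Sigma>"
  proof (rule image_subsetI)
    fix w :: complex assume "w \<in> ball 0 \<epsilon> - {0}"
    then have "w \<in> ball 0 \<delta> - {0}" using \<epsilon>(2) by auto
    then show "chart p w \<in> \<Sigma>" using chart_w[OF exp] by blast
  qed
  ultimately show ?thesis unfolding log_end_def using p N by blast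
qed

lemma planar_end_expansion:
  assumes "deriv q1 0 = 0" "deriv q2 0 = 0" "deriv \<eta> 0 = 0"
  shows "planar_end P G X p N"
proof -
  have "r = 0" unfolding vec_eq_iff forall_3 by (simp add: r_nth assms)
  then show ?thesis using log_end_expansion by (simp add: planar_end_def)
qed

text \<open>The residue vector \<open>r\<close> is a multiple of \<open>N\<close>, and the end points in the direction \<open>- r / \<bar>r\<bar>\<close>, because
the height grows like \<open>(r \<bullet> N) ln \<bar>w\<bar>\<close> and \<open>ln \<bar>w\<bar>\<close> tends to minus infinity. So the third
component of \<open>r\<close>, the residue of \<open>h\<close>, decides between up and down.\<close>

lemma catenoid_end_expansion:
  assumes "Re (deriv \<eta> 0) \<noteq> 0"
  shows "\<exists>\<nu>. catenoid_end P G X p N \<and> points_in_direction X p N \<nu> \<and> sgn (\<nu> $ 3) = - sgn (Re (deriv \<eta> 0))"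
proof -
  have r3: "r $ 3 = Re (deriv \<eta> 0)" by (simp add: r_nth)
  have "r $ 3 = (r \<bullet> N) * N $ 3" 
    using arg_cong[OF end_facts(1), of "\<lambda>x::real^3. x $ 3"] by simp
  then have r3': "Re (deriv \<eta> 0) = (r \<bullet> N) * N $ 3" using r3 by simp
  then have nz: "r \<bullet> N \<noteq> 0" using assms by auto
  have "catenoid_end P G X p N" unfolding catenoid_end_def using log_end_expansion nz by (metis neg_equal_0_iff_equal)
  moreover have "points_in_direction X p N (- sgn (r \<bullet> N) *\<^sub>R N)"
    unfolding points_in_direction_def using end_facts(3)[OF nz] nz
    by (auto simp: sgn_real_def)
  moreover have "sgn ((- sgn (r \<bullet> N) *\<^sub>R N) $ 3) = - sgn (Re (deriv \<eta> 0))"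
    unfolding r3' by (simp add: sgn_mult)
  ultimately show ?thesis by blast
qed

end
end

section \<open>Double poles at the roots of a binomial\<close>

definition root_factor :: "nat \<Rightarrow> complex \<Rightarrow> complex \<Rightarrow> complex" where
  "root_factor k \<zeta> z = (\<Sum>i<k. \<zeta> ^ (k - Suc i) * z ^ i)"

lemma root_factor: "z ^ k - \<zeta> ^ k = (z - \<zeta>) * root_factor k \<zeta> z"
  by (simp add: root_factor_def power_diff_sumr2)

lemma holomorphic_root_factor [holomorphic_intros]:
  "f holomorphic_on S \<Longrightarrow> (\<lambda>z. root_factor k \<zeta> (f z)) holomorphic_on S"
  unfolding root_factor_def by (intro holomorphic_intros)

lemma root_factor_same:
  assumes "\<zeta> \<noteq> 0"
  shows "root_factor k \<zeta> \<zeta> = of_nat k * \<zeta> ^ k / \<zeta>"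
proof -
  have "\<zeta> ^ (k - Suc i) * \<zeta> ^ i = \<zeta> ^ k / \<zeta>" if "i < k" for i
  proof -
    have "\<zeta> ^ (k - Suc i) * \<zeta> ^ i * \<zeta> = \<zeta> ^ (k - Suc i + i + 1)" by (simp add: power_add)
    also have "k - Suc i + i + 1 = k" using that by simp
    finally show ?thesis using assms by (simp add: field_simps)
  qed
  then show ?thesis unfolding root_factor_def by simp
qed

lemma root_factor_nonzero:
  "z ^ k \<noteq> \<zeta> ^ k \<or> (z = \<zeta> \<and> \<zeta> \<noteq> 0 \<and> k > 0) \<Longrightarrow> root_factor k \<zeta> z \<noteq> 0"
  using root_factor[of z k \<zeta>] root_factor_same[of \<zeta> k] by auto

lemma root_factor_has_field_derivative:
  assumes "\<zeta> \<noteq> 0" "k > 0"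
  shows "(root_factor k \<zeta> has_field_derivative of_nat k * (of_nat k - 1) / 2 * \<zeta> ^ k / \<zeta>\<^sup>2) (at \<zeta>)"
proof -
  have "\<zeta> ^ (k - Suc i) * (of_nat i * \<zeta> ^ (i - Suc 0)) = of_nat i * (\<zeta> ^ k / \<zeta>\<^sup>2)" if "i < k" for i
  proof (cases i)
    case (Suc j)
    have "\<zeta> ^ (k - Suc i) * \<zeta> ^ j * \<zeta>\<^sup>2 = \<zeta> ^ (k - Suc i + j + 2)" by (simp add: power_add power2_eq_square)
    also have "k - Suc i + j + 2 = k" using that Suc by simp
    finally have "\<zeta> ^ (k - Suc i) * \<zeta> ^ j = \<zeta> ^ k / \<zeta>\<^sup>2" using assms by (simp add: eq_divide_eq)
    then have "of_nat i * (\<zeta> ^ (k - Suc i) * \<zeta> ^ j) = of_nat i * (\<zeta> ^ k / \<zeta>\<^sup>2)" by (rule arg_cong)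
    moreover have "j = i - Suc 0" using Suc by simp
    ultimately show ?thesis by (simp only: mult.left_commute)
  qed simp
  then have "(\<Sum>i<k. \<zeta> ^ (k - Suc i) * (of_nat i * \<zeta> ^ (i - Suc 0))) = (\<Sum>i<k. of_nat i) * (\<zeta> ^ k / \<zeta>\<^sup>2)"
    unfolding sum_distrib_right by (intro sum.cong) auto
  also have "(\<Sum>i<k. of_nat i :: complex) = of_nat k * (of_nat k - 1) / 2"
    by (induction k) (simp_all add: field_simps)
  finally have eq: "(\<Sum>i<k. \<zeta> ^ (k - Suc i) * (of_nat i * \<zeta> ^ (i - Suc 0)))
      = of_nat k * (of_nat k - 1) / 2 * \<zeta> ^ k / \<zeta>\<^sup>2" by simp
  have "((\<lambda>z. \<Sum>i<k. \<zeta> ^ (k - Suc i) * z ^ i) has_field_derivative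
      (\<Sum>i<k. \<zeta> ^ (k - Suc i) * (of_nat i * \<zeta> ^ (i - Suc 0)))) (at \<zeta>)"
    by (auto intro!: derivative_eq_intros simp: mult_ac)
  then show ?thesis unfolding eq root_factor_def[abs_def] .
qed

text \<open>The residue of \<open>F z / (z ^ k - \<zeta> ^ k)\<^sup>2\<close> at \<open>\<zeta>\<close>: since \<open>z ^ k - \<zeta> ^ k = (z - \<zeta>) * root_factor k \<zeta> z\<close>, it is
the derivative of \<open>F / (root_factor k \<zeta>)\<^sup>2\<close> there.\<close>

lemma double_root_derivative:
  assumes \<zeta>: "\<zeta> \<noteq> 0" and k: "k > 0" and F: "(F has_field_derivative F') (at \<zeta>)"
  shows "((\<lambda>w. F (\<zeta> + w) / (root_factor k \<zeta> (\<zeta> + w))\<^sup>2) has_field_derivative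
     (F' - F \<zeta> * (of_nat k - 1) / \<zeta>) * (\<zeta> / (of_nat k * \<zeta> ^ k))\<^sup>2) (at 0)"
proof -
  have nz: "root_factor k \<zeta> \<zeta> \<noteq> 0" using \<zeta> k by (intro root_factor_nonzero) simp
  have "((\<lambda>z. F z / (root_factor k \<zeta> z)\<^sup>2) has_field_derivative
     (F' - F \<zeta> * (of_nat k - 1) / \<zeta>) * (\<zeta> / (of_nat k * \<zeta> ^ k))\<^sup>2) (at \<zeta>)"
  proof -
    define R where "R = root_factor k \<zeta> \<zeta>"
    define R' where "R' = of_nat k * (of_nat k - 1) / 2 * \<zeta> ^ k / \<zeta>\<^sup>2"
    have R: "R \<noteq> 0" using nz by (simp add: R_def)
    have RR: "2 * R' = R * ((of_nat k - 1) / \<zeta>)"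
      using \<zeta> k by (simp add: R_def R'_def root_factor_same field_simps power2_eq_square)
    have inv: "\<zeta> / (of_nat k * \<zeta> ^ k) = 1 / R"
      using \<zeta> k by (simp add: R_def root_factor_same field_simps)
    have "((\<lambda>z. (root_factor k \<zeta> z)\<^sup>2) has_field_derivative R * (2 * R')) (at \<zeta>)"
      using DERIV_power[OF root_factor_has_field_derivative[OF \<zeta> k], of 2]
      by (simp add: R_def R'_def mult_ac)
    then have "((\<lambda>z. F z / (root_factor k \<zeta> z)\<^sup>2) has_field_derivative
        (F' * R\<^sup>2 - F \<zeta> * (R * (2 * R'))) / (R\<^sup>2 * R\<^sup>2)) (at \<zeta>)"
      using DERIV_divide[OF F, of "\<lambda>z. (root_factor k \<zeta> z)\<^sup>2"] nz by (simp add: R_def)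
    also have "(F' * R\<^sup>2 - F \<zeta> * (R * (2 * R'))) / (R\<^sup>2 * R\<^sup>2) = (F' - F \<zeta> * ((of_nat k - 1) / \<zeta>)) * (1 / R)\<^sup>2"
    proof -
      have eq: "F' * R\<^sup>2 - F \<zeta> * (R * (R * c)) = R\<^sup>2 * (F' - F \<zeta> * c)" for c
        by (simp add: power2_eq_square algebra_simps)
      have "R\<^sup>2 * x / (R\<^sup>2 * R\<^sup>2) = x * (1 / R)\<^sup>2" for x
        using R by (simp add: field_simps power2_eq_square)
      then show ?thesis unfolding RR eq .
    qed
    finally show ?thesis unfolding inv by simp
  qed
  then have "((\<lambda>z. F z / (root_factor k \<zeta> z)\<^sup>2) has_field_derivative
     (F' - F \<zeta> * (of_nat k - 1) / \<zeta>) * (\<zeta> / (of_nat k * \<zeta> ^ k))\<^sup>2) (at (\<zeta> + 0))" by simp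
  then show ?thesis by (rule DERIV_chain2[where g = "\<lambda>w. \<zeta> + w" and Db = 1, simplified]) (auto intro!: derivative_eq_intros)
qed

lemma has_field_derivative_power_over:
  fixes z :: complex
  assumes "z \<noteq> 0"
  shows "((\<lambda>z. z ^ n) has_field_derivative of_nat n * z ^ n / z) (at z)"
proof -
  have "of_nat n * z ^ n / z = of_nat n * (1 * z ^ (n - Suc 0))"
    using assms by (cases n) auto
  then show ?thesis using DERIV_power[OF DERIV_ident, of n z] by simp
qed

section \<open>The forms and the choice of the parameter\<close>

text \<open>With \<open>\<alpha> = a ^ k\<close> and \<open>\<tau> = b ^ k\<close> these are the coefficients of \<open>h / G\<close>, \<open>G * h\<close> and \<open>h\<close>. They do not change
when \<open>\<tau>\<close> is replaced by \<open>1 / \<tau>\<close>, so that both families of catenoid ends are covered by the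
computations at roots of \<open>z ^ k = \<tau>\<close>.\<close>

definition h_over_G :: "nat \<Rightarrow> complex \<Rightarrow> complex \<Rightarrow> complex \<Rightarrow> complex" where
  "h_over_G k \<alpha> \<tau> z = \<tau>\<^sup>2 * (\<alpha> * z ^ k - 1)\<^sup>2 / (\<alpha> * z\<^sup>2 * (z ^ k - \<tau>)\<^sup>2 * (\<tau> * z ^ k - 1)\<^sup>2)"

definition h_times_G :: "nat \<Rightarrow> complex \<Rightarrow> complex \<Rightarrow> complex \<Rightarrow> complex" where
  "h_times_G k \<alpha> \<tau> z = \<tau>\<^sup>2 * (z ^ k)\<^sup>2 * (z ^ k - \<alpha>)\<^sup>2 / (\<alpha> * (z ^ k - \<tau>)\<^sup>2 * (\<tau> * z ^ k - 1)\<^sup>2)"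

definition h_form :: "nat \<Rightarrow> complex \<Rightarrow> complex \<Rightarrow> complex \<Rightarrow> complex" where
  "h_form k \<alpha> \<tau> z = \<tau>\<^sup>2 * z ^ (k - 1) * (z ^ k - \<alpha>) * (\<alpha> * z ^ k - 1) / (\<alpha> * (z ^ k - \<tau>)\<^sup>2 * (\<tau> * z ^ k - 1)\<^sup>2)"

lemma forms_inverse:
  assumes "\<tau> \<noteq> 0"
  shows "h_over_G k \<alpha> (1 / \<tau>) = h_over_G k \<alpha> \<tau>" "h_times_G k \<alpha> (1 / \<tau>) = h_times_G k \<alpha> \<tau>" "h_form k \<alpha> (1 / \<tau>) = h_form k \<alpha> \<tau>"
proof -
  have "(Z - 1 / \<tau>)\<^sup>2 * (1 / \<tau> * Z - 1)\<^sup>2 = (1 / \<tau>)\<^sup>2 * ((1 / \<tau>)\<^sup>2 * ((Z - \<tau>)\<^sup>2 * (\<tau> * Z - 1)\<^sup>2))" for Z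
    using assms by (simp add: field_simps power2_eq_square)
  then have "(1 / \<tau>)\<^sup>2 * c / (d * (Z - 1 / \<tau>)\<^sup>2 * (1 / \<tau> * Z - 1)\<^sup>2) = \<tau>\<^sup>2 * c / (d * (Z - \<tau>)\<^sup>2 * (\<tau> * Z - 1)\<^sup>2)" for Z c d
    using assms by (simp add: mult.assoc) (simp add: divide_simps)
  note * = this[unfolded mult.assoc]
  show "h_over_G k \<alpha> (1 / \<tau>) = h_over_G k \<alpha> \<tau>" "h_times_G k \<alpha> (1 / \<tau>) = h_times_G k \<alpha> \<tau>" "h_form k \<alpha> (1 / \<tau>) = h_form k \<alpha> \<tau>"
    unfolding fun_eq_iff h_over_G_def h_times_G_def h_form_def mult.assoc using *[of _ "\<alpha> * _"] * by (simp_all only: mult.assoc) auto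
qed

text \<open>Up to a common positive factor, the residues of \<open>h / G\<close> and \<open>G * h\<close> at a root \<open>\<zeta>\<close> of \<open>z ^ k = \<tau>\<close> are
\<open>c1 / \<zeta>\<close> and \<open>c2 * \<zeta>\<close>, where \<open>c1\<close> and \<open>c2\<close> are the real coefficients of \<open>1\<close> and \<open>s\<close> in this expression, with
\<open>\<kappa> = k\<close>. With \<open>s = \<bar>\<zeta>\<bar>\<^sup>2\<close> its vanishing means that the residue of \<open>G * h\<close> is minus the conjugate of the
residue of \<open>h / G\<close>.\<close>

definition balance :: "real \<Rightarrow> real \<Rightarrow> real \<Rightarrow> real \<Rightarrow> real" where
  "balance \<kappa> \<alpha> \<tau> s =
     - (\<kappa> + 1) * (\<alpha> * \<tau> - 1)\<^sup>2 + 2 * \<kappa> * (\<alpha> * \<tau> - 1) - 2 * \<kappa> * ((\<alpha> * \<tau> - 1)\<^sup>2 / (\<tau>\<^sup>2 - 1))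
     + s * \<tau>\<^sup>2 * ((\<kappa> + 1) * (\<tau> - \<alpha>)\<^sup>2 + 2 * \<kappa> * \<alpha> * (\<tau> - \<alpha>) - 2 * \<kappa> * ((\<tau> - \<alpha>)\<^sup>2 / (\<tau>\<^sup>2 - 1)))"

text \<open>The conditions at the roots of \<open>z ^ k = \<tau>\<close> and at those of \<open>z ^ k = 1 / \<tau>\<close>, which have reciprocal
absolute values, are equivalent, so a single real equation solves the period problem.\<close>

lemma balance_inverse:
  assumes \<tau>: "\<tau> \<noteq> 0" "\<tau>\<^sup>2 \<noteq> 1" and s: "s \<noteq> 0"
  shows "s * \<tau> ^ 4 * balance \<kappa> \<alpha> (1 / \<tau>) (1 / s) = - balance \<kappa> \<alpha> \<tau> s"
proof -
  define D where "D = \<tau>\<^sup>2 - 1"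
  define M where "M = \<tau> - \<alpha>"
  define N where "N = \<alpha> * \<tau> - 1"
  define W where "W = M\<^sup>2 / D"
  define X where "X = N\<^sup>2 / D"
  define i where "i = 1 / \<tau>"
  define \<sigma> where "\<sigma> = 1 / s"
  have D: "D \<noteq> 0" using \<tau> by (simp add: D_def)
  have i: "\<tau> * i = 1" "s * \<sigma> = 1" using \<tau> s by (simp_all add: i_def \<sigma>_def)
  have WX: "W * D = M\<^sup>2" "X * D = N\<^sup>2" using D by (simp_all add: W_def X_def)
  have N': "\<alpha> * i - 1 = - M * i" "i - \<alpha> = - N * i" and D': "i\<^sup>2 - 1 = - D * i\<^sup>2"
    using i(1) unfolding M_def N_def D_def by algebra+
  have "i \<noteq> 0" using i by auto
  then have q: "(- M * i)\<^sup>2 / (- D * i\<^sup>2) = - W" "(- N * i)\<^sup>2 / (- D * i\<^sup>2) = - X"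
    using D by (simp_all add: W_def X_def power_mult_distrib)
  have 1: "balance \<kappa> \<alpha> (1 / \<tau>) (1 / s) = - (\<kappa> + 1) * (- M * i)\<^sup>2 + 2 * \<kappa> * (- M * i) - 2 * \<kappa> * (- W)
      + \<sigma> * i\<^sup>2 * ((\<kappa> + 1) * (- N * i)\<^sup>2 + 2 * \<kappa> * \<alpha> * (- N * i) - 2 * \<kappa> * (- X))"
    unfolding balance_def i_def[symmetric] \<sigma>_def[symmetric] N' D' q ..
  have 2: "balance \<kappa> \<alpha> \<tau> s = - (\<kappa> + 1) * N\<^sup>2 + 2 * \<kappa> * N - 2 * \<kappa> * X
      + s * \<tau>\<^sup>2 * ((\<kappa> + 1) * M\<^sup>2 + 2 * \<kappa> * \<alpha> * M - 2 * \<kappa> * W)"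
    unfolding balance_def M_def[symmetric] N_def[symmetric] D_def[symmetric] W_def[symmetric] X_def[symmetric] ..
  have t4: "\<tau> ^ 4 * i\<^sup>2 = \<tau>\<^sup>2" "\<tau> ^ 4 * i ^ 4 = 1" "\<tau> ^ 4 * i = \<tau> ^ 3" "\<tau> ^ 4 * i ^ 3 = \<tau>" using i(1) by algebra+
  have "s * \<tau> ^ 4 * balance \<kappa> \<alpha> (1 / \<tau>) (1 / s)
    = s * (- (\<kappa> + 1) * M\<^sup>2 * \<tau>\<^sup>2 - 2 * \<kappa> * M * \<tau> ^ 3 + 2 * \<kappa> * W * \<tau> ^ 4)
      + ((\<kappa> + 1) * N\<^sup>2 - 2 * \<kappa> * \<alpha> * N * \<tau> + 2 * \<kappa> * X * \<tau>\<^sup>2)"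
    unfolding 1 using i(2) t4 by algebra
  also have "\<dots> = - balance \<kappa> \<alpha> \<tau> s"
  proof -
    have w: "W * \<tau>\<^sup>2 = M\<^sup>2 + W" "X * \<tau>\<^sup>2 = N\<^sup>2 + X" using WX by (simp_all add: D_def algebra_simps)
    show ?thesis unfolding 2 using w M_def N_def by algebra
  qed
  finally show ?thesis .
qed

text \<open>The expression changes sign between \<open>\<alpha> = 1\<close> and \<open>\<alpha> = 1 / \<beta>\<close>. Both end points must be avoided: at
\<open>\<alpha> = 1\<close> the zeros of \<open>G\<close> cancel its poles while \<open>h\<close> has double zeros, and at \<open>\<alpha> = 1 / \<beta>\<close> zeros of \<open>h\<close> collide
with punctures.\<close>

lemma exists_balanced_parameter:
  fixes \<beta> s \<kappa> :: real
  assumes \<beta>: "0 < \<beta>" "\<beta> < 1" and s: "0 < s" "s < 1" and \<kappa>: "\<kappa> > 0"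
  obtains \<alpha> where "1 < \<alpha>" "\<alpha> * \<beta> < 1" "balance \<kappa> \<alpha> \<beta> s = 0"
proof -
  define D where "D = \<beta>\<^sup>2 - 1"
  have b2: "\<beta>\<^sup>2 < 1" using \<beta> power_strict_mono[of \<beta> 1 2] by simp
  then have D: "D < 0" by (simp add: D_def)
  have neg: "balance \<kappa> 1 \<beta> s < 0"
  proof -
    define E where "E = (1 - \<beta>) / (1 + \<beta>)"
    have E: "E * (1 + \<beta>) = 1 - \<beta>" "E > 0" using \<beta> by (simp_all add: E_def)
    have e: "(\<beta> - 1)\<^sup>2 / D = - E"
      using \<beta> D unfolding D_def E_def by (simp add: divide_simps) (simp add: power2_eq_square algebra_simps)
    have "balance \<kappa> 1 \<beta> s = - (\<kappa> + 1) * (\<beta> - 1)\<^sup>2 + 2 * \<kappa> * (\<beta> - 1) + 2 * \<kappa> * E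
      + s * \<beta>\<^sup>2 * ((\<kappa> + 1) * (\<beta> - 1)\<^sup>2 + 2 * \<kappa> * (\<beta> - 1) + 2 * \<kappa> * E)"
      unfolding balance_def D_def[symmetric] by (simp add: e)
    also have "\<dots> = - ((\<kappa> + 1) * (\<beta> - 1)\<^sup>2 * (1 - s * \<beta>\<^sup>2) + 2 * \<kappa> * \<beta> * E * (1 + s * \<beta>\<^sup>2))"
      using E(1) by algebra
    also have "\<dots> < 0"
    proof -
      have "s * \<beta>\<^sup>2 < 1" using s b2 mult_strict_mono[of s 1 "\<beta>\<^sup>2" 1] by simp
      then have "(\<kappa> + 1) * (\<beta> - 1)\<^sup>2 * (1 - s * \<beta>\<^sup>2) \<ge> 0" using \<kappa> by simp
      moreover have "2 * \<kappa> * \<beta> * E * (1 + s * \<beta>\<^sup>2) > 0"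
        using \<beta> s \<kappa> E by (intro mult_pos_pos add_pos_nonneg) auto
      ultimately show ?thesis by linarith
    qed
    finally show ?thesis .
  qed
  have pos: "balance \<kappa> (1 / \<beta>) \<beta> s > 0"
  proof -
    have M: "\<beta> - 1 / \<beta> = D / \<beta>" using \<beta> by (simp add: D_def field_simps power2_eq_square)
    have "balance \<kappa> (1 / \<beta>) \<beta> s = s * (\<kappa> + 1) * D\<^sup>2"
      unfolding balance_def D_def[symmetric] M using \<beta> D by (simp add: field_simps power2_eq_square)
    then show ?thesis using s \<kappa> D by simp
  qed
  have "\<exists>\<alpha>\<ge>1. \<alpha> \<le> 1 / \<beta> \<and> balance \<kappa> \<alpha> \<beta> s = 0"
    using neg pos \<beta> D by (intro IVT') (auto simp: balance_def D_def intro!: continuous_intros)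
  then obtain \<alpha> where \<alpha>: "1 \<le> \<alpha>" "\<alpha> \<le> 1 / \<beta>" "balance \<kappa> \<alpha> \<beta> s = 0" by blast
  then have "\<alpha> \<noteq> 1" "\<alpha> \<noteq> 1 / \<beta>" using neg pos by auto
  then show thesis using \<alpha> \<beta> by (intro that[of \<alpha>]) (auto simp: field_simps)
qed

section \<open>Residues at the catenoid ends\<close>

text \<open>Written as \<open>f' = f * l\<close>, logarithmic derivatives of the product formulas below are just sums of one
term for each factor.\<close>

definition has_log_derivative :: "(complex \<Rightarrow> complex) \<Rightarrow> complex \<Rightarrow> complex \<Rightarrow> bool" where
  "has_log_derivative f l z \<longleftrightarrow> (f has_field_derivative f z * l) (at z)"

lemma log_derivative_const: "has_log_derivative (\<lambda>z. c) 0 z"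
  by (simp add: has_log_derivative_def)

lemma log_derivative_mult:
  "has_log_derivative f l z \<Longrightarrow> has_log_derivative g m z \<Longrightarrow> has_log_derivative (\<lambda>z. f z * g z) (l + m) z"
  unfolding has_log_derivative_def by (auto intro!: derivative_eq_intros simp: algebra_simps)

lemma log_derivative_divide:
  "has_log_derivative f l z \<Longrightarrow> has_log_derivative g m z \<Longrightarrow> g z \<noteq> 0 \<Longrightarrow>
    has_log_derivative (\<lambda>z. f z / g z) (l - m) z"
  unfolding has_log_derivative_def by (auto intro!: derivative_eq_intros simp: field_simps)

lemma log_derivative_square:
  "has_log_derivative f l z \<Longrightarrow> has_log_derivative (\<lambda>z. (f z)\<^sup>2) (2 * l) z"
  using log_derivative_mult[of f l z f l] by (simp add: power2_eq_square)

lemma log_derivative_self: "z \<noteq> 0 \<Longrightarrow> has_log_derivative (\<lambda>z. z) (1 / z) z"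
  unfolding has_log_derivative_def by (auto intro!: derivative_eq_intros)

lemma log_derivative_linear_power:
  assumes "z \<noteq> 0" "c * z ^ k - d \<noteq> 0"
  shows "has_log_derivative (\<lambda>z. c * z ^ k - d) (of_nat k * (c * z ^ k) / (c * z ^ k - d) / z) z"
proof -
  have "((\<lambda>z. c * z ^ k - d) has_field_derivative c * (of_nat k * z ^ k / z)) (at z)"
    using DERIV_diff[OF DERIV_cmult[OF has_field_derivative_power_over[OF assms(1)], of c] DERIV_const] by simp
  also have "c * (of_nat k * z ^ k / z) = (c * z ^ k - d) * (of_nat k * (c * z ^ k) / (c * z ^ k - d) / z)"
    using assms by (simp add: field_simps)
  finally show ?thesis unfolding has_log_derivative_def .
qed

lemma double_root_log_derivative:
  assumes "\<zeta> \<noteq> 0" "k > 0" "has_log_derivative F l \<zeta>"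
  shows "deriv (\<lambda>w. F (\<zeta> + w) / (root_factor k \<zeta> (\<zeta> + w))\<^sup>2) 0
     = F \<zeta> * (\<zeta> * l - (of_nat k - 1)) * \<zeta> / (of_nat k * \<zeta> ^ k)\<^sup>2"
proof -
  have "(F has_field_derivative F \<zeta> * l) (at \<zeta>)" using assms(3) unfolding has_log_derivative_def .
  from DERIV_imp_deriv[OF double_root_derivative[OF assms(1,2) this]]
  show ?thesis using assms(1) by (simp add: power_divide) (simp add: field_simps power2_eq_square)
qed

text \<open>The forms with the factor \<open>(z ^ k - \<tau>)\<^sup>2\<close> removed from the denominator. Trivial coefficients are kept,
and \<open>z ^ (k - 1)\<close> is written as \<open>z ^ k / z\<close>, so that each factor is a constant, \<open>z\<close>, or of the shape
\<open>c * z ^ k - d\<close>.\<close>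

definition h_over_G_reg :: "nat \<Rightarrow> complex \<Rightarrow> complex \<Rightarrow> complex \<Rightarrow> complex" where
  "h_over_G_reg k \<alpha> \<tau> z = \<tau>\<^sup>2 * (\<alpha> * z ^ k - 1)\<^sup>2 / (\<alpha> * z\<^sup>2 * (\<tau> * z ^ k - 1)\<^sup>2)"

definition h_times_G_reg :: "nat \<Rightarrow> complex \<Rightarrow> complex \<Rightarrow> complex \<Rightarrow> complex" where
  "h_times_G_reg k \<alpha> \<tau> z = \<tau>\<^sup>2 * (1 * z ^ k - 0)\<^sup>2 * (1 * z ^ k - \<alpha>)\<^sup>2 / (\<alpha> * (\<tau> * z ^ k - 1)\<^sup>2)"

definition h_form_reg :: "nat \<Rightarrow> complex \<Rightarrow> complex \<Rightarrow> complex \<Rightarrow> complex" where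
  "h_form_reg k \<alpha> \<tau> z = \<tau>\<^sup>2 * ((1 * z ^ k - 0) / z) * (1 * z ^ k - \<alpha>) * (\<alpha> * z ^ k - 1) / (\<alpha> * (\<tau> * z ^ k - 1)\<^sup>2)"

context
  fixes k :: nat and \<alpha> \<tau> \<zeta> :: complex
  assumes k: "k > 0" and \<alpha>: "\<alpha> \<noteq> 0" and \<zeta>: "\<zeta> \<noteq> 0" "\<zeta> ^ k = \<tau>"
    and D: "\<tau>\<^sup>2 - 1 \<noteq> 0" and N: "\<alpha> * \<tau> - 1 \<noteq> 0" and M: "\<tau> - \<alpha> \<noteq> 0"
begin

lemma \<tau>0: "\<tau> \<noteq> 0" using \<zeta> by auto

lemma deriv_double_root_1:
  "deriv (\<lambda>w. h_over_G_reg k \<alpha> \<tau> (\<zeta> + w) / (root_factor k \<zeta> (\<zeta> + w))\<^sup>2) 0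
    = (- (of_nat k + 1) * (\<alpha> * \<tau> - 1)\<^sup>2 + 2 * of_nat k * (\<alpha> * \<tau> - 1) - 2 * of_nat k * ((\<alpha> * \<tau> - 1)\<^sup>2 / (\<tau>\<^sup>2 - 1)))
      / ((of_nat k)\<^sup>2 * \<alpha> * (\<tau>\<^sup>2 - 1)\<^sup>2) / \<zeta>"
proof -
  define E where "E = \<tau>\<^sup>2 - 1"
  define V where "V = \<alpha> * \<tau> - 1"
  have nz: "E \<noteq> 0" "V \<noteq> 0" using D N by (simp_all add: E_def V_def)
  let ?l = "0 + 2 * (of_nat k * (\<alpha> * \<zeta> ^ k) / (\<alpha> * \<zeta> ^ k - 1) / \<zeta>)
     - (0 + 2 * (1 / \<zeta>) + 2 * (of_nat k * (\<tau> * \<zeta> ^ k) / (\<tau> * \<zeta> ^ k - 1) / \<zeta>))"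
  have l: "has_log_derivative (h_over_G_reg k \<alpha> \<tau>) ?l \<zeta>"
    unfolding h_over_G_reg_def[abs_def]
    by (intro log_derivative_divide log_derivative_mult log_derivative_square log_derivative_const
        log_derivative_self log_derivative_linear_power)
       (use \<alpha> \<zeta> D N in \<open>simp_all add: power2_eq_square\<close>)
  have z: "\<zeta> * (0 + 2 * (a / \<zeta>) - (0 + 2 * (1 / \<zeta>) + 2 * (c / \<zeta>))) = 2 * a - 2 - 2 * c" for a c
    using \<zeta>(1) by (simp add: algebra_simps)
  have "\<zeta> * ?l - (of_nat k - 1) = 2 * (of_nat k * (V + 1) / V) - 2 - 2 * (of_nat k * (E + 1) / E) - (of_nat k - 1)"
    unfolding z \<zeta>(2) by (simp add: V_def E_def power2_eq_square)
  also have "\<dots> = 2 * of_nat k / V - 2 * of_nat k / E - (of_nat k + 1)"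
    using nz by (simp add: field_simps)
  finally have e: "\<zeta> * ?l - (of_nat k - 1) = 2 * of_nat k / V - 2 * of_nat k / E - (of_nat k + 1)" .
  have R: "h_over_G_reg k \<alpha> \<tau> \<zeta> = \<tau>\<^sup>2 * V\<^sup>2 / (\<alpha> * \<zeta>\<^sup>2 * E\<^sup>2)"
    unfolding h_over_G_reg_def \<zeta>(2) by (simp add: power2_eq_square V_def E_def)
  show ?thesis
    unfolding double_root_log_derivative[OF \<zeta>(1) k l] e R
    unfolding \<zeta>(2) E_def[symmetric] V_def[symmetric]
    using \<alpha> nz \<zeta>(1) \<tau>0 k by (simp add: divide_simps) (simp add: power2_eq_square algebra_simps)
qed

lemma deriv_double_root_2:
  "deriv (\<lambda>w. h_times_G_reg k \<alpha> \<tau> (\<zeta> + w) / (root_factor k \<zeta> (\<zeta> + w))\<^sup>2) 0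
    = \<zeta> * (\<tau>\<^sup>2 * ((of_nat k + 1) * (\<tau> - \<alpha>)\<^sup>2 + 2 * of_nat k * \<alpha> * (\<tau> - \<alpha>) - 2 * of_nat k * ((\<tau> - \<alpha>)\<^sup>2 / (\<tau>\<^sup>2 - 1)))
      / ((of_nat k)\<^sup>2 * \<alpha> * (\<tau>\<^sup>2 - 1)\<^sup>2))"
proof -
  define E where "E = \<tau>\<^sup>2 - 1"
  define W where "W = \<tau> - \<alpha>"
  let ?l = "0 + 2 * (of_nat k * (1 * \<zeta> ^ k) / (1 * \<zeta> ^ k - 0) / \<zeta>) + 2 * (of_nat k * (1 * \<zeta> ^ k) / (1 * \<zeta> ^ k - \<alpha>) / \<zeta>)
     - (0 + 2 * (of_nat k * (\<tau> * \<zeta> ^ k) / (\<tau> * \<zeta> ^ k - 1) / \<zeta>))"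
  have tt: "\<tau> * \<tau> = E + 1" "\<tau> = W + \<alpha>" by (simp_all add: power2_eq_square E_def W_def)
  have nz: "E \<noteq> 0" "W \<noteq> 0" using D M by (simp_all add: E_def W_def)
  have l: "has_log_derivative (h_times_G_reg k \<alpha> \<tau>) ?l \<zeta>"
    unfolding h_times_G_reg_def[abs_def]
    by (intro log_derivative_divide log_derivative_mult log_derivative_square log_derivative_const
        log_derivative_self log_derivative_linear_power)
       (use \<alpha> \<zeta> D M \<tau>0 in \<open>simp_all add: power2_eq_square\<close>)
  have z: "\<zeta> * (0 + 2 * (a / \<zeta>) + 2 * (c / \<zeta>) - (0 + 2 * (d / \<zeta>))) = 2 * a + 2 * c - 2 * d" for a c d
    using \<zeta>(1) by (simp add: algebra_simps)
  have "\<zeta> * ?l - (of_nat k - 1) = 2 * of_nat k + 2 * of_nat k * (\<tau> / W) - 2 * of_nat k * ((E + 1) / E) - (of_nat k - 1)"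
    unfolding z \<zeta>(2) using \<tau>0 by (simp add: W_def E_def power2_eq_square mult.assoc)
  also have "\<dots> = 2 * of_nat k * (\<alpha> / W) - 2 * of_nat k / E + (of_nat k + 1)"
    using nz unfolding tt(2) by (simp add: field_simps)
  finally have e: "\<zeta> * ?l - (of_nat k - 1) = 2 * of_nat k * (\<alpha> / W) - 2 * of_nat k / E + (of_nat k + 1)" .
  have R: "h_times_G_reg k \<alpha> \<tau> \<zeta> = \<tau>\<^sup>2 * \<tau>\<^sup>2 * W\<^sup>2 / (\<alpha> * E\<^sup>2)" unfolding h_times_G_reg_def \<zeta>(2) by (simp add: power2_eq_square W_def E_def)
  show ?thesis
    unfolding double_root_log_derivative[OF \<zeta>(1) k l] e R
    unfolding \<zeta>(2) E_def[symmetric] W_def[symmetric]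
    using \<alpha> nz \<zeta>(1) \<tau>0 k by (simp add: divide_simps) (simp add: power2_eq_square power4_eq_xxxx algebra_simps)
qed

text \<open>The sum of squares makes the sign of the residue of \<open>h\<close> visible; it arises from the identity
\<open>(\<tau>\<^sup>2 - 1) * ((\<alpha> * \<tau> - 1) + \<alpha> * (\<tau> - \<alpha>)) - 2 * \<tau> * (\<tau> - \<alpha>) * (\<alpha> * \<tau> - 1) = (\<alpha> * \<tau> - 1)\<^sup>2 + (\<tau> - \<alpha>)\<^sup>2\<close>.\<close>

lemma deriv_double_root_3:
  "deriv (\<lambda>w. h_form_reg k \<alpha> \<tau> (\<zeta> + w) / (root_factor k \<zeta> (\<zeta> + w))\<^sup>2) 0
    = \<tau>\<^sup>2 * ((\<alpha> * \<tau> - 1)\<^sup>2 + (\<tau> - \<alpha>)\<^sup>2) / (of_nat k * \<alpha> * (\<tau>\<^sup>2 - 1) ^ 3)"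
proof -
  define E where "E = \<tau>\<^sup>2 - 1"
  define W where "W = \<tau> - \<alpha>"
  define V where "V = \<alpha> * \<tau> - 1"
  let ?l = "0 + (of_nat k * (1 * \<zeta> ^ k) / (1 * \<zeta> ^ k - 0) / \<zeta> - 1 / \<zeta>) + of_nat k * (1 * \<zeta> ^ k) / (1 * \<zeta> ^ k - \<alpha>) / \<zeta>
     + of_nat k * (\<alpha> * \<zeta> ^ k) / (\<alpha> * \<zeta> ^ k - 1) / \<zeta>
     - (0 + 2 * (of_nat k * (\<tau> * \<zeta> ^ k) / (\<tau> * \<zeta> ^ k - 1) / \<zeta>))"
  have nz: "E \<noteq> 0" "W \<noteq> 0" "V \<noteq> 0" using D M N by (simp_all add: E_def W_def V_def)
  have l: "has_log_derivative (h_form_reg k \<alpha> \<tau>) ?l \<zeta>"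
    unfolding h_form_reg_def[abs_def]
    by (intro log_derivative_divide log_derivative_mult log_derivative_square log_derivative_const
        log_derivative_self log_derivative_linear_power)
       (use \<alpha> \<zeta> D M N \<tau>0 in \<open>simp_all add: power2_eq_square\<close>)
  have "\<zeta> * ?l - (of_nat k - 1) = of_nat k * (\<tau> / W + \<alpha> * \<tau> / V - 2 * (\<tau> * \<tau> / E))"
  proof -
    have z: "\<zeta> * (0 + (a / \<zeta> - 1 / \<zeta>) + c / \<zeta> + d / \<zeta> - (0 + 2 * (f / \<zeta>))) = a - 1 + c + d - 2 * f" for a c d f
      using \<zeta>(1) by (simp add: algebra_simps)
    show ?thesis
      unfolding z \<zeta>(2) using \<tau>0 by (simp add: W_def V_def E_def power2_eq_square distrib_left right_diff_distrib)
  qed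
  also have "\<dots> = of_nat k * (\<tau> * (E * (V + \<alpha> * W) - 2 * \<tau> * W * V) / (W * V * E))"
    using nz by (simp add: field_simps)
  also have "E * (V + \<alpha> * W) - 2 * \<tau> * W * V = V\<^sup>2 + W\<^sup>2"
    unfolding E_def V_def W_def by algebra
  finally have e: "\<zeta> * ?l - (of_nat k - 1) = of_nat k * (\<tau> * (V\<^sup>2 + W\<^sup>2) / (W * V * E))" .
  have R: "h_form_reg k \<alpha> \<tau> \<zeta> = \<tau>\<^sup>2 * (\<tau> / \<zeta>) * W * V / (\<alpha> * E\<^sup>2)" unfolding h_form_reg_def \<zeta>(2) by (simp add: power2_eq_square W_def E_def V_def)
  show ?thesis
    unfolding double_root_log_derivative[OF \<zeta>(1) k l] e R
    unfolding \<zeta>(2) E_def[symmetric] W_def[symmetric] V_def[symmetric]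
    using \<alpha> nz \<zeta>(1) \<tau>0 k by (simp add: divide_simps) (simp add: power2_eq_square power3_eq_cube algebra_simps)
qed

end

lemma forms_root_factor:
  assumes "\<zeta> ^ k = \<tau>" "k > 0" "w \<noteq> 0" "\<zeta> + w \<noteq> 0"
  shows "h_over_G_reg k \<alpha> \<tau> (\<zeta> + w) / (root_factor k \<zeta> (\<zeta> + w))\<^sup>2 = w\<^sup>2 * h_over_G k \<alpha> \<tau> (\<zeta> + w)"
    "h_times_G_reg k \<alpha> \<tau> (\<zeta> + w) / (root_factor k \<zeta> (\<zeta> + w))\<^sup>2 = w\<^sup>2 * h_times_G k \<alpha> \<tau> (\<zeta> + w)"
    "h_form_reg k \<alpha> \<tau> (\<zeta> + w) / (root_factor k \<zeta> (\<zeta> + w))\<^sup>2 = w\<^sup>2 * h_form k \<alpha> \<tau> (\<zeta> + w)"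
proof -
  have "(\<zeta> + w) ^ k - \<tau> = w * root_factor k \<zeta> (\<zeta> + w)" using root_factor[of "\<zeta> + w" k \<zeta>] assms(1) by simp
  then have *: "((\<zeta> + w) ^ k - \<tau>)\<^sup>2 = w\<^sup>2 * (root_factor k \<zeta> (\<zeta> + w))\<^sup>2" by (simp add: power_mult_distrib)
  have p: "(\<zeta> + w) ^ k / (\<zeta> + w) = (\<zeta> + w) ^ (k - 1)" using assms by (cases k) auto
  show "h_over_G_reg k \<alpha> \<tau> (\<zeta> + w) / (root_factor k \<zeta> (\<zeta> + w))\<^sup>2 = w\<^sup>2 * h_over_G k \<alpha> \<tau> (\<zeta> + w)"
    unfolding h_over_G_reg_def h_over_G_def * using assms by simp
  show "h_times_G_reg k \<alpha> \<tau> (\<zeta> + w) / (root_factor k \<zeta> (\<zeta> + w))\<^sup>2 = w\<^sup>2 * h_times_G k \<alpha> \<tau> (\<zeta> + w)"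
    unfolding h_times_G_reg_def h_times_G_def * using assms by (simp add: mult_ac)
  show "h_form_reg k \<alpha> \<tau> (\<zeta> + w) / (root_factor k \<zeta> (\<zeta> + w))\<^sup>2 = w\<^sup>2 * h_form k \<alpha> \<tau> (\<zeta> + w)"
    unfolding h_form_reg_def h_form_def * using assms p by (simp add: mult_ac)
qed

section \<open>Orders of vanishing and limit normals\<close>

lemma has_order_atI:
  assumes S: "open S" "p \<in> S" and g: "g holomorphic_on S" "g p \<noteq> 0"
    and f: "\<And>w. w \<in> S \<Longrightarrow> w \<noteq> p \<Longrightarrow> f w = g w * (w - p) powi n"
  shows "has_order_at f p n"
proof -
  have "isCont g p" using S g(1) by (meson continuous_on_eq_continuous_at holomorphic_on_imp_continuous_on)
  then have "\<forall>\<^sub>F w in at p. g w \<noteq> 0" using g(2) unfolding isCont_def by (rule tendsto_imp_eventually_ne)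
  moreover have "\<forall>\<^sub>F w in at p. w \<in> S" using S eventually_at_topological by blast
  moreover have "\<forall>\<^sub>F w in at p. w \<noteq> p" by (simp add: eventually_at_filter)
  ultimately have "\<forall>\<^sub>F w in at p. f w \<noteq> 0" by eventually_elim (simp add: f)
  then show ?thesis
    unfolding has_order_at_def using zorder_eqI[OF S g f] by (simp add: eventually_frequently)
qed

lemma continuous_inv_stereographic: "isCont inv_stereographic g"
proof -
  have "((\<lambda>x. inv_stereographic x $ j) \<longlongrightarrow> inv_stereographic g $ j) (at g)" for j
  proof -
    have "(cmod g)\<^sup>2 + 1 \<noteq> 0" by (simp add: add_nonneg_eq_0_iff)
    then have "isCont (\<lambda>x. inv_stereographic x $ j) g"
      using exhaust_3[of j]
      by (elim disjE; simp only: inv_stereographic_nth; intro continuous_intros; simp)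
    then show ?thesis by (simp add: isCont_def)
  qed
  then show ?thesis unfolding isCont_def by (intro vec_tendstoI) 
qed

text \<open>Inversion of \<open>g\<close> is a half-turn of the sphere, which reduces limits at poles of \<open>G\<close> to continuity at
\<open>0\<close>.\<close>

lemma inv_stereographic_inverse:
  assumes "g \<noteq> 0"
  shows "inv_stereographic (inverse g) $ 1 = inv_stereographic g $ 1"
    "inv_stereographic (inverse g) $ 2 = - inv_stereographic g $ 2"
    "inv_stereographic (inverse g) $ 3 = - inv_stereographic g $ 3"
proof -
  define c where "c = (cmod g)\<^sup>2"
  have c: "c > 0" using assms by (simp add: c_def)
  have i: "Re (inverse g) = Re g / c" "Im (inverse g) = - Im g / c" "(cmod (inverse g))\<^sup>2 = 1 / c"
    by (simp add: c_def cmod_power2, simp add: c_def cmod_power2,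
        simp add: c_def inverse_eq_divide norm_divide power_one_over)
  show "inv_stereographic (inverse g) $ 1 = inv_stereographic g $ 1"
    "inv_stereographic (inverse g) $ 2 = - inv_stereographic g $ 2"
    "inv_stereographic (inverse g) $ 3 = - inv_stereographic g $ 3"
    unfolding inv_stereographic_nth i c_def[symmetric] using c
    by (simp_all add: divide_simps)
qed

lemma vertical_inv_stereographic: "vertical (inv_stereographic g) \<Longrightarrow> g = 0"
proof -
  assume "vertical (inv_stereographic g)"
  then have "inv_stereographic g $ 1 = 0" "inv_stereographic g $ 2 = 0" unfolding vertical_def by auto
  moreover have "(cmod g)\<^sup>2 + 1 > 0" by (simp add: add_nonneg_pos)
  ultimately show ?thesis by (auto simp: inv_stereographic_nth complex_eq_iff)
qed

section \<open>The surface\<close>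

lemma forms_quotient:
  assumes "z \<noteq> 0" "z ^ k - \<alpha> \<noteq> 0" "\<alpha> * z ^ k - 1 \<noteq> 0" "k > 0"
  shows "h_over_G k \<alpha> \<tau> z = h_form k \<alpha> \<tau> z / (z ^ (k + 1) * (z ^ k - \<alpha>) / (\<alpha> * z ^ k - 1))"
    and "h_times_G k \<alpha> \<tau> z = z ^ (k + 1) * (z ^ k - \<alpha>) / (\<alpha> * z ^ k - 1) * h_form k \<alpha> \<tau> z"
proof -
  define u where "u = z ^ k"
  define x where "x = u - \<alpha>"
  define y where "y = \<alpha> * u - 1"
  define d where "d = (u - \<tau>)\<^sup>2"
  define e where "e = (\<tau> * u - 1)\<^sup>2"
  have p: "z ^ (k - 1) = u / z" "z ^ (k + 1) = u * z" using assms by (cases k; simp add: u_def)+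
  have nz: "u \<noteq> 0" "x \<noteq> 0" "y \<noteq> 0" "z \<noteq> 0" using assms by (auto simp: u_def x_def y_def)
  show "h_over_G k \<alpha> \<tau> z = h_form k \<alpha> \<tau> z / (z ^ (k + 1) * (z ^ k - \<alpha>) / (\<alpha> * z ^ k - 1))"
    unfolding h_over_G_def h_form_def p u_def[symmetric] d_def[symmetric] e_def[symmetric] y_def[symmetric] x_def[symmetric]
    using nz by (simp add: divide_simps power2_eq_square)
  show "h_times_G k \<alpha> \<tau> z = z ^ (k + 1) * (z ^ k - \<alpha>) / (\<alpha> * z ^ k - 1) * h_form k \<alpha> \<tau> z"
    unfolding h_times_G_def h_form_def p u_def[symmetric] d_def[symmetric] e_def[symmetric] y_def[symmetric] x_def[symmetric]
    using nz by (simp add: divide_simps power2_eq_square)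
qed

text \<open>In the parameter \<open>w = 1 / z\<close> the roles of \<open>h / G\<close> and \<open>G * h\<close> are exchanged: now \<open>G * h\<close> carries the double
pole, after multiplication with the derivative \<open>- 1 / w\<^sup>2\<close> of the chart.\<close>

lemma forms_at_inverse:
  assumes "w \<noteq> 0" "k > 0"
  shows "h_over_G k \<alpha> \<tau> (inverse w) = \<tau>\<^sup>2 * w\<^sup>2 * (w ^ k)\<^sup>2 * (\<alpha> - w ^ k)\<^sup>2 / (\<alpha> * (1 - \<tau> * w ^ k)\<^sup>2 * (\<tau> - w ^ k)\<^sup>2)"
    and "h_times_G k \<alpha> \<tau> (inverse w) = \<tau>\<^sup>2 * (1 - \<alpha> * w ^ k)\<^sup>2 / (\<alpha> * (1 - \<tau> * w ^ k)\<^sup>2 * (\<tau> - w ^ k)\<^sup>2)"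
    and "h_form k \<alpha> \<tau> (inverse w) = \<tau>\<^sup>2 * (w ^ k * w) * (1 - \<alpha> * w ^ k) * (\<alpha> - w ^ k) / (\<alpha> * (1 - \<tau> * w ^ k)\<^sup>2 * (\<tau> - w ^ k)\<^sup>2)"
proof -
  define u where "u = w ^ k"
  define x where "x = 1 - \<alpha> * u"
  define y where "y = \<alpha> - u"
  define d where "d = 1 - \<tau> * u"
  define e where "e = \<tau> - u"
  have u0: "u \<noteq> 0" using assms by (simp add: u_def)
  have ck: "(inverse w) ^ k = 1 / u" "(inverse w)\<^sup>2 = 1 / w\<^sup>2"
    by (simp_all add: u_def inverse_eq_divide power_one_over)
  have ck1: "(inverse w) ^ (k - 1) = w / u"
  proof -
    have "(inverse w) ^ k = inverse w ^ (k - 1) * inverse w" using assms by (cases k) auto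
    then show ?thesis using ck u0 assms by (simp add: field_simps)
  qed
  have f: "1 / u - \<tau> = d / u" "\<tau> * (1 / u) - 1 = e / u" "1 / u - \<alpha> = x / u" "\<alpha> * (1 / u) - 1 = y / u"
    using u0 by (simp_all add: field_simps d_def e_def x_def y_def)
  note folds = u_def[symmetric] x_def[symmetric] y_def[symmetric] d_def[symmetric] e_def[symmetric]
  show "h_over_G k \<alpha> \<tau> (inverse w) = \<tau>\<^sup>2 * w\<^sup>2 * (w ^ k)\<^sup>2 * (\<alpha> - w ^ k)\<^sup>2 / (\<alpha> * (1 - \<tau> * w ^ k)\<^sup>2 * (\<tau> - w ^ k)\<^sup>2)"
    unfolding h_over_G_def ck f folds using u0 assms by (simp add: power2_eq_square divide_simps)
  show "h_times_G k \<alpha> \<tau> (inverse w) = \<tau>\<^sup>2 * (1 - \<alpha> * w ^ k)\<^sup>2 / (\<alpha> * (1 - \<tau> * w ^ k)\<^sup>2 * (\<tau> - w ^ k)\<^sup>2)"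
    unfolding h_times_G_def ck f folds using u0 assms by (simp add: power2_eq_square divide_simps)
  show "h_form k \<alpha> \<tau> (inverse w) = \<tau>\<^sup>2 * (w ^ k * w) * (1 - \<alpha> * w ^ k) * (\<alpha> - w ^ k) / (\<alpha> * (1 - \<tau> * w ^ k)\<^sup>2 * (\<tau> - w ^ k)\<^sup>2)"
    unfolding h_form_def ck ck1 f folds using u0 assms by (simp add: power2_eq_square divide_simps)
qed

lemma holomorphic_forms:
  assumes "\<alpha> \<noteq> 0" "\<And>z. z \<in> S \<Longrightarrow> z \<noteq> 0 \<and> z ^ k - \<tau> \<noteq> 0 \<and> \<tau> * z ^ k - 1 \<noteq> 0"
  shows "h_over_G k \<alpha> \<tau> holomorphic_on S" "h_times_G k \<alpha> \<tau> holomorphic_on S" "h_form k \<alpha> \<tau> holomorphic_on S"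
  unfolding h_over_G_def[abs_def] h_times_G_def[abs_def] h_form_def[abs_def]
  by (intro holomorphic_intros; use assms in simp)+

lemma has_order_at_unique: "has_order_at f p m \<Longrightarrow> has_order_at f p n \<longleftrightarrow> n = m"
  by (auto simp: has_order_at_def)

locale catenoid_ring =
  fixes k :: nat and b \<alpha> :: real
  assumes k: "k > 1" and b: "0 < b" "b < 1" and \<alpha>: "1 < \<alpha>" "\<alpha> * b ^ k < 1"
    and bal: "balance (real k) \<alpha> (b ^ k) (b\<^sup>2) = 0"
begin

abbreviation (input) A :: complex where "A \<equiv> complex_of_real \<alpha>"
abbreviation (input) B :: complex where "B \<equiv> complex_of_real (b ^ k)"

definition G :: "complex \<Rightarrow> complex" where "G z = z ^ (k + 1) * (z ^ k - A) / (A * z ^ k - 1)"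

abbreviation H1 where "H1 \<equiv> h_over_G k A B"
abbreviation H2 where "H2 \<equiv> h_times_G k A B"
abbreviation H3 where "H3 \<equiv> h_form k A B"

definition P :: "rsphere set" where
  "P = {Fin 0, Infty} \<union> Fin ` {z. z ^ k = B} \<union> Fin ` {z. z ^ k = 1 / B}"

definition Z :: "complex set" where "Z = {z. z ^ k = A} \<union> {z. z ^ k = 1 / A}"

lemma \<beta>: "0 < b ^ k" "b ^ k < 1"
  using b k by (auto simp: power_less_one_iff)

lemma B_nz: "B \<noteq> 0" using b by simp
lemma A_nz: "A \<noteq> 0" using \<alpha> by simp

lemma mem_Sigma: "z \<in> punctured_sphere P \<longleftrightarrow> z \<noteq> 0 \<and> z ^ k - B \<noteq> 0 \<and> B * z ^ k - 1 \<noteq> 0"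
  unfolding punctured_sphere_def P_def using B_nz by (auto simp: field_simps)

lemma notin_Z: "z \<notin> Z \<longleftrightarrow> z ^ k - A \<noteq> 0 \<and> A * z ^ k - 1 \<noteq> 0"
  unfolding Z_def using A_nz by (auto simp: field_simps)

lemma finite_roots: "finite {z :: complex. z ^ k = c}"
  using k by (intro finite_nth_roots) simp

lemma G_H:
  assumes z: "z \<in> punctured_sphere P" "z \<notin> Z"
  shows "G z \<noteq> 0" "H1 z = H3 z / G z" "H2 z = G z * H3 z"
proof -
  note z' = z(1)[unfolded mem_Sigma] z(2)[unfolded notin_Z]
  show "G z \<noteq> 0" using z' by (simp add: G_def)
  show "H1 z = H3 z / G z" "H2 z = G z * H3 z"
    unfolding G_def using forms_quotient[of z k A B] z' k by simp_all
qed

lemma holomorphic_H: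
  "H1 holomorphic_on punctured_sphere P" "H2 holomorphic_on punctured_sphere P" "H3 holomorphic_on punctured_sphere P"
  using holomorphic_forms[OF A_nz, of "punctured_sphere P" k B] mem_Sigma by blast+

sublocale weierstrass_forms P G H3 H1 H2 Z
proof
  show "finite P" "finite Z" "Infty \<in> P" using finite_roots by (auto simp: P_def Z_def)
qed (use holomorphic_H G_H in auto)

text \<open>The smallest absolute value of a nonzero puncture, zero or pole is \<open>b\<close>, because
\<open>b ^ k < 1 / \<alpha> < \<alpha>\<close> and \<open>b ^ k < 1 / b ^ k\<close>.\<close>

lemma power_small:
  assumes w: "cmod w < b"
  shows "w ^ k - B \<noteq> 0" "B * w ^ k - 1 \<noteq> 0" "w ^ k - A \<noteq> 0" "A * w ^ k - 1 \<noteq> 0"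
proof -
  have less: "cmod (w ^ k) < b ^ k" using w k by (simp add: norm_power power_strict_mono)
  show "w ^ k - B \<noteq> 0" using less b by (metis abs_of_pos eq_iff_diff_eq_0 less_irrefl norm_of_real zero_less_power)
  have "cmod (w ^ k) < \<alpha>" using less \<beta> \<alpha> by linarith
  then show "w ^ k - A \<noteq> 0" using \<alpha> by (metis abs_of_pos eq_iff_diff_eq_0 less_irrefl norm_of_real less_trans zero_less_one)
  have "cmod (A * w ^ k) \<le> \<alpha> * b ^ k" unfolding norm_mult using less \<alpha> by (simp add: mult_left_mono)
  then show "A * w ^ k - 1 \<noteq> 0" using \<alpha>(2) by (metis eq_iff_diff_eq_0 norm_one not_le)
  have "cmod B = b ^ k" unfolding norm_of_real using \<beta> by simp
  then have "cmod (B * w ^ k) \<le> b ^ k * b ^ k" unfolding norm_mult using less \<beta> by (simp add: mult_left_mono)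
  also have "\<dots> < 1 * 1" using \<beta> by (intro mult_strict_mono) auto
  finally show "B * w ^ k - 1 \<noteq> 0" by (metis eq_iff_diff_eq_0 norm_one less_irrefl mult_1)
qed

lemma power_k_has_zero_derivative: "((\<lambda>w::complex. w ^ k) has_field_derivative 0) (at 0)"
proof -
  have "0 ^ (k - Suc 0) = (0 :: complex)" using k by simp
  then show ?thesis by (auto intro!: derivative_eq_intros)
qed

text \<open>The residues at \<open>0\<close> vanish: \<open>q1\<close> depends on \<open>w\<close> only through \<open>w ^ k\<close> with \<open>k \<ge> 2\<close>, and \<open>G * h\<close> and \<open>h\<close> are
holomorphic at \<open>0\<close>. This is what makes the end planar.\<close>

lemma end_expansion_zero:
  defines "q1 \<equiv> \<lambda>w. B\<^sup>2 * (A * w ^ k - 1)\<^sup>2 / (A * (w ^ k - B)\<^sup>2 * (B * w ^ k - 1)\<^sup>2)"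
    and "q2 \<equiv> \<lambda>w. w\<^sup>2 * H2 w" and "\<eta> \<equiv> \<lambda>w. w\<^sup>2 * H3 w"
  shows "end_expansion (Fin 0) b q1 q2 \<eta>" "deriv q1 0 = 0" "deriv q2 0 = 0" "deriv \<eta> 0 = 0"
proof -
  note ps = power_small
  have q1h: "q1 holomorphic_on ball 0 b" and q2h: "q2 holomorphic_on ball 0 b" and \<eta>h: "\<eta> holomorphic_on ball 0 b"
    unfolding q1_def q2_def \<eta>_def h_times_G_def h_form_def using ps A_nz by (auto intro!: holomorphic_intros)
  have H2h: "H2 holomorphic_on ball 0 b" and H3h: "H3 holomorphic_on ball 0 b"
    unfolding h_times_G_def[abs_def] h_form_def[abs_def] using ps A_nz by (auto intro!: holomorphic_intros)
  have d1: "(q1 has_field_derivative 0) (at 0)"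
    unfolding q1_def using k b A_nz
    by (auto intro!: derivative_eq_intros power_k_has_zero_derivative simp: power_0_left)
  have d2: "((\<lambda>w. w\<^sup>2 * H w) has_field_derivative 0) (at 0)" if "H holomorphic_on ball 0 b" for H
  proof -
    have "(H has_field_derivative deriv H 0) (at 0)" using holomorphic_derivI[OF that open_ball] b by simp
    then show ?thesis by (auto intro!: derivative_eq_intros)
  qed
  show d: "deriv q1 0 = 0" "deriv q2 0 = 0" "deriv \<eta> 0 = 0"
    unfolding q2_def \<eta>_def using d1 d2[OF H2h] d2[OF H3h] by (simp_all add: DERIV_imp_deriv)
  have dc: "deriv (chart (Fin 0)) w = 1" for w
    unfolding chart_eq by simp
  have "q1 w = w\<^sup>2 * H1 w" if "w \<noteq> 0" for w
    unfolding q1_def h_over_G_def using that by simp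
  moreover have "q1 0 \<noteq> 0" unfolding q1_def using A_nz b k by (simp add: power_0_left)
  ultimately show "end_expansion (Fin 0) b q1 q2 \<eta>"
    unfolding end_expansion_def d using b q1h q2h \<eta>h ps
    by (auto simp: dc mem_Sigma notin_Z q2_def \<eta>_def simp del: right_minus_eq)
qed

lemma end_expansion_infinity:
  defines "q1 \<equiv> \<lambda>w. - (B\<^sup>2 * w\<^sup>2 * (w ^ k)\<^sup>2 * (A - w ^ k)\<^sup>2 / (A * (1 - B * w ^ k)\<^sup>2 * (B - w ^ k)\<^sup>2))"
    and "q2 \<equiv> \<lambda>w. - (B\<^sup>2 * (1 - A * w ^ k)\<^sup>2 / (A * (1 - B * w ^ k)\<^sup>2 * (B - w ^ k)\<^sup>2))"
    and "\<eta> \<equiv> \<lambda>w. - (B\<^sup>2 * (w ^ k * w) * (1 - A * w ^ k) * (A - w ^ k) / (A * (1 - B * w ^ k)\<^sup>2 * (B - w ^ k)\<^sup>2))"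
  shows "end_expansion Infty b q1 q2 \<eta>" "deriv q1 0 = 0" "deriv q2 0 = 0" "deriv \<eta> 0 = 0"
proof -
  have ps: "B - w ^ k \<noteq> 0" "1 - B * w ^ k \<noteq> 0" if "cmod w < b" for w
    using power_small[OF that] by (metis right_minus_eq)+
  have q1h: "q1 holomorphic_on ball 0 b" and q2h: "q2 holomorphic_on ball 0 b" and \<eta>h: "\<eta> holomorphic_on ball 0 b"
    unfolding q1_def q2_def \<eta>_def using ps A_nz by (auto intro!: holomorphic_intros)
  have "(q1 has_field_derivative 0) (at 0)" "(q2 has_field_derivative 0) (at 0)" "(\<eta> has_field_derivative 0) (at 0)"
    unfolding q1_def q2_def \<eta>_def using k b A_nz
    by (auto intro!: derivative_eq_intros power_k_has_zero_derivative simp: power_0_left)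
  then show d: "deriv q1 0 = 0" "deriv q2 0 = 0" "deriv \<eta> 0 = 0" by (simp_all add: DERIV_imp_deriv)
  have "q2 0 \<noteq> 0" unfolding q2_def using A_nz b k by (simp add: power_0_left)
  moreover have "chart Infty w \<in> \<Sigma> - Z \<and>
        q1 w = w\<^sup>2 * (H1 (chart Infty w) * deriv (chart Infty) w) \<and>
        q2 w = w\<^sup>2 * (H2 (chart Infty w) * deriv (chart Infty) w) \<and>
        \<eta> w = w\<^sup>2 * (H3 (chart Infty w) * deriv (chart Infty) w)" if w: "w \<in> ball 0 b - {0}" for w
  proof -
    have w': "cmod w < b" "w \<noteq> 0" "k > 0" using w k by auto
    have dc: "deriv (chart Infty) w = - 1 / w\<^sup>2"
      unfolding chart_eq using w' by (intro DERIV_imp_deriv) (auto intro!: derivative_eq_intros simp: power2_eq_square field_simps)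
    have "inverse w ^ k - c \<noteq> 0 \<and> c * inverse w ^ k - 1 \<noteq> 0" if "w ^ k - c \<noteq> 0" "c * w ^ k - 1 \<noteq> 0" for c
      using that w'(2) by (auto simp: power_inverse field_simps)
    then have "inverse w \<in> \<Sigma> - Z"
      unfolding Diff_iff mem_Sigma notin_Z using power_small[OF w'(1)] w' by auto
    moreover have "w\<^sup>2 * (H * (- 1 / w\<^sup>2)) = - H" for H using w' by simp
    ultimately show ?thesis
      unfolding dc chart.simps q1_def q2_def \<eta>_def by (simp only: forms_at_inverse[OF w'(2,3)])
  qed
  ultimately show "end_expansion Infty b q1 q2 \<eta>"
    unfolding end_expansion_def d using b q1h q2h \<eta>h by simp
qed

text \<open>The value \<open>\<tau>\<close> of \<open>\<zeta> ^ k\<close> at a catenoid end \<open>\<zeta>\<close>, together with \<open>s = \<bar>\<zeta>\<bar>\<^sup>2\<close>.\<close>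

definition catenoid_value :: "real \<Rightarrow> real \<Rightarrow> bool" where
  "catenoid_value \<tau> s \<longleftrightarrow> (\<tau> = b ^ k \<and> s = b\<^sup>2) \<or> (\<tau> = 1 / b ^ k \<and> s = 1 / b\<^sup>2)"

lemma catenoid_valueD:
  assumes "catenoid_value \<tau> s"
  shows "\<tau> > 0" "\<tau>\<^sup>2 \<noteq> 1" "\<alpha> * \<tau> \<noteq> 1" "\<tau> \<noteq> \<alpha>" "balance (real k) \<alpha> \<tau> s = 0"
    "h_over_G k A (of_real \<tau>) = H1" "h_times_G k A (of_real \<tau>) = H2" "h_form k A (of_real \<tau>) = H3"
    "z ^ k = of_real \<tau> \<Longrightarrow> z * cnj z = of_real s"
    "z ^ k = of_real \<tau> \<Longrightarrow> Fin z \<in> P"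
    "of_real \<tau> * z ^ k - 1 = 0 \<Longrightarrow> Fin z \<in> P"
proof -
  define \<beta> where "\<beta> = b ^ k"
  have \<beta>: "0 < \<beta>" "\<beta> < 1" "\<alpha> * \<beta> < 1" using \<beta> \<alpha> by (simp_all add: \<beta>_def)
  have b2: "\<beta>\<^sup>2 < 1" using \<beta> power_strict_mono[of \<beta> 1 2] by simp
  have gt: "\<alpha> * (1 / \<beta>) > 1" using \<alpha> \<beta> by (simp add: field_simps)
  have bal': "balance (real k) \<alpha> (1 / \<beta>) (1 / b\<^sup>2) = 0"
    using balance_inverse[of \<beta> "b\<^sup>2" "real k" \<alpha>] \<beta> b2 b bal by (simp add: \<beta>_def)
  have c: "\<tau> = \<beta> \<and> s = b\<^sup>2 \<or> \<tau> = 1 / \<beta> \<and> s = 1 / b\<^sup>2" using assms unfolding catenoid_value_def \<beta>_def .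
  show "\<tau> > 0" using c \<beta> by auto
  show "\<tau>\<^sup>2 \<noteq> 1" using c \<beta> b2 by (auto simp: power_one_over)
  show "\<alpha> * \<tau> \<noteq> 1" using c \<beta> gt by auto
  show "\<tau> \<noteq> \<alpha>" using c \<beta> \<alpha> by (auto simp: field_simps)
  show "balance (real k) \<alpha> \<tau> s = 0" using c bal bal' by (auto simp: \<beta>_def)
  have "complex_of_real \<tau> = B \<or> complex_of_real \<tau> = 1 / B" using c by (auto simp: \<beta>_def)
  then show "h_over_G k A (of_real \<tau>) = H1" "h_times_G k A (of_real \<tau>) = H2" "h_form k A (of_real \<tau>) = H3"
    using forms_inverse[OF B_nz] by auto
  show "Fin z \<in> P" if "z ^ k = of_real \<tau>"
    using c that by (auto simp: P_def \<beta>_def)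
  show "Fin z \<in> P" if "of_real \<tau> * z ^ k - 1 = 0"
  proof -
    have "z ^ k = 1 / of_real \<tau>" using that \<open>\<tau> > 0\<close> by (simp add: field_simps)
    then show ?thesis using c by (auto simp: P_def \<beta>_def)
  qed
  show "z * cnj z = of_real s" if z: "z ^ k = of_real \<tau>"
  proof -
    have n: "cmod z ^ k = \<tau>" using z \<open>\<tau> > 0\<close> by (metis abs_of_pos norm_of_real norm_power)
    have eq: "cmod z = x" if "cmod z ^ k = x ^ k" "x > 0" for x
      using that k power_eq_imp_eq_base[of "cmod z" k x] by simp
    have "s = (cmod z)\<^sup>2"
      using c
    proof
      assume "\<tau> = \<beta> \<and> s = b\<^sup>2"
      then show ?thesis using eq[of b] n b by (simp add: \<beta>_def)
    next
      assume "\<tau> = 1 / \<beta> \<and> s = 1 / b\<^sup>2"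
      then show ?thesis using eq[of "1 / b"] n b by (simp add: \<beta>_def power_one_over)
    qed
    then show ?thesis by (metis complex_norm_square)
  qed
qed

text \<open>The balance equation makes the residues of the triple real. The residue of \<open>h\<close> is a positive
multiple of \<open>1 / (\<tau>\<^sup>2 - 1) ^ 3\<close>.\<close>

lemma end_expansion_root:
  assumes \<tau>: "catenoid_value \<tau> s" and \<zeta>: "\<zeta> ^ k = of_real \<tau>"
  obtains \<delta> q1 q2 \<eta> where "end_expansion (Fin \<zeta>) \<delta> q1 q2 \<eta>" "sgn (Re (deriv \<eta> 0)) = sgn (\<tau>\<^sup>2 - 1)"
proof -
  let ?T = "complex_of_real \<tau>"
  note \<tau>' = catenoid_valueD[OF \<tau>]
  have \<zeta>0: "\<zeta> \<noteq> 0" using \<zeta> \<tau>'(1) k by (auto simp: power_0_left)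
  have k0: "k > 0" using k by simp
  have D: "?T\<^sup>2 - 1 \<noteq> 0" using \<tau>'(2) by (metis eq_iff_diff_eq_0 of_real_1 of_real_eq_iff of_real_power)
  have N: "A * ?T - 1 \<noteq> 0" using \<tau>'(3) by (metis eq_iff_diff_eq_0 of_real_1 of_real_eq_iff of_real_mult)
  have M: "?T - A \<noteq> 0" using \<tau>'(4) by simp
  note dd = deriv_double_root_1[OF k0 A_nz \<zeta>0 \<zeta> D N M] deriv_double_root_2[OF k0 A_nz \<zeta>0 \<zeta> D N M]
    deriv_double_root_3[OF k0 A_nz \<zeta>0 \<zeta> D N M]
  define q where "q R w = R (\<zeta> + w) / (root_factor k \<zeta> (\<zeta> + w))\<^sup>2" for R and w :: complex
  define q1 where "q1 = q (h_over_G_reg k A ?T)"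
  define q2 where "q2 = q (h_times_G_reg k A ?T)"
  define \<eta> where "\<eta> = q (h_form_reg k A ?T)"
  obtain \<delta> where \<delta>: "\<delta> > 0" "\<And>z. z \<in> ball \<zeta> \<delta> \<Longrightarrow> z \<noteq> \<zeta> \<Longrightarrow> z \<notin> pts \<union> Z"
    using finite_ball_avoid[OF open_UNIV, of "pts \<union> Z" \<zeta>] finite_pts finZ by auto
  have in_ball: "\<zeta> + w \<in> ball \<zeta> \<delta>" if "w \<in> ball 0 \<delta>" for w using that by (simp add: dist_norm)
  have mem: "\<zeta> + w \<in> \<Sigma>" "\<zeta> + w \<notin> Z" if "w \<in> ball 0 \<delta> - {0}" for w
    using \<delta>(2)[OF in_ball[of w]] that by (auto simp: Sigma_eq)
  have nz0: "\<zeta> + w \<noteq> 0" if "w \<in> ball 0 \<delta>" for w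
    using mem[of w] that \<zeta>0 by (cases "w = 0") (auto simp: mem_Sigma)
  have rf: "root_factor k \<zeta> (\<zeta> + w) \<noteq> 0" if "w \<in> ball 0 \<delta>" for w
  proof (rule root_factor_nonzero)
    have "(\<zeta> + w) ^ k \<noteq> \<zeta> ^ k" if "w \<noteq> 0"
      using mem(1)[of w] \<open>w \<in> ball 0 \<delta>\<close> that \<tau>'(10)[of "\<zeta> + w"] \<zeta> by (auto simp: punctured_sphere_def)
    then show "(\<zeta> + w) ^ k \<noteq> \<zeta> ^ k \<or> \<zeta> + w = \<zeta> \<and> \<zeta> \<noteq> 0 \<and> k > 0" using \<zeta>0 k by auto
  qed
  have tz: "?T * (\<zeta> + w) ^ k - 1 \<noteq> 0" if "w \<in> ball 0 \<delta>" for w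
  proof (cases "w = 0")
    case True then show ?thesis using D \<zeta> by (simp add: power2_eq_square)
  next
    case False then show ?thesis
      using mem(1)[of w] that \<tau>'(11)[of "\<zeta> + w"] by (auto simp: punctured_sphere_def)
  qed
  have hol: "q1 holomorphic_on ball 0 \<delta>" "q2 holomorphic_on ball 0 \<delta>" "\<eta> holomorphic_on ball 0 \<delta>"
    unfolding q1_def q2_def \<eta>_def q_def[abs_def] h_over_G_reg_def h_times_G_reg_def h_form_reg_def
    using rf tz nz0 A_nz by (auto intro!: holomorphic_intros)
  have q_eq: "q1 w = w\<^sup>2 * H1 (\<zeta> + w)" "q2 w = w\<^sup>2 * H2 (\<zeta> + w)" "\<eta> w = w\<^sup>2 * H3 (\<zeta> + w)"
    if "w \<in> ball 0 \<delta> - {0}" for w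
    using forms_root_factor[OF \<zeta> k0, of w A] that nz0[of w] unfolding q1_def q2_def \<eta>_def q_def \<tau>'(6,7,8) by auto
  have dc: "deriv (chart (Fin \<zeta>)) w = 1" for w
    unfolding chart_eq by (rule DERIV_imp_deriv) (auto intro!: derivative_eq_intros)
  have q10: "q1 0 \<noteq> 0"
    using rf[of 0] \<delta>(1) D N \<zeta> \<zeta>0 A_nz \<tau>'(1) by (simp add: q1_def q_def h_over_G_reg_def power2_eq_square)
  define a1 where "a1 = (- (real k + 1) * (\<alpha> * \<tau> - 1)\<^sup>2 + 2 * real k * (\<alpha> * \<tau> - 1)
      - 2 * real k * ((\<alpha> * \<tau> - 1)\<^sup>2 / (\<tau>\<^sup>2 - 1))) / ((real k)\<^sup>2 * \<alpha> * (\<tau>\<^sup>2 - 1)\<^sup>2)"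
  define a2 where "a2 = \<tau>\<^sup>2 * ((real k + 1) * (\<tau> - \<alpha>)\<^sup>2 + 2 * real k * \<alpha> * (\<tau> - \<alpha>)
      - 2 * real k * ((\<tau> - \<alpha>)\<^sup>2 / (\<tau>\<^sup>2 - 1))) / ((real k)\<^sup>2 * \<alpha> * (\<tau>\<^sup>2 - 1)\<^sup>2)"
  define a3 where "a3 = \<tau>\<^sup>2 * ((\<alpha> * \<tau> - 1)\<^sup>2 + (\<tau> - \<alpha>)\<^sup>2) / (real k * \<alpha> * (\<tau>\<^sup>2 - 1) ^ 3)"
  have d1: "deriv q1 0 = of_real a1 / \<zeta>" unfolding q1_def q_def[abs_def] dd(1) a1_def by simp
  have d2: "deriv q2 0 = \<zeta> * of_real a2" unfolding q2_def q_def[abs_def] dd(2) a2_def by simp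
  have d3: "deriv \<eta> 0 = of_real a3" unfolding \<eta>_def q_def[abs_def] dd(3) a3_def by simp
  have "a1 + s * a2 = balance (real k) \<alpha> \<tau> s / ((real k)\<^sup>2 * \<alpha> * (\<tau>\<^sup>2 - 1)\<^sup>2)"
    unfolding a1_def a2_def balance_def by (simp add: add_divide_distrib mult.assoc)
  then have a12: "a1 = - (s * a2)" using \<tau>'(5) by simp
  have "cnj (deriv q1 0) = - deriv q2 0"
  proof -
    have "cnj (deriv q1 0) = - (of_real s * of_real a2) / cnj \<zeta>" unfolding d1 a12 by simp
    also have "\<dots> = - \<zeta> * of_real a2" unfolding \<tau>'(9)[OF \<zeta>, symmetric] using \<zeta>0 by simp
    finally show ?thesis unfolding d2 by simp
  qed
  moreover have "Im (deriv \<eta> 0) = 0" unfolding d3 by simp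
  ultimately have "end_expansion (Fin \<zeta>) \<delta> q1 q2 \<eta>"
    unfolding end_expansion_def using \<delta>(1) hol q10 mem q_eq dc by simp
  moreover have "sgn (Re (deriv \<eta> 0)) = sgn (\<tau>\<^sup>2 - 1)"
  proof -
    have "\<tau>\<^sup>2 * ((\<alpha> * \<tau> - 1)\<^sup>2 + (\<tau> - \<alpha>)\<^sup>2) > 0" using \<tau>'(1,4) by (intro mult_pos_pos add_nonneg_pos) auto
    moreover have "real k * \<alpha> > 0" using k \<alpha> by simp
    moreover have "sgn (p / (q * x ^ 3)) = sgn x" if "p > 0" "q > 0" for p q x :: real
      using that by (cases x "0::real" rule: linorder_cases)
        (auto simp: divide_less_0_iff mult_less_0_iff)
    ultimately show ?thesis unfolding d3 a3_def Re_complex_of_real by blast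
  qed
  ultimately show thesis by (rule that)
qed

lemma catenoid_value_roots:
  "z ^ k = B \<Longrightarrow> catenoid_value (b ^ k) (b\<^sup>2)" "z ^ k = 1 / B \<Longrightarrow> catenoid_value (1 / b ^ k) (1 / b\<^sup>2)"
  by (simp_all add: catenoid_value_def)

sublocale weierstrass_ends P G H3 H1 H2 Z
proof
  fix p assume "p \<in> P"
  then consider "p = Fin 0" | "p = Infty" | z where "p = Fin z" "z ^ k = B" | z where "p = Fin z" "z ^ k = 1 / B"
    unfolding P_def by blast
  then show "\<exists>\<delta> q1 q2 \<eta>. end_expansion p \<delta> q1 q2 \<eta>"
  proof cases
    case 1 then show ?thesis using end_expansion_zero by blast
  next
    case 2 then show ?thesis using end_expansion_infinity by blast
  next
    case 3 then show ?thesis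
      using end_expansion_root[of "b ^ k" "b\<^sup>2" z] catenoid_value_def by metis
  next
    case 4 
    then have "z ^ k = of_real (1 / b ^ k)" by simp
    then show ?thesis
      using 4 end_expansion_root[of "1 / b ^ k" "1 / b\<^sup>2" z] catenoid_value_def by metis
  qed
qed

lemma isCont_G:
  assumes "A * z ^ k - 1 \<noteq> 0"
  shows "isCont G z"
  unfolding G_def[abs_def] using assms by (intro continuous_intros)

lemma limit_normal_Fin:
  assumes "A * z ^ k - 1 \<noteq> 0"
  shows "limit_normal G (Fin z) (inv_stereographic (G z))"
proof -
  have "isCont (\<lambda>x. inv_stereographic (G x)) z"
    using isCont_o2[OF isCont_G[OF assms] continuous_inv_stereographic] .
  then show ?thesis unfolding limit_normal_def isCont_def chart.simps by (rule LIM_offset_zero)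
qed

text \<open>\<open>G\<close> has a pole at infinity, so its reciprocal is used as in \<open>inv_stereographic_inverse\<close>.\<close>

lemma limit_normal_Infty: "limit_normal G Infty (vector [0, 0, 1])"
proof -
  define g where "g w = (w ^ k * w) * (w ^ k - A) / (A * w ^ k - 1)" for w :: complex
  have ev: "\<forall>\<^sub>F w in at 0. G (inverse w) = inverse (g w) \<and> g w \<noteq> 0"
    unfolding eventually_at
  proof (intro exI[of _ b] conjI ballI impI b(1))
    fix w :: complex assume "w \<noteq> 0 \<and> dist w 0 < b"
    then have w: "w \<noteq> 0" "cmod w < b" by auto
    define u where "u = w ^ k"
    note u = power_small[OF w(2), folded u_def]
    have u0: "u \<noteq> 0" using w by (simp add: u_def)
    have ck: "(inverse w) ^ k = 1 / u" "(inverse w) ^ (k + 1) = 1 / (u * w)" 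
      by (simp_all add: u_def inverse_eq_divide power_one_over)
    show "g w \<noteq> 0" using u u0 w by (simp add: g_def u_def[symmetric])
    have f: "1 / u - A = - (A * u - 1) / u" "A * (1 / u) - 1 = - (u - A) / u"
      using u0 by (simp_all add: field_simps)
    show "G (inverse w) = inverse (g w)"
      unfolding G_def g_def ck f u_def[symmetric] using u u0 w by (simp add: divide_simps) (simp add: algebra_simps)
  qed
  have g0: "(g \<longlongrightarrow> 0) (at 0)"
  proof -
    have "isCont g 0" unfolding g_def[abs_def] using k by (intro continuous_intros) (simp add: power_0_left)
    then show ?thesis by (simp add: isCont_def g_def)
  qed
  have lim: "((\<lambda>w. inv_stereographic (g w)) \<longlongrightarrow> inv_stereographic 0) (at 0)"
    by (rule isCont_tendsto_compose[OF continuous_inv_stereographic g0])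
  note comp = tendsto_vec_nth[OF lim]
  have z: "inv_stereographic 0 $ 1 = 0" "inv_stereographic 0 $ 2 = 0" "inv_stereographic 0 $ 3 = - 1"
    by (simp_all add: inv_stereographic_nth)
  have "((\<lambda>w. inv_stereographic (G (inverse w)) $ 1) \<longlongrightarrow> 0) (at 0)"
    using comp[of 1] unfolding z
    by (rule Lim_transform_eventually) (use ev in \<open>eventually_elim, simp add: inv_stereographic_inverse\<close>)
  moreover have "((\<lambda>w. inv_stereographic (G (inverse w)) $ 2) \<longlongrightarrow> 0) (at 0)"
    using tendsto_minus[OF comp[of 2]] unfolding z minus_zero
    by (rule Lim_transform_eventually) (use ev in \<open>eventually_elim, simp add: inv_stereographic_inverse\<close>)
  moreover have "((\<lambda>w. inv_stereographic (G (inverse w)) $ 3) \<longlongrightarrow> 1) (at 0)"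
    using tendsto_minus[OF comp[of 3]] unfolding z minus_minus
    by (rule Lim_transform_eventually) (use ev in \<open>eventually_elim, simp add: inv_stereographic_inverse\<close>)
  ultimately have "((\<lambda>w. inv_stereographic (G (inverse w)) $ j) \<longlongrightarrow> vector [0, 0, 1] $ j) (at 0)" for j
    using exhaust_3[of j] by auto
  then show ?thesis unfolding limit_normal_def chart_eq by (intro vec_tendstoI)
qed

context
  fixes z0 assumes z0: "z0 \<in> \<Sigma>"
begin

abbreviation surface :: "complex \<Rightarrow> real^3" where "surface \<equiv> weierstrass_map P G H3 z0"

lemma planar_end_zero: "horizontal_planar_end P G surface (Fin 0)"
proof -
  have "limit_normal G (Fin 0) (inv_stereographic (G 0))" using k by (intro limit_normal_Fin) (simp add: power_0_left)
  moreover have "vertical (inv_stereographic (G 0))"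
    by (simp add: vertical_def inv_stereographic_def G_def)
  ultimately show ?thesis
    unfolding horizontal_planar_end_def
    using planar_end_expansion[OF end_expansion_zero(1) _ _ z0 end_expansion_zero(2-4)] by (auto simp: P_def)
qed

lemma planar_end_infinity: "horizontal_planar_end P G surface Infty"
  unfolding horizontal_planar_end_def
  using planar_end_expansion[OF end_expansion_infinity(1) _ limit_normal_Infty z0 end_expansion_infinity(2-4)]
  by (auto simp: P_def vertical_def)

lemma catenoid_end_root:
  assumes \<tau>: "catenoid_value \<tau> s" and \<zeta>: "\<zeta> ^ k = of_real \<tau>"
  shows "\<exists>N \<nu>. catenoid_end P G surface (Fin \<zeta>) N \<and> \<not> vertical N \<and> points_in_direction surface (Fin \<zeta>) N \<nu> \<and> sgn (\<nu> $ 3) = sgn (1 - \<tau>\<^sup>2)"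
proof -
  note \<tau>' = catenoid_valueD[OF \<tau>]
  have nz: "\<zeta> \<noteq> 0" using \<zeta> \<tau>'(1) k by (auto simp: power_0_left)
  have N: "A * of_real \<tau> - 1 \<noteq> 0" using \<tau>'(3) by (metis eq_iff_diff_eq_0 of_real_1 of_real_eq_iff of_real_mult)
  have lim: "limit_normal G (Fin \<zeta>) (inv_stereographic (G \<zeta>))" by (rule limit_normal_Fin) (simp only: \<zeta> N not_False_eq_True)
  have "G \<zeta> \<noteq> 0" unfolding G_def \<zeta> using nz N \<tau>'(4) by simp
  then have nv: "\<not> vertical (inv_stereographic (G \<zeta>))" using vertical_inv_stereographic by blast
  obtain \<delta> q1 q2 \<eta> where e: "end_expansion (Fin \<zeta>) \<delta> q1 q2 \<eta>" and sg: "sgn (Re (deriv \<eta> 0)) = sgn (\<tau>\<^sup>2 - 1)"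
    using end_expansion_root[OF \<tau> \<zeta>] by blast
  have "Re (deriv \<eta> 0) \<noteq> 0" using sg \<tau>'(2) by (metis eq_iff_diff_eq_0 sgn_0_0)
  from catenoid_end_expansion[OF e \<tau>'(10)[OF \<zeta>] lim z0 this] nv
  show ?thesis unfolding sg by (metis minus_diff_eq sgn_minus)
qed

lemma upward_end: "z ^ k = B \<Longrightarrow> upward_nonvertical_catenoid_end P G surface (Fin z)"
proof -
  assume z: "z ^ k = B"
  have "sgn (1 - (b ^ k)\<^sup>2) = 1" using \<beta> power_strict_mono[of "b ^ k" 1 2] by simp
  then show ?thesis
    using catenoid_end_root[OF catenoid_value_roots(1)[OF z] z]
    unfolding upward_nonvertical_catenoid_end_def by (metis sgn_1_pos)
qed

lemma downward_end: "z ^ k = 1 / B \<Longrightarrow> downward_nonvertical_catenoid_end P G surface (Fin z)"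
proof -
  assume z: "z ^ k = 1 / B"
  then have z': "z ^ k = of_real (1 / b ^ k)" by simp
  have "1 / b ^ k > 1" using \<beta> by simp
  then have "sgn (1 - (1 / b ^ k)\<^sup>2) = - 1" using power_strict_mono[of 1 "1 / b ^ k" 2] by simp
  then show ?thesis
    using catenoid_end_root[OF catenoid_value_roots(2)[OF z] z']
    unfolding downward_nonvertical_catenoid_end_def by (metis sgn_1_neg)
qed

end

text \<open>\<open>\<alpha>\<^sup>2 \<noteq> 1\<close> keeps the roots of \<open>z ^ k = \<alpha>\<close> apart from those of \<open>z ^ k = 1 / \<alpha>\<close>: the former are simple
zeros and the latter simple poles of \<open>G\<close>, and both are simple zeros of \<open>h\<close>.\<close>

lemma orders:
  assumes p: "p \<in> \<Sigma>"
  obtains g h where "has_order_at G p g" "has_order_at H3 p h" "(g = 1 \<and> h = 1) \<or> (g = - 1 \<and> h = 1) \<or> (g = 0 \<and> h = 0)"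
proof -
  have p': "p \<noteq> 0" "p ^ k - B \<noteq> 0" "B * p ^ k - 1 \<noteq> 0" using p mem_Sigma by auto
  have rf: "root_factor k p p \<noteq> 0" using p' k by (intro root_factor_nonzero) simp
  have \<Sigma>': "w \<noteq> 0" "w ^ k - B \<noteq> 0" "B * w ^ k - 1 \<noteq> 0" if "w \<in> \<Sigma>" for w using that mem_Sigma by auto
  have AA: "A * A \<noteq> 1"
  proof -
    have "\<alpha> * \<alpha> > 1 * 1" using \<alpha> by (intro mult_strict_mono) auto
    then show ?thesis by (metis less_irrefl mult_1 of_real_1 of_real_eq_iff of_real_mult)
  qed
  consider (zero) "p ^ k = A" | (pole) "A * p ^ k = 1" | (regular) "p ^ k - A \<noteq> 0" "A * p ^ k - 1 \<noteq> 0" by force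
  then show thesis
  proof cases
    case zero
    have "has_order_at G p 1"
    proof (rule has_order_atI)
      show "open (\<Sigma> \<inter> {w. A * w ^ k - 1 \<noteq> 0})"
        by (intro open_Int open_Sigma open_Collect_neq continuous_intros)
      show "p \<in> \<Sigma> \<inter> {w. A * w ^ k - 1 \<noteq> 0}" using p zero AA by simp
      show "(\<lambda>z. z ^ (k + 1) * root_factor k p z / (A * z ^ k - 1)) holomorphic_on \<Sigma> \<inter> {w. A * w ^ k - 1 \<noteq> 0}"
        by (auto intro!: holomorphic_intros)
      show "p ^ (k + 1) * root_factor k p p / (A * p ^ k - 1) \<noteq> 0" using p' rf zero AA A_nz by simp
      show "G w = w ^ (k + 1) * root_factor k p w / (A * w ^ k - 1) * (w - p) powi 1" for w
        unfolding G_def zero[symmetric] root_factor by simp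
    qed
    moreover have "has_order_at H3 p 1"
    proof (rule has_order_atI[OF open_Sigma p])
      let ?h = "\<lambda>z. B\<^sup>2 * z ^ (k - 1) * root_factor k p z * (A * z ^ k - 1) / (A * (z ^ k - B)\<^sup>2 * (B * z ^ k - 1)\<^sup>2)"
      show "?h holomorphic_on \<Sigma>" using \<Sigma>' A_nz by (auto intro!: holomorphic_intros)
      show "?h p \<noteq> 0" using p' rf zero AA A_nz B_nz by simp
      show "H3 w = ?h w * (w - p) powi 1" for w
        unfolding h_form_def by (subst (1) zero[symmetric]) (simp add: root_factor)
    qed
    ultimately show ?thesis using that by blast
  next
    case pole
    have pk: "p ^ k = 1 / A" using pole A_nz by (simp add: field_simps)
    have fac: "A * w ^ k - 1 = A * ((w - p) * root_factor k p w)" for w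
      using root_factor[of w k p] A_nz unfolding pk by (simp add: field_simps)
    have pA: "p ^ k - A \<noteq> 0" unfolding pk using A_nz AA by (simp add: field_simps)
    have "has_order_at G p (- 1)"
    proof (rule has_order_atI)
      show "open {w. root_factor k p w \<noteq> 0}"
        unfolding root_factor_def by (intro open_Collect_neq continuous_intros)
      show "p \<in> {w. root_factor k p w \<noteq> 0}" using rf by simp
      show "(\<lambda>z. z ^ (k + 1) * (z ^ k - A) / (A * root_factor k p z)) holomorphic_on {w. root_factor k p w \<noteq> 0}"
        using A_nz by (auto intro!: holomorphic_intros)
      show "p ^ (k + 1) * (p ^ k - A) / (A * root_factor k p p) \<noteq> 0" using p' rf pA A_nz by simp
      show "G w = w ^ (k + 1) * (w ^ k - A) / (A * root_factor k p w) * (w - p) powi (- 1)" for w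
        unfolding G_def fac by (simp add: power_int_minus field_simps)
    qed
    moreover have "has_order_at H3 p 1"
    proof (rule has_order_atI[OF open_Sigma p])
      let ?h = "\<lambda>z. B\<^sup>2 * z ^ (k - 1) * (z ^ k - A) * (A * root_factor k p z) / (A * (z ^ k - B)\<^sup>2 * (B * z ^ k - 1)\<^sup>2)"
      show "?h holomorphic_on \<Sigma>" using \<Sigma>' A_nz by (auto intro!: holomorphic_intros)
      show "?h p \<noteq> 0" using p' rf pA A_nz B_nz by simp
      show "H3 w = ?h w * (w - p) powi 1" for w
        unfolding h_form_def fac by simp
    qed
    ultimately show ?thesis using that by blast
  next
    case regular
    have "has_order_at G p 0"
    proof (rule has_order_atI)
      show "open (\<Sigma> \<inter> {w. A * w ^ k - 1 \<noteq> 0})"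
        by (intro open_Int open_Sigma open_Collect_neq continuous_intros)
      show "p \<in> \<Sigma> \<inter> {w. A * w ^ k - 1 \<noteq> 0}" using p regular by simp
      show "G holomorphic_on \<Sigma> \<inter> {w. A * w ^ k - 1 \<noteq> 0}"
        unfolding G_def[abs_def] by (auto intro!: holomorphic_intros)
      show "G p \<noteq> 0" unfolding G_def using p' regular by simp
    qed simp
    moreover have "has_order_at H3 p 0"
      by (rule has_order_atI[OF open_Sigma p holomorphic_H(3)]) (use p' regular A_nz B_nz in \<open>auto simp: h_form_def\<close>)
    ultimately show ?thesis using that by blast
  qed
qed

lemma meromorphic_G: "meromorphic_fun_on_sphere G"
  unfolding meromorphic_fun_on_sphere_def
proof
  fix p show "(\<lambda>w. G (chart p w)) meromorphic_on {0}"
    by (cases p) (auto simp: G_def intro!: meromorphic_intros)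
qed

lemma meromorphic_H3: "meromorphic_form_on_sphere H3"
  unfolding meromorphic_form_on_sphere_def
proof
  fix p
  have "deriv (chart p) meromorphic_on {0}"
    by (cases p) (auto simp: chart_eq intro!: meromorphic_intros)
  moreover have "(\<lambda>w. H3 (chart p w)) meromorphic_on {0}"
    by (cases p) (auto simp: h_form_def intro!: meromorphic_intros)
  ultimately show "(\<lambda>w. H3 (chart p w) * deriv (chart p) w) meromorphic_on {0}"
    by (rule meromorphic_on_mult[rotated])
qed

theorem weierstrass_data_ring: "weierstrass_data P G H3"
  unfolding weierstrass_data_def
proof (intro conjI allI impI ballI)
  show "(has_order_at G p n \<or> has_order_at G p (- n)) \<longleftrightarrow> has_order_at H3 p n" if pn: "p \<in> \<Sigma>" "n > 0" for p n
  proof -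
    obtain g h where "has_order_at G p g" "has_order_at H3 p h"
      and gh: "(g = 1 \<and> h = 1) \<or> (g = - 1 \<and> h = 1) \<or> (g = 0 \<and> h = 0)" using orders[OF pn(1)] by blast
    then show ?thesis using pn(2) by (auto simp: has_order_at_unique)
  qed
qed (use finP InftyP meromorphic_G meromorphic_H3 weierstrass_integral_closed holomorphic_H in auto)

end

theorem theorem3p2:
  fixes k :: nat and b :: real
  assumes "k > 1" and "0 < b" and "b < 1"
  shows "\<exists>a::real. a > 0 \<and>
    (let A = complex_of_real a; B = complex_of_real b;
         G = (\<lambda>z. z ^ (k + 1) * (z ^ k - A ^ k) / (A ^ k * z ^ k - 1));
         h = (\<lambda>z. B ^ (2 * k) * z ^ (k - 1) * (z ^ k - A ^ k) * (A ^ k * z ^ k - 1) /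
                   (A ^ k * (z ^ k - B ^ k)\<^sup>2 * (B ^ k * z ^ k - 1)\<^sup>2));
         P = {Fin 0, Infty} \<union> Fin ` {z. z ^ k = B ^ k} \<union> Fin ` {z. z ^ k = 1 / B ^ k}
     in weierstrass_data P G h \<and>
        (\<forall>z0\<in>punctured_sphere P.
           let X = weierstrass_map P G h z0 in
             horizontal_planar_end P G X (Fin 0) \<and>
             horizontal_planar_end P G X Infty \<and>
             (\<forall>z. z ^ k = B ^ k \<longrightarrow> upward_nonvertical_catenoid_end P G X (Fin z)) \<and>
             (\<forall>z. z ^ k = 1 / B ^ k \<longrightarrow> downward_nonvertical_catenoid_end P G X (Fin z))))"
proof -
  have "0 < b ^ k" "b ^ k < 1" "0 < b\<^sup>2" "b\<^sup>2 < 1" using assms by (auto simp: power_less_one_iff)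
  then obtain \<alpha> where \<alpha>: "1 < \<alpha>" "\<alpha> * b ^ k < 1" "balance (real k) \<alpha> (b ^ k) (b\<^sup>2) = 0"
    using exists_balanced_parameter[of "b ^ k" "b\<^sup>2" "real k"] assms by auto
  interpret R: catenoid_ring k b \<alpha> by unfold_locales (use assms \<alpha> in auto)
  define a where "a = root k \<alpha>"
  have a: "a > 0" "a ^ k = \<alpha>" using assms \<alpha> by (simp_all add: a_def)
  have A: "complex_of_real a ^ k = complex_of_real \<alpha>" using a by (metis of_real_power)
  have B: "complex_of_real b ^ k = complex_of_real (b ^ k)" "complex_of_real b ^ (2 * k) = (complex_of_real (b ^ k))\<^sup>2"
    by (simp_all add: mult.commute flip: power_mult)
  have G: "(\<lambda>z. z ^ (k + 1) * (z ^ k - complex_of_real \<alpha>) / (complex_of_real \<alpha> * z ^ k - 1)) = R.G"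
    by (simp add: R.G_def fun_eq_iff)
  have P: "{Fin 0, Infty} \<union> Fin ` {z. z ^ k = complex_of_real (b ^ k)} \<union> Fin ` {z. z ^ k = 1 / complex_of_real (b ^ k)} = R.P"
    by (simp add: R.P_def)
  have H: "(\<lambda>z. (complex_of_real (b ^ k))\<^sup>2 * z ^ (k - 1) * (z ^ k - complex_of_real \<alpha>) * (complex_of_real \<alpha> * z ^ k - 1) /
      (complex_of_real \<alpha> * (z ^ k - complex_of_real (b ^ k))\<^sup>2 * (complex_of_real (b ^ k) * z ^ k - 1)\<^sup>2))
      = h_form k (complex_of_real \<alpha>) (complex_of_real (b ^ k))"
    by (simp add: h_form_def fun_eq_iff)
  let ?X = "weierstrass_map R.P R.G R.H3"
  have "weierstrass_data R.P R.G R.H3 \<and> (\<forall>z0\<in>punctured_sphere R.P.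
      horizontal_planar_end R.P R.G (?X z0) (Fin 0) \<and> horizontal_planar_end R.P R.G (?X z0) Infty \<and>
      (\<forall>z. z ^ k = complex_of_real (b ^ k) \<longrightarrow> upward_nonvertical_catenoid_end R.P R.G (?X z0) (Fin z)) \<and>
      (\<forall>z. z ^ k = 1 / complex_of_real (b ^ k) \<longrightarrow> downward_nonvertical_catenoid_end R.P R.G (?X z0) (Fin z)))"
    using R.weierstrass_data_ring R.planar_end_zero R.planar_end_infinity R.upward_end R.downward_end by blast
  then show ?thesis
    by (intro exI[of _ a]) (simp only: Let_def A B G P H a(1) simp_thms, blast)
qed

end
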